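(* Let $G$ be a finite group and let $N$ be a nonsolvable normal subgroup of $G$. Then $T(G)\geq 6\,T(G/N)$.
   Context: For a finite group $H$, $\mathrm{Irr}(H)$ denotes the set of complex irreducible characters of $H$, and $T(H)=\sum_{\chi\in\mathrm{Irr}(H)}\chi(1)$ denotes the sum of the degrees of the complex irreducible characters of $H$. *)

theory Defs
  imports "HOL-Algebra.Solvable_Groups" "Jordan_Normal_Form.VS_Connect"
begin

definition GL :: "nat \<Rightarrow> complex mat monoid" where
  "GL n = units_of (ring_mat TYPE(complex) n ())"

definition representation :: "('a, 'b) monoid_scheme \<Rightarrow> nat \<Rightarrow> ('a \<Rightarrow> complex mat) \<Rightarrow> bool" where
  "representation G n \<rho> \<longleftrightarrow> \<rho> \<in> hom G (GL n)"

definition invariant_subspace ::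
  "('a, 'b) monoid_scheme \<Rightarrow> nat \<Rightarrow> ('a \<Rightarrow> complex mat) \<Rightarrow> complex vec set \<Rightarrow> bool" where
  "invariant_subspace G n \<rho> W \<longleftrightarrow>
     subspace class_ring W (module_vec TYPE(complex) n) \<and>
     (\<forall>g \<in> carrier G. \<forall>w \<in> W. \<rho> g *\<^sub>v w \<in> W)"

definition irreducible_representation ::
  "('a, 'b) monoid_scheme \<Rightarrow> nat \<Rightarrow> ('a \<Rightarrow> complex mat) \<Rightarrow> bool" where
  "irreducible_representation G n \<rho> \<longleftrightarrow>
     representation G n \<rho> \<and> n > 0 \<and>
     (\<forall>W. invariant_subspace G n \<rho> W \<longrightarrow> W = {0\<^sub>v n} \<or> W = carrier_vec n)"

definition mat_trace :: "'a::comm_monoid_add mat \<Rightarrow> 'a" where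
  "mat_trace A = (\<Sum>i<dim_row A. A $$ (i, i))"

text \<open>Characters are functions on the carrier only: restricting makes them \<open>undefined\<close> elsewhere,
  so that distinct elements of \<open>Irr G\<close> differ at some group element.\<close>

definition character_of ::
  "('a, 'b) monoid_scheme \<Rightarrow> ('a \<Rightarrow> complex mat) \<Rightarrow> 'a \<Rightarrow> complex" where
  "character_of G \<rho> = restrict (\<lambda>g. mat_trace (\<rho> g)) (carrier G)"

definition Irr :: "('a, 'b) monoid_scheme \<Rightarrow> ('a \<Rightarrow> complex) set" where
  "Irr G = {character_of G \<rho> | n \<rho>. irreducible_representation G n \<rho>}"

text \<open>The values \<open>\<chi> \<one>\<close> are complex numbers that are positive integers (see
  \<open>Irr_degree\<close> below), so taking real parts only serves to make the sum an ordered quantity.\<close>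

definition degree_sum :: "('a, 'b) monoid_scheme \<Rightarrow> real" where
  "degree_sum G = (\<Sum>\<chi> \<in> Irr G. Re (\<chi> \<one>\<^bsub>G\<^esub>))"

lemma group_GL: "group (GL n)"
proof -
  interpret R: semiring "ring_mat TYPE(complex) n ()"
    by (rule semiring_mat)
  show ?thesis
    unfolding GL_def by (rule R.units_group)
qed

lemma character_of_one:
  assumes "group G" and "representation G n \<rho>"
  shows "character_of G \<rho> \<one>\<^bsub>G\<^esub> = of_nat n"
proof -
  have "group_hom G (GL n) \<rho>"
    using assms group_GL
    by (simp add: group_hom_def group_hom_axioms_def representation_def)
  then have "\<rho> \<one>\<^bsub>G\<^esub> = 1\<^sub>m n"
    using group_hom.hom_one[of G "GL n" \<rho>] by (simp add: GL_def units_of_one ring_mat_simps)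
  moreover have "\<one>\<^bsub>G\<^esub> \<in> carrier G"
    using assms(1) by (simp add: group.is_monoid monoid.one_closed)
  ultimately show ?thesis
    by (simp add: character_of_def mat_trace_def)
qed

lemma Irr_degree:
  assumes "group G" and "\<chi> \<in> Irr G"
  shows "\<exists>n > 0. \<chi> \<one>\<^bsub>G\<^esub> = of_nat n"
  using assms by (auto simp: Irr_def irreducible_representation_def character_of_one)

end

theory Submission
  imports Defs "Jordan_Normal_Form.Spectral_Radius" "HOL-Algebra.Sylow" "HOL-Algebra.Group_Action"
    "HOL-Computational_Algebra.Primes"
begin

text \<open>
  Replacing \<open>N\<close> by the last term \<open>D\<close> of its derived series, which is perfect and normal in \<open>G\<close>, does not
  decrease \<open>T(G/N)\<close>. Some prime \<open>p \<ge> 5\<close> has a Sylow subgroup \<open>P\<close> of \<open>D\<close> that is not normal in \<open>D\<close>: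
  otherwise a simple quotient of \<open>D\<close> would be a perfect \<open>{2,3}\<close>-group. Such a group does not exist by the
  character theoretic argument of Burnside; as the central element of a Sylow 2-subgroup can be taken
  to be an involution \<open>z\<close>, all values \<open>\<chi>(z)\<close> are integers and no Galois theory is needed.

  Put \<open>H = N\<^sub>G(P)\<close> and \<open>M = H \<inter> D\<close>. Then \<open>G = HD\<close>, and each nontrivial orbit of \<open>M\<close> on \<open>D/M\<close> has length
  divisible by \<open>p\<close>. Comparing degree and rank of the permutation character \<open>1\<^sub>M\<^sup>D\<close>
  yields a nontrivial \<open>\<theta> \<in> Irr(D)\<close> with \<open>m = [\<theta>\<^sub>M, 1] > 0\<close> and \<open>\<theta>(1) \<ge> p m\<close>. Each \<open>\<beta> \<in> Irr(G/D)\<close> occurs in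
  the restriction to \<open>H\<close> of some \<open>\<chi> \<in> Irr(G)\<close> over \<open>\<theta>\<close>, and for these \<open>\<chi>\<close> the degree is \<open>\<theta>(1)/m\<close> times the
  dimension of the space of \<open>M\<close>-fixed vectors. So the irreducible characters over \<open>\<theta>\<close> contribute at least \<open>p T(G/D)\<close>
  to \<open>T(G)\<close>. In this way neither an extension of \<open>\<theta>\<close> to \<open>G\<close> nor the classification of finite simple groups
  is needed.
\<close>

section \<open>Matrices and adapted bases\<close>

text \<open>The obstacle is that \<theta> need not be \<open>G\<close>-invariant. The way round it
  is to count \<open>M\<close>-fixed vectors. \<open>H\<close> normalizes \<open>M\<close>, so the
  \<open>M\<close>-fixed vectors of \<chi> form a module for \<open>H/M\<close>, which is isomorphic
  to \<open>G/D\<close>. Since every element of \<open>G\<close> is an element of \<open>D\<close>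
  times one of \<open>H\<close>, all \<open>G\<close>-conjugates of \<theta> contain the trivial
  character of \<open>M\<close> equally often. Hence the ratio of degree to fixed space is
  \<theta>(1)/m for every \<chi> over \<theta>, invariant or not.

  The existence of \<theta> is an averaging argument. Over the nontrivial constituents of the
  permutation character, the sum of m \<theta>(1) is the degree minus 1 and the sum of m^2 is the
  rank minus 1. Orbit lengths divisible by \<open>p\<close> make the second sum at most 1/p of the
  first.

  The constant 6 is 1 + 5: characters with \<open>D\<close> in the kernel contribute T(G/D), those
  over \<theta> at least p T(G/D), and the two sets are disjoint because \<theta> is nontrivial. The
  primes 2 and 3 would give only 3 and 4, which is why {2,3}-groups have to be excluded.\<close>

lemma mat_trace_comm:
  fixes A B :: "'a::comm_semiring_0 mat"
  assumes A: "A \<in> carrier_mat n m" and B: "B \<in> carrier_mat m n"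
  shows "mat_trace (A * B) = mat_trace (B * A)"
proof -
  have "mat_trace (A * B) = (\<Sum>i<n. \<Sum>j<m. A $$ (i,j) * B $$ (j,i))"
    using A B by (simp add: mat_trace_def scalar_prod_def lessThan_atLeast0)
  also have "\<dots> = (\<Sum>j<m. \<Sum>i<n. B $$ (j,i) * A $$ (i,j))"
    by (subst sum.swap) (simp add: mult.commute)
  also have "\<dots> = mat_trace (B * A)"
    using A B by (simp add: mat_trace_def scalar_prod_def lessThan_atLeast0)
  finally show ?thesis .
qed

lemma mat_unit_vec_col:
  fixes A :: "'a::semiring_1 mat"
  assumes "A \<in> carrier_mat n m" and "j < m"
  shows "A *\<^sub>v unit_vec m j = col A j"
proof (rule eq_vecI)
  fix i assume "i < dim_vec (col A j)"
  then have i: "i < n" using assms by simp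
  have "(A *\<^sub>v unit_vec m j) $ i = (\<Sum>k<m. if k = j then A $$ (i,k) else 0)"
    using assms i by (simp add: scalar_prod_def unit_vec_def lessThan_atLeast0 if_distrib cong: if_cong)
  then show "(A *\<^sub>v unit_vec m j) $ i = col A j $ i" using assms i by simp
qed (use assms in auto)

lemma det_nonzero_obtains_inverse:
  fixes P :: "'a::field mat"
  assumes "P \<in> carrier_mat n n" and "det P \<noteq> 0"
  obtains Q where "Q \<in> carrier_mat n n" "P * Q = 1\<^sub>m n" "Q * P = 1\<^sub>m n"
  using det_non_zero_imp_unit[OF assms, of "()"]
  by (auto simp: Units_def ring_mat_simps)

text \<open>Exchange step in matrix form: \<open>E\<close> is the identity with columns
  \<open>k\<close> and \<open>i\<close> swapped and column \<open>k\<close> then overwritten by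
  \<open>u\<close>. Row \<open>i\<close> of \<open>E v = 0\<close> forces \<open>v $ k = 0\<close>
  because \<open>u $ i\<close> is nonzero, row \<open>k\<close> then forces
  \<open>v $ i = 0\<close>, and the other rows are trivial.\<close>

lemma det_replace_col_nonzero:
  fixes u :: "'a::field vec"
  assumes u: "u \<in> carrier_vec n" and k: "k < n" and i: "i < n" and ui: "u $ i \<noteq> 0"
  defines "E \<equiv> mat n n (\<lambda>(a,b). if b = k then u $ a else if b = i then (if a = k then 1 else 0)
      else (if a = b then 1 else 0))"
  shows "det E \<noteq> 0"
proof
  have E: "E \<in> carrier_mat n n" by (simp add: E_def)
  assume "det E = 0"
  then obtain v where v: "v \<in> carrier_vec n" "v \<noteq> 0\<^sub>v n" "E *\<^sub>v v = 0\<^sub>v n"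
    using det_0_iff_vec_prod_zero_field[OF E] by blast
  have e: "(\<Sum>b<n. E $$ (a,b) * v $ b) = 0" if "a < n" for a
    using arg_cong[OF v(3), of "\<lambda>w. w $ a"] that E v(1)
    by (simp add: scalar_prod_def lessThan_atLeast0 row_def)
  have split: "(\<Sum>b<n. E $$ (a,b) * v $ b) = u $ a * v $ k
      + (if i \<noteq> k \<and> a = k then v $ i else 0) + (if a \<noteq> k \<and> a \<noteq> i then v $ a else 0)" if a: "a < n" for a
  proof -
    have "(\<Sum>b<n. E $$ (a,b) * v $ b) = (\<Sum>b<n. (if b = k then u $ a * v $ k else 0)
       + (if b = i then (if i \<noteq> k \<and> a = k then v $ i else 0) else 0)
       + (if b = a then (if a \<noteq> k \<and> a \<noteq> i then v $ a else 0) else 0))"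
      by (rule sum.cong) (auto simp: E_def a)
    also have "\<dots> = u $ a * v $ k
      + (if i \<noteq> k \<and> a = k then v $ i else 0) + (if a \<noteq> k \<and> a \<noteq> i then v $ a else 0)"
      using k i a by (simp add: sum.distrib)
    finally show ?thesis .
  qed
  have vk: "v $ k = 0"
    using e[OF i] split[OF i] ui by (auto split: if_splits)
  have vi: "v $ i = 0"
    using e[OF k] split[OF k] vk by (auto split: if_splits)
  have "v $ a = 0" if "a < n" for a
    using e[OF that] split[OF that] vk vi by (auto split: if_splits)
  then have "v = 0\<^sub>v n" using v(1) by auto
  then show False using v(2) by simp
qed

text \<open>Basis extension without dimension theory: \<open>P\<close> is an invertible matrix with
  as many leading columns in \<open>W\<close> as possible. A vector of \<open>W\<close> with a
  nonzero coordinate beyond these could be exchanged into \<open>P\<close>, against maximality. So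
  \<open>W\<close> is exactly the set where the coordinates \<open>Q w\<close> vanish from
  \<open>k\<close> on.\<close>

lemma subspace_adapted_basis:
  fixes W :: "'a::field vec set"
  assumes W: "W \<subseteq> carrier_vec n" and W0: "0\<^sub>v n \<in> W"
    and Wadd: "\<And>v w. v \<in> W \<Longrightarrow> w \<in> W \<Longrightarrow> v + w \<in> W"
    and Wsmult: "\<And>c v. v \<in> W \<Longrightarrow> c \<cdot>\<^sub>v v \<in> W"
  obtains k P Q where "k \<le> n" "P \<in> carrier_mat n n" "Q \<in> carrier_mat n n"
    "P * Q = 1\<^sub>m n" "Q * P = 1\<^sub>m n"
    "W = {w \<in> carrier_vec n. \<forall>i<n. k \<le> i \<longrightarrow> (Q *\<^sub>v w) $ i = 0}"
proof -
  define S where "S k \<longleftrightarrow> k \<le> n \<and> (\<exists>P \<in> carrier_mat n n. det P \<noteq> 0 \<and> (\<forall>j<k. col P j \<in> W))" for k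
  have "S 0" unfolding S_def by (auto intro!: bexI[of _ "1\<^sub>m n"])
  moreover have "\<forall>k. S k \<longrightarrow> k \<le> n" by (simp add: S_def)
  ultimately obtain k where k: "S k" "\<And>k'. S k' \<Longrightarrow> k' \<le> k"
    using ex_has_greatest_nat[of S 0 "\<lambda>x. x" "Suc n"] by (metis le_imp_less_Suc)
  then obtain P where P: "P \<in> carrier_mat n n" "det P \<noteq> 0" "\<And>j. j < k \<Longrightarrow> col P j \<in> W" and kn: "k \<le> n"
    unfolding S_def by blast
  obtain Q where Q: "Q \<in> carrier_mat n n" "P * Q = 1\<^sub>m n" "Q * P = 1\<^sub>m n"
    using det_nonzero_obtains_inverse P by blast
  have PQv: "P *\<^sub>v (Q *\<^sub>v w) = w" if "w \<in> carrier_vec n" for w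
    using assoc_mult_mat_vec[OF P(1) Q(1) that] Q(2) that by simp
  have "(Q *\<^sub>v w) $ i = 0" if w: "w \<in> W" and i: "i < n" "k \<le> i" for w i
  proof (rule ccontr)
    assume ne: "(Q *\<^sub>v w) $ i \<noteq> 0"
    define u where "u = Q *\<^sub>v w"
    have u: "u \<in> carrier_vec n" using Q(1) w W unfolding u_def by (auto intro!: mult_mat_vec_carrier)
    have kl: "k < n" using i by simp
    define E where "E = mat n n (\<lambda>(a,b). if b = k then u $ a else if b = i then (if a = k then 1 else 0)
      else (if a = b then 1 else (0::'a)))"
    have E: "E \<in> carrier_mat n n" by (simp add: E_def)
    have dE: "det E \<noteq> 0"
      unfolding E_def using ne by (intro det_replace_col_nonzero u kl i) (simp add: u_def)
    \<comment> \<open>Column \<open>k\<close> of \<open>P * E\<close> is \<open>P u = w\<close>, and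
      the earlier columns of \<open>P\<close> survive because \<open>k \<le> i\<close>.\<close>
    have cols: "col (P * E) j \<in> W" if "j < Suc k" for j
    proof -
      have c: "col (P * E) j = P *\<^sub>v col E j"
        using col_mult2[OF P(1) E, of j] that kl by simp
      show ?thesis
      proof (cases "j = k")
        case True
        then have "col E j = u" using kl u by (auto simp: E_def)
        then show ?thesis using c PQv w W by (auto simp: u_def)
      next
        case False
        then have j: "j < k" using that by simp
        then have "col E j = unit_vec n j" using kl i by (auto simp: E_def unit_vec_def)
        then have "col (P * E) j = col P j" 
          using c P(1) j kl mat_unit_vec_col[OF P(1), of j] by simp
        then show ?thesis using P(3) j by simp
      qed
    qed
    have "S (Suc k)" unfolding S_def
      using P(1,2) E dE cols kl det_mult[OF P(1) E] by (auto intro!: bexI[of _ "P * E"])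
    then show False using k(2) by fastforce
  qed
  moreover have "w \<in> W" if w: "w \<in> carrier_vec n" and z: "\<forall>i<n. k \<le> i \<longrightarrow> (Q *\<^sub>v w) $ i = 0" for w
  proof -
    define u where "u = Q *\<^sub>v w"
    have u: "u \<in> carrier_vec n" using Q(1) w unfolding u_def by (auto intro!: mult_mat_vec_carrier)
    have part: "vec n (\<lambda>a. \<Sum>j<m. P $$ (a,j) * u $ j) \<in> W" if "m \<le> k" for m
      using that
    proof (induction m)
      case 0
      then show ?case using W0 by (simp add: zero_vec_def)
    next
      case (Suc m)
      have "vec n (\<lambda>a. \<Sum>j<Suc m. P $$ (a,j) * u $ j)
        = vec n (\<lambda>a. \<Sum>j<m. P $$ (a,j) * u $ j) + u $ m \<cdot>\<^sub>v col P m"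
        using P(1) Suc.prems kn by (auto simp: mult.commute)
      then show ?case using Suc Wadd Wsmult P(3) by simp
    qed
    have "w = P *\<^sub>v u" using PQv w by (simp add: u_def)
    also have "\<dots> = vec n (\<lambda>a. \<Sum>j<k. P $$ (a,j) * u $ j)"
    proof (rule eq_vecI)
      show "dim_vec (P *\<^sub>v u) = dim_vec (vec n (\<lambda>a. \<Sum>j<k. P $$ (a,j) * u $ j))" using P by simp
      fix a assume "a < dim_vec (vec n (\<lambda>a. \<Sum>j<k. P $$ (a,j) * u $ j))"
      then have a: "a < n" by simp
      have "(P *\<^sub>v u) $ a = (\<Sum>j<n. P $$ (a,j) * u $ j)"
        using P(1) u a by (simp add: scalar_prod_def lessThan_atLeast0)
      also have "\<dots> = (\<Sum>j<k. P $$ (a,j) * u $ j)"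
        using kn z by (intro sum.mono_neutral_right) (auto simp: u_def)
      finally show "(P *\<^sub>v u) $ a = vec n (\<lambda>a. \<Sum>j<k. P $$ (a,j) * u $ j) $ a" using a by simp
    qed
    finally show ?thesis using part by simp
  qed
  ultimately have "W = {w \<in> carrier_vec n. \<forall>i<n. k \<le> i \<longrightarrow> (Q *\<^sub>v w) $ i = 0}"
    using W by blast
  then show thesis using that kn P Q by blast
qed

section \<open>Representations and their characters\<close>

context group
begin

text \<open>Invertibility, which is built into \<open>GL\<close>, comes for free from
  multiplicativity: \<open>\<rho> (inv g)\<close> is the inverse of \<open>\<rho> g\<close>.\<close>

lemma representation_iff:
  "representation G n \<rho> \<longleftrightarrow> (\<forall>g \<in> carrier G. \<rho> g \<in> carrier_mat n n) \<and> \<rho> \<one> = 1\<^sub>m n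
     \<and> (\<forall>g \<in> carrier G. \<forall>h \<in> carrier G. \<rho> (g \<otimes> h) = \<rho> g * \<rho> h)" (is "?L \<longleftrightarrow> ?R")
proof
  assume L: ?L
  have "group_hom G (GL n) \<rho>"
    using L group_GL by (simp add: group_hom_def group_hom_axioms_def representation_def)
  then have "\<rho> \<one> = 1\<^sub>m n"
    using group_hom.hom_one[of G "GL n" \<rho>] by (simp add: GL_def units_of_one ring_mat_simps)
  moreover have "carrier (GL n) \<subseteq> carrier_mat n n"
    by (auto simp: GL_def units_of_def Units_def ring_mat_simps)
  ultimately show ?R
    using L unfolding representation_def hom_def
    by (auto simp: GL_def units_of_def ring_mat_simps)
next
  assume R: ?R
  have "\<rho> g \<in> Units (ring_mat TYPE(complex) n ())" if g: "g \<in> carrier G" for g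
  proof -
    have "\<rho> g * \<rho> (inv g) = 1\<^sub>m n" "\<rho> (inv g) * \<rho> g = 1\<^sub>m n"
      using R g by (metis inv_closed r_inv, metis inv_closed l_inv)
    then show ?thesis using R g by (auto simp: Units_def ring_mat_simps intro!: bexI[of _ "\<rho> (inv g)"])
  qed
  then show ?L using R
    by (auto simp: representation_def hom_def GL_def units_of_def ring_mat_simps)
qed

lemma rep_carrier: "representation G n \<rho> \<Longrightarrow> g \<in> carrier G \<Longrightarrow> \<rho> g \<in> carrier_mat n n"
  and rep_one: "representation G n \<rho> \<Longrightarrow> \<rho> \<one> = 1\<^sub>m n"
  and rep_mult: "representation G n \<rho> \<Longrightarrow> g \<in> carrier G \<Longrightarrow> h \<in> carrier G \<Longrightarrow> \<rho> (g \<otimes> h) = \<rho> g * \<rho> h"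
  by (simp_all add: representation_iff)

lemma rep_mult_entry:
  assumes "representation G n \<rho>" "g \<in> carrier G" "h \<in> carrier G" "i < n" "j < n"
  shows "\<rho> (g \<otimes> h) $$ (i,j) = (\<Sum>k<n. \<rho> g $$ (i,k) * \<rho> h $$ (k,j))"
  using assms rep_carrier[OF assms(1,2)] rep_carrier[OF assms(1,3)]
  by (simp add: rep_mult scalar_prod_def lessThan_atLeast0)

lemma invariant_subspace_iff:
  "invariant_subspace G n \<rho> W \<longleftrightarrow> W \<subseteq> carrier_vec n \<and> 0\<^sub>v n \<in> W \<and> (\<forall>v\<in>W. \<forall>w\<in>W. v + w \<in> W)
     \<and> (\<forall>c. \<forall>v\<in>W. c \<cdot>\<^sub>v v \<in> W) \<and> (\<forall>g\<in>carrier G. \<forall>w\<in>W. \<rho> g *\<^sub>v w \<in> W)"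
  unfolding invariant_subspace_def VectorSpace.subspace_def submodule_def
  using vec_vs[of n, where ?'a = complex] vec_module[of n, where ?'a = complex]
  by (auto simp: module_vec_simps class_ring_simps)

text \<open>In a basis adapted to \<open>W\<close> all matrices are block upper triangular. The
  diagonal blocks \<sigma> and \<tau> are the actions on \<open>W\<close> and on the quotient by
  \<open>W\<close>, and the trace is additive on them.\<close>

lemma representation_split:
  assumes \<rho>: "representation G n \<rho>" and W: "invariant_subspace G n \<rho> W"
    and ne: "W \<noteq> {0\<^sub>v n}" "W \<noteq> carrier_vec n"
  obtains k \<sigma> \<tau> where "k < n" "n - k < n" "representation G k \<sigma>" "representation G (n - k) \<tau>"
    "\<And>g. g \<in> carrier G \<Longrightarrow> mat_trace (\<rho> g) = mat_trace (\<sigma> g) + mat_trace (\<tau> g)"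
proof -
  note W' = W[unfolded invariant_subspace_iff]
  obtain k P Q where k: "k \<le> n" and P: "P \<in> carrier_mat n n" and Q: "Q \<in> carrier_mat n n"
    and PQ: "P * Q = 1\<^sub>m n" and QP: "Q * P = 1\<^sub>m n"
    and WQ: "W = {w \<in> carrier_vec n. \<forall>i<n. k \<le> i \<longrightarrow> (Q *\<^sub>v w) $ i = 0}"
    using W' by (rule_tac subspace_adapted_basis[of W n]) auto
  have "k \<noteq> n" using WQ ne(2) by auto
  then have kn: "k < n" using k by simp
  have "k \<noteq> 0"
  proof
    assume "k = 0"
    have "w = 0\<^sub>v n" if "w \<in> W" for w
    proof -
      have w: "w \<in> carrier_vec n" using that W' by auto
      have "Q *\<^sub>v w = 0\<^sub>v n" using that Q \<open>k = 0\<close> unfolding WQ by (intro eq_vecI) auto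
      then have "P *\<^sub>v (Q *\<^sub>v w) = 0\<^sub>v n" using P by auto
      then show ?thesis using assoc_mult_mat_vec[OF P Q w] PQ w by simp
    qed
    then show False using ne(1) W' by auto
  qed
  define R where "R g = Q * \<rho> g * P" for g
  have \<rho>c: "\<rho> g \<in> carrier_mat n n" if "g \<in> carrier G" for g using rep_carrier[OF \<rho> that] .
  have Rc: "R g \<in> carrier_mat n n" if "g \<in> carrier G" for g
    using \<rho>c[OF that] P Q by (simp add: R_def)
  have Rm: "R (g \<otimes> h) = R g * R h" if "g \<in> carrier G" "h \<in> carrier G" for g h
  proof -
    note c = \<rho>c[OF that(1)] \<rho>c[OF that(2)]
    have "R g * R h = Q * \<rho> g * (P * (Q * (\<rho> h * P)))"
      unfolding R_def using c P Q by (simp add: assoc_mult_mat[of _ n n _ n _ n])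
    also have "P * (Q * (\<rho> h * P)) = (P * Q) * (\<rho> h * P)"
      using c P Q by (simp add: assoc_mult_mat[of _ n n _ n _ n])
    also have "Q * \<rho> g * ((P * Q) * (\<rho> h * P)) = R (g \<otimes> h)"
      unfolding R_def PQ rep_mult[OF \<rho> that] using c P Q by (simp add: assoc_mult_mat[of _ n n _ n _ n])
    finally show ?thesis by simp
  qed
  have R1: "R \<one> = 1\<^sub>m n" unfolding R_def rep_one[OF \<rho>] using P Q QP by simp
  have Rtr: "mat_trace (R g) = mat_trace (\<rho> g)" if "g \<in> carrier G" for g
  proof -
    have "mat_trace (R g) = mat_trace (P * (Q * \<rho> g))"
      unfolding R_def by (rule mat_trace_comm[OF mult_carrier_mat[OF Q \<rho>c[OF that]] P])
    also have "P * (Q * \<rho> g) = \<rho> g"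
      using assoc_mult_mat[OF P Q \<rho>c[OF that]] PQ \<rho>c[OF that] by simp
    finally show ?thesis .
  qed
  \<comment> \<open>The lower left block vanishes by invariance: column \<open>j < k\<close> of
    \<open>P\<close> lies in \<open>W\<close>, and so does its image under \<open>\<rho> g\<close>,
    whose adapted coordinates are therefore 0 from \<open>k\<close> on.\<close>
  have R0: "R g $$ (i,j) = 0" if g: "g \<in> carrier G" and ij: "i < n" "k \<le> i" "j < k" for g i j
  proof -
    have jn: "j < n" using ij kn by simp
    have cP: "col P j \<in> W"
    proof -
      have "Q *\<^sub>v col P j = col (Q * P) j" using col_mult2[OF Q P jn] by simp
      then have "Q *\<^sub>v col P j = unit_vec n j" using QP jn by simp
      moreover have "col P j \<in> carrier_vec n" using P by (simp add: carrier_vecI)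
      ultimately show ?thesis unfolding WQ using ij jn by auto
    qed
    then have "\<rho> g *\<^sub>v col P j \<in> W" using W' g by blast
    then have "(Q *\<^sub>v (\<rho> g *\<^sub>v col P j)) $ i = 0" unfolding WQ using ij by auto
    moreover have "col (R g) j = Q *\<^sub>v (\<rho> g *\<^sub>v col P j)"
    proof -
      have "col (R g) j = (Q * \<rho> g) *\<^sub>v col P j"
        unfolding R_def using col_mult2[OF mult_carrier_mat[OF Q \<rho>c[OF g]] P jn] .
      also have "\<dots> = Q *\<^sub>v (\<rho> g *\<^sub>v col P j)"
        using assoc_mult_mat_vec[OF Q \<rho>c[OF g], of "col P j"] P by (simp add: carrier_vecI)
      finally show ?thesis .
    qed
    ultimately have "col (R g) j $ i = 0" by simp
    then show ?thesis using Rc[OF g] ij jn by simp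
  qed
  have Re: "R (g \<otimes> h) $$ (i,j) = (\<Sum>l<n. R g $$ (i,l) * R h $$ (l,j))"
    if "g \<in> carrier G" "h \<in> carrier G" "i < n" "j < n" for g h i j
    using that Rc[OF that(1)] Rc[OF that(2)] by (simp add: Rm scalar_prod_def lessThan_atLeast0)
  define \<sigma> where "\<sigma> g = mat k k (\<lambda>(i,j). R g $$ (i,j))" for g
  define \<tau> where "\<tau> g = mat (n - k) (n - k) (\<lambda>(i,j). R g $$ (i + k,j + k))" for g
  have split: "(\<Sum>l<n. f l) = (\<Sum>l<k. f l) + (\<Sum>l<n - k. f (l + k))" for f :: "nat \<Rightarrow> complex"
  proof -
    have "(\<Sum>l<n. f l) = (\<Sum>l\<in>{0..<k}. f l) + (\<Sum>l\<in>{k..<n}. f l)"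
      using k by (simp add: lessThan_atLeast0 sum.atLeastLessThan_concat)
    also have "(\<Sum>l\<in>{k..<n}. f l) = (\<Sum>l<n - k. f (l + k))"
      using sum.shift_bounds_nat_ivl[of f 0 k "n - k"] k by (simp add: lessThan_atLeast0)
    finally show ?thesis by (simp add: lessThan_atLeast0)
  qed
  have "representation G k \<sigma>"
    unfolding representation_iff
  proof (intro conjI ballI)
    show "\<sigma> \<one> = 1\<^sub>m k" using kn by (intro eq_matI) (auto simp: \<sigma>_def R1)
    fix g h assume gh: "g \<in> carrier G" "h \<in> carrier G"
    show "\<sigma> (g \<otimes> h) = \<sigma> g * \<sigma> h"
    proof (rule eq_matI)
      fix i j assume "i < dim_row (\<sigma> g * \<sigma> h)" "j < dim_col (\<sigma> g * \<sigma> h)"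
      then have ij: "i < k" "j < k" by (auto simp: \<sigma>_def)
      have "\<sigma> (g \<otimes> h) $$ (i,j) = (\<Sum>l<k. R g $$ (i,l) * R h $$ (l,j))"
        using ij kn gh R0[OF gh(2)] by (simp add: \<sigma>_def Re split)
      then show "\<sigma> (g \<otimes> h) $$ (i,j) = (\<sigma> g * \<sigma> h) $$ (i,j)"
        using ij by (simp add: \<sigma>_def scalar_prod_def lessThan_atLeast0)
    qed (auto simp: \<sigma>_def)
  qed (auto simp: \<sigma>_def)
  moreover have "representation G (n - k) \<tau>"
    unfolding representation_iff
  proof (intro conjI ballI)
    show "\<tau> \<one> = 1\<^sub>m (n - k)" using kn by (intro eq_matI) (auto simp: \<tau>_def R1)
    fix g h assume gh: "g \<in> carrier G" "h \<in> carrier G"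
    show "\<tau> (g \<otimes> h) = \<tau> g * \<tau> h"
    proof (rule eq_matI)
      fix i j assume "i < dim_row (\<tau> g * \<tau> h)" "j < dim_col (\<tau> g * \<tau> h)"
      then have ij: "i < n - k" "j < n - k" by (auto simp: \<tau>_def)
      then have ij': "i + k < n" "j + k < n" by auto
      have "\<tau> (g \<otimes> h) $$ (i,j) = (\<Sum>l<n-k. R g $$ (i + k,l + k) * R h $$ (l + k,j + k))"
        using ij ij' gh R0[OF gh(1)] by (simp add: \<tau>_def Re split)
      then show "\<tau> (g \<otimes> h) $$ (i,j) = (\<tau> g * \<tau> h) $$ (i,j)"
        using ij by (simp add: \<tau>_def scalar_prod_def lessThan_atLeast0)
    qed (auto simp: \<tau>_def)
  qed (auto simp: \<tau>_def)
  moreover have "mat_trace (\<rho> g) = mat_trace (\<sigma> g) + mat_trace (\<tau> g)" if "g \<in> carrier G" for g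
    using Rtr[OF that] Rc[OF that] by (simp add: mat_trace_def split \<sigma>_def \<tau>_def)
  ultimately show thesis using that[of k \<sigma> \<tau>] kn \<open>k \<noteq> 0\<close> by simp
qed

text \<open>A composition series suffices for characters, so Maschke's theorem is not needed.\<close>

lemma character_decomposition:
  assumes "representation G n \<rho>"
  shows "\<exists>xs. set xs \<subseteq> Irr G \<and> (\<forall>g\<in>carrier G. mat_trace (\<rho> g) = (\<Sum>\<chi>\<leftarrow>xs. \<chi> g))"
  using assms
proof (induction n arbitrary: \<rho> rule: less_induct)
  case (less n)
  note \<rho> = less.prems
  show ?case
  proof (cases "n = 0")
    case True
    then have "mat_trace (\<rho> g) = 0" if "g \<in> carrier G" for g
      using rep_carrier[OF \<rho> that] by (simp add: mat_trace_def)
    then show ?thesis by (intro exI[of _ "[]"]) simp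
  next
    case n: False
    show ?thesis
    proof (cases "irreducible_representation G n \<rho>")
      case True
      then have "character_of G \<rho> \<in> Irr G" by (auto simp: Irr_def)
      then show ?thesis by (intro exI[of _ "[character_of G \<rho>]"]) (simp add: character_of_def)
    next
      case False
      then obtain W where "invariant_subspace G n \<rho> W" "W \<noteq> {0\<^sub>v n}" "W \<noteq> carrier_vec n"
        using n \<rho> by (auto simp: irreducible_representation_def)
      from representation_split[OF \<rho> this]
      obtain k \<sigma> \<tau> where s: "k < n" "n - k < n" "representation G k \<sigma>" "representation G (n - k) \<tau>"
        "\<And>g. g \<in> carrier G \<Longrightarrow> mat_trace (\<rho> g) = mat_trace (\<sigma> g) + mat_trace (\<tau> g)" by metis
      from less.IH[OF s(1,3)] less.IH[OF s(2,4)] obtain xs ys where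
        "set xs \<subseteq> Irr G" "\<forall>g\<in>carrier G. mat_trace (\<sigma> g) = (\<Sum>\<chi>\<leftarrow>xs. \<chi> g)"
        "set ys \<subseteq> Irr G" "\<forall>g\<in>carrier G. mat_trace (\<tau> g) = (\<Sum>\<chi>\<leftarrow>ys. \<chi> g)" by blast
      then show ?thesis using s(5) by (intro exI[of _ "xs @ ys"]) simp
    qed
  qed
qed


section \<open>Schur's lemma\<close>

lemma schur_scalar:
  assumes irr: "irreducible_representation G n \<rho>" and A: "A \<in> carrier_mat n n"
    and comm: "\<And>g. g \<in> carrier G \<Longrightarrow> \<rho> g * A = A * \<rho> g"
  obtains c where "A = c \<cdot>\<^sub>m 1\<^sub>m n"
proof -
  have \<rho>: "representation G n \<rho>" and n: "n > 0" using irr by (auto simp: irreducible_representation_def)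
  \<comment> \<open>Algebraic closedness of the complex numbers enters here. The eigenspace is a
    nonzero invariant subspace and hence the whole space.\<close>
  obtain c where "eigenvalue A c" using spectrum_non_empty[OF A n] by (auto simp: spectrum_def)
  then obtain v where v: "v \<in> carrier_vec n" "v \<noteq> 0\<^sub>v n" "A *\<^sub>v v = c \<cdot>\<^sub>v v"
    using A by (auto simp: eigenvalue_def eigenvector_def)
  define W where "W = {w \<in> carrier_vec n. A *\<^sub>v w = c \<cdot>\<^sub>v w}"
  have "invariant_subspace G n \<rho> W"
    unfolding invariant_subspace_iff
  proof (intro conjI ballI allI)
    show "W \<subseteq> carrier_vec n" by (auto simp: W_def)
    show "0\<^sub>v n \<in> W" using A by (auto simp: W_def)
    show "v + w \<in> W" if "v \<in> W" "w \<in> W" for v w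
      using that A by (auto simp: W_def mult_add_distrib_mat_vec smult_add_distrib_vec)
    show "d \<cdot>\<^sub>v w \<in> W" if "w \<in> W" for d w
      using that A by (auto simp: W_def mult_mat_vec smult_smult_assoc mult.commute)
    show "\<rho> g *\<^sub>v w \<in> W" if g: "g \<in> carrier G" and w: "w \<in> W" for g w
    proof -
      have c': "\<rho> g \<in> carrier_mat n n" and wc: "w \<in> carrier_vec n" and we: "A *\<^sub>v w = c \<cdot>\<^sub>v w"
        using rep_carrier[OF \<rho> g] w by (auto simp: W_def)
      have "A *\<^sub>v (\<rho> g *\<^sub>v w) = \<rho> g *\<^sub>v (A *\<^sub>v w)"
        using assoc_mult_mat_vec[OF A c' wc] assoc_mult_mat_vec[OF c' A wc] comm[OF g] by simp
      also have "\<dots> = c \<cdot>\<^sub>v (\<rho> g *\<^sub>v w)"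
        unfolding we using c' wc by (simp add: mult_mat_vec)
      finally show ?thesis using c' wc by (auto simp: W_def)
    qed
  qed
  moreover have "v \<in> W" using v by (simp add: W_def)
  ultimately have W: "W = carrier_vec n"
    using irr v(2) unfolding irreducible_representation_def by auto
  have "A = c \<cdot>\<^sub>m 1\<^sub>m n"
  proof (rule eq_matI)
    fix i j assume "i < dim_row (c \<cdot>\<^sub>m 1\<^sub>m n)" "j < dim_col (c \<cdot>\<^sub>m 1\<^sub>m n)"
    then have ij: "i < n" "j < n" by auto
    have "unit_vec n j \<in> W" using W by simp
    then have "col A j = c \<cdot>\<^sub>v unit_vec n j"
      using mat_unit_vec_col[OF A ij(2)] by (simp add: W_def)
    then have "col A j $ i = (c \<cdot>\<^sub>v unit_vec n j) $ i" by simp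
    then show "A $$ (i,j) = (c \<cdot>\<^sub>m 1\<^sub>m n) $$ (i,j)" using A ij by (simp add: unit_vec_def)
  qed (use A in auto)
  then show thesis by (rule that)
qed

text \<open>Kernel and image of \<open>X\<close> are invariant, so \<open>X\<close> is bijective.
  Its inverse \<open>Y\<close> has the preimages of the unit vectors as columns. Equality of traces
  comes directly from cyclicity of the trace, applied to the possibly rectangular matrices
  \<open>X\<close> and \<open>Y\<close>.\<close>

lemma schur_intertwiner:
  assumes irr: "irreducible_representation G n \<rho>" "irreducible_representation G m \<sigma>"
    and X: "X \<in> carrier_mat n m" and ne: "X \<noteq> 0\<^sub>m n m"
    and comm: "\<And>g. g \<in> carrier G \<Longrightarrow> \<rho> g * X = X * \<sigma> g"
    and g: "g \<in> carrier G"
  shows "mat_trace (\<rho> g) = mat_trace (\<sigma> g)"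
proof -
  have \<rho>: "representation G n \<rho>" and \<sigma>: "representation G m \<sigma>"
    using irr by (auto simp: irreducible_representation_def)
  note \<rho>c = rep_carrier[OF \<rho>] and \<sigma>c = rep_carrier[OF \<sigma>]
  have swap: "X *\<^sub>v (\<sigma> h *\<^sub>v w) = \<rho> h *\<^sub>v (X *\<^sub>v w)" if "h \<in> carrier G" "w \<in> carrier_vec m" for h w
    using assoc_mult_mat_vec[OF X \<sigma>c[OF that(1)] that(2)] assoc_mult_mat_vec[OF \<rho>c[OF that(1)] X that(2)]
      comm[OF that(1)] by simp
  have ex: "\<exists>v \<in> carrier_vec m. X *\<^sub>v v \<noteq> 0\<^sub>v n"
  proof (rule ccontr)
    assume "\<not> ?thesis"
    then have "X *\<^sub>v unit_vec m j = 0\<^sub>v n" for j by simp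
    then have c0: "col X j = 0\<^sub>v n" if "j < m" for j using mat_unit_vec_col[OF X that] by simp
    have "X $$ (i,j) = 0" if "i < n" "j < m" for i j
    proof -
      have "X $$ (i,j) = col X j $ i" using X that by simp
      also have "\<dots> = 0" using c0[OF that(2)] that by simp
      finally show ?thesis .
    qed
    then have "X = 0\<^sub>m n m" using X by (intro eq_matI) auto
    then show False using ne by simp
  qed
  define K where "K = {v \<in> carrier_vec m. X *\<^sub>v v = 0\<^sub>v n}"
  have "invariant_subspace G m \<sigma> K"
    unfolding invariant_subspace_iff
  proof (intro conjI ballI allI)
    show "K \<subseteq> carrier_vec m" by (auto simp: K_def)
    show "0\<^sub>v m \<in> K" using X by (auto simp: K_def)
    show "v + w \<in> K" if "v \<in> K" "w \<in> K" for v w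
      using that X by (auto simp: K_def mult_add_distrib_mat_vec)
    show "d \<cdot>\<^sub>v w \<in> K" if "w \<in> K" for d w
      using that X by (auto simp: K_def mult_mat_vec)
    show "\<sigma> h *\<^sub>v w \<in> K" if "h \<in> carrier G" "w \<in> K" for h w
      using that \<rho>c[OF that(1)] \<sigma>c[OF that(1)] swap by (auto simp: K_def)
  qed
  moreover have "K \<noteq> carrier_vec m" using ex by (auto simp: K_def)
  ultimately have K: "K = {0\<^sub>v m}" using irr(2) by (auto simp: irreducible_representation_def)
  define R where "R = {X *\<^sub>v v | v. v \<in> carrier_vec m}"
  have "invariant_subspace G n \<rho> R"
    unfolding invariant_subspace_iff
  proof (intro conjI ballI allI)
    show "R \<subseteq> carrier_vec n" using X by (auto simp: R_def)
    show "0\<^sub>v n \<in> R" using X by (auto simp: R_def intro!: exI[of _ "0\<^sub>v m"])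
    show "v + w \<in> R" if vw: "v \<in> R" "w \<in> R" for v w
    proof -
      obtain v' w' where "v' \<in> carrier_vec m" "w' \<in> carrier_vec m" "v = X *\<^sub>v v'" "w = X *\<^sub>v w'"
        using vw by (auto simp: R_def)
      then show ?thesis using X
        by (auto simp: R_def mult_add_distrib_mat_vec intro!: exI[of _ "v' + w'"])
    qed
    show "d \<cdot>\<^sub>v w \<in> R" if w: "w \<in> R" for d w
    proof -
      obtain w' where "w' \<in> carrier_vec m" "w = X *\<^sub>v w'" using w by (auto simp: R_def)
      then show ?thesis using X by (auto simp: R_def mult_mat_vec intro!: exI[of _ "d \<cdot>\<^sub>v w'"])
    qed
    show "\<rho> h *\<^sub>v w \<in> R" if h: "h \<in> carrier G" and w: "w \<in> R" for h w
    proof -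
      obtain w' where w': "w' \<in> carrier_vec m" "w = X *\<^sub>v w'" using w by (auto simp: R_def)
      then show ?thesis using swap[OF h w'(1)] \<sigma>c[OF h]
        by (auto simp: R_def intro!: exI[of _ "\<sigma> h *\<^sub>v w'"])
    qed
  qed
  moreover have "R \<noteq> {0\<^sub>v n}" using ex by (auto simp: R_def)
  ultimately have R: "R = carrier_vec n" using irr(1) by (auto simp: irreducible_representation_def)
  have "\<exists>v. v \<in> carrier_vec m \<and> X *\<^sub>v v = unit_vec n j" for j
  proof -
    have "unit_vec n j \<in> R" using R by simp
    then show ?thesis by (auto simp: R_def)
  qed
  then obtain y where y: "\<And>j. y j \<in> carrier_vec m" "\<And>j. X *\<^sub>v y j = unit_vec n j" by metis
  define Y where "Y = mat m n (\<lambda>(i,j). y j $ i)"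
  have Y: "Y \<in> carrier_mat m n" by (simp add: Y_def)
  have cY: "col Y j = y j" if "j < n" for j using y(1)[of j] that by (auto simp: Y_def)
  have XY: "X * Y = 1\<^sub>m n"
  proof (rule mat_col_eqI)
    show "col (X * Y) i = col (1\<^sub>m n) i" if "i < dim_col (1\<^sub>m n)" for i
      using that col_mult2[OF X Y, of i] cY[of i] y(2)[of i] by simp
  qed (use X Y in auto)
  have YX: "Y * X = 1\<^sub>m m"
  proof (rule mat_col_eqI)
    fix i assume "i < dim_col (1\<^sub>m m)"
    then have i: "i < m" by simp
    let ?e = "unit_vec m i :: complex vec"
    let ?v = "Y *\<^sub>v (X *\<^sub>v ?e)"
    have v: "?v \<in> carrier_vec m" using Y X by simp
    have "X *\<^sub>v ?v = X *\<^sub>v ?e"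
      using assoc_mult_mat_vec[OF X Y, of "X *\<^sub>v ?e"] XY X by simp
    then have "X *\<^sub>v (?v - ?e) = 0\<^sub>v n"
      using X v by (simp add: mult_minus_distrib_mat_vec)
    then have "?v - ?e \<in> K" using v by (simp add: K_def)
    then have d: "?v - ?e = 0\<^sub>v m" using K by simp
    have "?v = ?e"
    proof (rule eq_vecI)
      fix a assume a: "a < dim_vec ?e"
      have "(?v - ?e) $ a = 0" using d a by simp
      then show "?v $ a = ?e $ a" using a v by simp
    qed (use Y in simp)
    then show "col (Y * X) i = col (1\<^sub>m m) i"
      using col_mult2[OF Y X i] mat_unit_vec_col[OF X i] i by simp
  qed (use X Y in auto)
  have "mat_trace (\<rho> g) = mat_trace (\<rho> g * (X * Y))" using XY \<rho>c[OF g] by simp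
  also have "\<dots> = mat_trace ((X * \<sigma> g) * Y)"
    using comm[OF g] assoc_mult_mat[OF \<rho>c[OF g] X Y] by simp
  also have "\<dots> = mat_trace (Y * (X * \<sigma> g))"
    using X Y \<sigma>c[OF g] by (intro mat_trace_comm[of _ n m]) auto
  also have "Y * (X * \<sigma> g) = \<sigma> g"
    using assoc_mult_mat[OF Y X \<sigma>c[OF g]] YX \<sigma>c[OF g] by simp
  finally show ?thesis .
qed

section \<open>Irreducible characters as class functions and the first orthogonality
  relation\<close>

lemma sum_left_translate: 
  "h \<in> carrier G \<Longrightarrow> (\<Sum>g\<in>carrier G. f (h \<otimes> g)) = (\<Sum>g\<in>carrier G. f g)"
  by (rule sum.reindex_bij_witness[of _ "\<lambda>g. inv h \<otimes> g" "\<lambda>g. h \<otimes> g"]) (auto simp: m_assoc[symmetric])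

lemma sum_right_translate: 
  "h \<in> carrier G \<Longrightarrow> (\<Sum>g\<in>carrier G. f (g \<otimes> h)) = (\<Sum>g\<in>carrier G. f g)"
  by (rule sum.reindex_bij_witness[of _ "\<lambda>g. g \<otimes> inv h" "\<lambda>g. g \<otimes> h"]) (auto simp: m_assoc)

lemma IrrE:
  assumes "\<chi> \<in> Irr G"
  obtains n \<rho> where "irreducible_representation G n \<rho>" "representation G n \<rho>" "n > 0"
    "\<And>g. g \<in> carrier G \<Longrightarrow> \<chi> g = mat_trace (\<rho> g)" "\<chi> \<one> = of_nat n"
proof -
  obtain n \<rho> where irr: "irreducible_representation G n \<rho>" and \<chi>: "\<chi> = character_of G \<rho>"
    using assms by (auto simp: Irr_def)
  have rep: "representation G n \<rho>" "n > 0" using irr by (simp_all add: irreducible_representation_def)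
  show thesis
    using that[OF irr rep] character_of_one[OF is_group rep(1)] \<chi> by (simp add: character_of_def)
qed

lemma Irr_eqI:
  assumes "\<chi> \<in> Irr G" "\<psi> \<in> Irr G" "\<And>g. g \<in> carrier G \<Longrightarrow> \<chi> g = \<psi> g"
  shows "\<chi> = \<psi>"
  using assms by (auto simp: Irr_def character_of_def restrict_def fun_eq_iff)

lemma trace_rep_mult_comm:
  assumes "representation G n \<rho>" "g \<in> carrier G" "h \<in> carrier G"
  shows "mat_trace (\<rho> (g \<otimes> h)) = mat_trace (\<rho> (h \<otimes> g))"
  using assms by (simp add: rep_mult) (rule mat_trace_comm[OF rep_carrier rep_carrier])

lemma Irr_mult_comm:
  assumes "\<chi> \<in> Irr G" "g \<in> carrier G" "h \<in> carrier G"
  shows "\<chi> (g \<otimes> h) = \<chi> (h \<otimes> g)"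
  using assms(1)
proof (rule IrrE)
  fix n \<rho> assume "representation G n \<rho>" "\<And>g. g \<in> carrier G \<Longrightarrow> \<chi> g = mat_trace (\<rho> g)"
  then show ?thesis using trace_rep_mult_comm[of n \<rho> g h] assms(2,3) by simp
qed

lemma Irr_conj:
  assumes "\<chi> \<in> Irr G" "g \<in> carrier G" "h \<in> carrier G"
  shows "\<chi> (h \<otimes> g \<otimes> inv h) = \<chi> g"
  using assms Irr_mult_comm[OF assms(1), of "h \<otimes> g" "inv h"] by (simp add: m_assoc[symmetric])

text \<open>Averaging the matrix unit with entry 1 at \<open>(j,k)\<close> over the group gives the
  intertwiner \<open>X j k\<close>; the pairing is the sum of the entries
  \<open>X j k $$ (j,k)\<close>, and Schur's lemma evaluates each of them. Writing
  \<open>\<psi> (inv g)\<close> in place of the conjugate of \<open>\<psi> g\<close> keeps unitarity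
  out of the argument.\<close>

lemma Irr_orthogonality:
  assumes fin: "finite (carrier G)" and \<chi>: "\<chi> \<in> Irr G" and \<psi>: "\<psi> \<in> Irr G"
  shows "(\<Sum>g\<in>carrier G. \<chi> g * \<psi> (inv g)) = (if \<chi> = \<psi> then of_nat (card (carrier G)) else 0)"
proof -
  obtain n \<rho> where \<rho>: "irreducible_representation G n \<rho>" "representation G n \<rho>" "n > 0"
    "\<And>g. g \<in> carrier G \<Longrightarrow> \<chi> g = mat_trace (\<rho> g)" using \<chi> by (rule IrrE) (rule that)
  \<comment> \<open>If \<chi> = \<psi>, the same representation is taken on both sides. A character
    is not known to determine its representation here, and \<open>schur_scalar\<close> applies only
    to matrices commuting with a single one.\<close>
  obtain m \<sigma> where \<sigma>: "irreducible_representation G m \<sigma>" "representation G m \<sigma>"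
    "\<And>g. g \<in> carrier G \<Longrightarrow> \<psi> g = mat_trace (\<sigma> g)"
    and same: "\<chi> = \<psi> \<Longrightarrow> n = m \<and> \<rho> = \<sigma>"
  proof (cases "\<chi> = \<psi>")
    case True
    then show ?thesis using that[of n \<rho>] \<rho> by simp
  next
    case False
    from \<psi> show ?thesis by (rule IrrE) (use that False in blast)
  qed
  note \<rho>c = rep_carrier[OF \<rho>(2)] and \<sigma>c = rep_carrier[OF \<sigma>(2)]
  define X where "X j k = mat n m (\<lambda>(a,b). \<Sum>g\<in>carrier G. \<rho> g $$ (a,j) * \<sigma> (inv g) $$ (k,b))" for j k
  have X: "X j k \<in> carrier_mat n m" for j k by (simp add: X_def)
  have comm: "\<rho> h * X j k = X j k * \<sigma> h" if h: "h \<in> carrier G" and jk: "j < n" "k < m" for h j k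
  proof (rule eq_matI)
    fix a b assume "a < dim_row (X j k * \<sigma> h)" "b < dim_col (X j k * \<sigma> h)"
    then have ab: "a < n" "b < m" using carrier_matD[OF X[of j k]] \<sigma>c[OF h] by auto
    have "(\<rho> h * X j k) $$ (a,b) = (\<Sum>c<n. \<rho> h $$ (a,c) * (\<Sum>g\<in>carrier G. \<rho> g $$ (c,j) * \<sigma> (inv g) $$ (k,b)))"
      using ab \<rho>c[OF h] by (simp add: X_def scalar_prod_def lessThan_atLeast0)
    also have "\<dots> = (\<Sum>g\<in>carrier G. (\<Sum>c<n. \<rho> h $$ (a,c) * \<rho> g $$ (c,j)) * \<sigma> (inv g) $$ (k,b))"
      by (simp add: sum_distrib_left sum_distrib_right mult.assoc) (rule sum.swap)
    also have "\<dots> = (\<Sum>g\<in>carrier G. \<rho> (h \<otimes> g) $$ (a,j) * \<sigma> (inv g) $$ (k,b))"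
      using h ab jk by (intro sum.cong) (simp_all add: rep_mult_entry[OF \<rho>(2)])
    also have "\<dots> = (\<Sum>g\<in>carrier G. \<rho> (h \<otimes> g) $$ (a,j) * \<sigma> (inv (h \<otimes> g) \<otimes> h) $$ (k,b))"
      using h by (intro sum.cong) (simp_all add: inv_mult_group m_assoc)
    also have "\<dots> = (\<Sum>g\<in>carrier G. \<rho> g $$ (a,j) * \<sigma> (inv g \<otimes> h) $$ (k,b))"
      by (rule sum_left_translate[OF h, of "\<lambda>g. \<rho> g $$ (a,j) * \<sigma> (inv g \<otimes> h) $$ (k,b)"])
    also have "\<dots> = (\<Sum>g\<in>carrier G. \<rho> g $$ (a,j) * (\<Sum>c<m. \<sigma> (inv g) $$ (k,c) * \<sigma> h $$ (c,b)))"
      using h ab jk by (intro sum.cong) (simp_all add: rep_mult_entry[OF \<sigma>(2)])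
    also have "\<dots> = (\<Sum>c<m. (\<Sum>g\<in>carrier G. \<rho> g $$ (a,j) * \<sigma> (inv g) $$ (k,c)) * \<sigma> h $$ (c,b))"
      by (simp add: sum_distrib_left sum_distrib_right mult.assoc) (rule sum.swap)
    also have "\<dots> = (X j k * \<sigma> h) $$ (a,b)"
      using ab \<sigma>c[OF h] by (simp add: X_def scalar_prod_def lessThan_atLeast0)
    finally show "(\<rho> h * X j k) $$ (a,b) = (X j k * \<sigma> h) $$ (a,b)" .
  qed (use carrier_matD[OF X[of j k]] \<rho>c[OF h] \<sigma>c[OF h] in auto)
  have "(\<Sum>g\<in>carrier G. \<chi> g * \<psi> (inv g)) = (\<Sum>g\<in>carrier G. (\<Sum>j<n. \<rho> g $$ (j,j)) * (\<Sum>k<m. \<sigma> (inv g) $$ (k,k)))"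
    by (intro sum.cong) (simp_all add: \<rho>(4) \<sigma>(3) mat_trace_def carrier_matD[OF \<rho>c] carrier_matD[OF \<sigma>c])
  also have "\<dots> = (\<Sum>g\<in>carrier G. \<Sum>j<n. \<Sum>k<m. \<rho> g $$ (j,j) * \<sigma> (inv g) $$ (k,k))"
    by (simp add: sum_product)
  also have "\<dots> = (\<Sum>j<n. \<Sum>g\<in>carrier G. \<Sum>k<m. \<rho> g $$ (j,j) * \<sigma> (inv g) $$ (k,k))"
    by (rule sum.swap)
  also have "\<dots> = (\<Sum>j<n. \<Sum>k<m. \<Sum>g\<in>carrier G. \<rho> g $$ (j,j) * \<sigma> (inv g) $$ (k,k))"
    by (intro sum.cong refl sum.swap)
  also have "\<dots> = (\<Sum>j<n. \<Sum>k<m. X j k $$ (j,k))"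
    by (intro sum.cong refl) (simp add: X_def)
  finally have main: "(\<Sum>g\<in>carrier G. \<chi> g * \<psi> (inv g)) = (\<Sum>j<n. \<Sum>k<m. X j k $$ (j,k))" .
  show ?thesis
  proof (cases "\<chi> = \<psi>")
    case False
    have "X j k = 0\<^sub>m n m" if "j < n" "k < m" for j k
    proof (rule ccontr)
      assume "X j k \<noteq> 0\<^sub>m n m"
      then have "mat_trace (\<rho> g) = mat_trace (\<sigma> g)" if "g \<in> carrier G" for g
        using schur_intertwiner[OF \<rho>(1) \<sigma>(1) X] comm \<open>j < n\<close> \<open>k < m\<close> that by blast
      then have "\<chi> = \<psi>" by (intro Irr_eqI \<chi> \<psi>) (simp add: \<rho>(4) \<sigma>(3))
      then show False using False by simp
    qed
    then show ?thesis using main False by simp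
  next
    case True
    then have mn: "m = n" and \<sigma>\<rho>: "\<sigma> = \<rho>" using same by auto
    have "X j k $$ (j,k) = (if j = k then of_nat (card (carrier G)) / of_nat n else 0)"
      if jk: "j < n" "k < n" for j k
    proof -
      obtain c where c: "X j k = c \<cdot>\<^sub>m 1\<^sub>m n"
        using schur_scalar[OF \<rho>(1)] X[of j k] comm[of _ j k] jk unfolding mn \<sigma>\<rho> by metis
      \<comment> \<open>The scalar is read off from the trace, where \<open>\<rho> (inv g)\<close>
        meets \<open>\<rho> g\<close> and leaves an entry of the identity matrix for each
        \<open>g\<close>.\<close>
      have "of_nat n * c = (\<Sum>a<n. X j k $$ (a,a))" by (simp add: c)
      also have "\<dots> = (\<Sum>a<n. \<Sum>g\<in>carrier G. \<rho> (inv g) $$ (k,a) * \<rho> g $$ (a,j))"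
        by (simp add: X_def mn \<sigma>\<rho> mult.commute)
      also have "\<dots> = (\<Sum>g\<in>carrier G. \<Sum>a<n. \<rho> (inv g) $$ (k,a) * \<rho> g $$ (a,j))"
        by (rule sum.swap)
      also have "\<dots> = (\<Sum>g\<in>carrier G. \<rho> (inv g \<otimes> g) $$ (k,j))"
        by (intro sum.cong refl rep_mult_entry[OF \<rho>(2), symmetric] inv_closed jk)
      also have "\<dots> = of_nat (card (carrier G)) * (if j = k then 1 else 0)"
        using jk by (simp add: rep_one[OF \<rho>(2)])
      finally have "of_nat n * c = of_nat (card (carrier G)) * (if j = k then 1 else 0)" .
      then have "c = (if j = k then of_nat (card (carrier G)) / of_nat n else 0)"
        using \<rho>(3) by (auto simp: field_simps split: if_splits)
      then show ?thesis using jk by (simp add: c)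
    qed
    then have "(\<Sum>j<n. \<Sum>k<m. X j k $$ (j,k)) = (\<Sum>j<n. \<Sum>k<n. if j = k then of_nat (card (carrier G)) / of_nat n else 0)"
      unfolding mn by (intro sum.cong) auto
    also have "\<dots> = of_nat (card (carrier G))" using \<rho>(3) by simp
    finally show ?thesis using main True by simp
  qed
qed

text \<open>The sum of all \<open>f(x) x\<close> is central in the group algebra, hence acts as a scalar.\<close>

lemma Irr_central_sum:
  assumes \<chi>: "\<chi> \<in> Irr G" and X: "X \<subseteq> carrier G"
    and conj: "\<And>x h. x \<in> X \<Longrightarrow> h \<in> carrier G \<Longrightarrow> h \<otimes> x \<otimes> inv h \<in> X"
    and f: "\<And>x h. x \<in> X \<Longrightarrow> h \<in> carrier G \<Longrightarrow> f (h \<otimes> x \<otimes> inv h) = f x"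
    and g: "g \<in> carrier G"
  shows "\<chi> \<one> * (\<Sum>x\<in>X. f x * \<chi> (x \<otimes> g)) = (\<Sum>x\<in>X. f x * \<chi> x) * \<chi> g"
proof -
  obtain n \<rho> where \<rho>: "irreducible_representation G n \<rho>" "representation G n \<rho>" "n > 0"
    "\<And>g. g \<in> carrier G \<Longrightarrow> \<chi> g = mat_trace (\<rho> g)" "\<chi> \<one> = of_nat n" using \<chi> by (rule IrrE) (rule that)
  note \<rho>c = rep_carrier[OF \<rho>(2)]
  define S where "S = mat n n (\<lambda>(a,b). \<Sum>x\<in>X. f x * \<rho> x $$ (a,b))"
  have S: "S \<in> carrier_mat n n" by (simp add: S_def)
  have comm: "\<rho> h * S = S * \<rho> h" if h: "h \<in> carrier G" for h
  proof (rule eq_matI)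
    fix a b assume "a < dim_row (S * \<rho> h)" "b < dim_col (S * \<rho> h)"
    then have ab: "a < n" "b < n" using S \<rho>c[OF h] by auto
    have xc: "x \<in> carrier G" if "x \<in> X" for x using that X by auto
    have "(\<rho> h * S) $$ (a,b) = (\<Sum>c<n. \<rho> h $$ (a,c) * (\<Sum>x\<in>X. f x * \<rho> x $$ (c,b)))"
      using ab \<rho>c[OF h] by (simp add: S_def scalar_prod_def lessThan_atLeast0)
    also have "\<dots> = (\<Sum>x\<in>X. f x * (\<Sum>c<n. \<rho> h $$ (a,c) * \<rho> x $$ (c,b)))"
      by (simp add: sum_distrib_left sum_distrib_right mult_ac) (rule sum.swap)
    also have "\<dots> = (\<Sum>x\<in>X. f x * \<rho> (h \<otimes> x) $$ (a,b))"
      using h ab xc by (intro sum.cong) (simp_all add: rep_mult_entry[OF \<rho>(2)])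
    also have "\<dots> = (\<Sum>x\<in>X. f x * \<rho> (x \<otimes> h) $$ (a,b))"
    proof (rule sum.reindex_bij_witness[of _ "\<lambda>x. inv h \<otimes> x \<otimes> h" "\<lambda>x. h \<otimes> x \<otimes> inv h"])
      fix x assume x: "x \<in> X"
      show "h \<otimes> x \<otimes> inv h \<in> X" using conj x h by simp
      show "inv h \<otimes> (h \<otimes> x \<otimes> inv h) \<otimes> h = x" using xc[OF x] h by (simp add: m_assoc[symmetric]) (simp add: m_assoc)
      show "inv h \<otimes> x \<otimes> h \<in> X" using conj[OF x, of "inv h"] h by simp
      show "h \<otimes> (inv h \<otimes> x \<otimes> h) \<otimes> inv h = x" using xc[OF x] h by (simp add: m_assoc[symmetric]) (simp add: m_assoc)
      show "f (h \<otimes> x \<otimes> inv h) * \<rho> (h \<otimes> x \<otimes> inv h \<otimes> h) $$ (a,b) = f x * \<rho> (h \<otimes> x) $$ (a,b)"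
        using xc[OF x] h f[OF x h] by (simp add: m_assoc)
    qed
    also have "\<dots> = (\<Sum>x\<in>X. f x * (\<Sum>c<n. \<rho> x $$ (a,c) * \<rho> h $$ (c,b)))"
      using h ab xc by (intro sum.cong) (simp_all add: rep_mult_entry[OF \<rho>(2)])
    also have "\<dots> = (\<Sum>c<n. (\<Sum>x\<in>X. f x * \<rho> x $$ (a,c)) * \<rho> h $$ (c,b))"
      by (simp add: sum_distrib_left sum_distrib_right mult.assoc) (rule sum.swap)
    also have "\<dots> = (S * \<rho> h) $$ (a,b)"
      using ab \<rho>c[OF h] by (simp add: S_def scalar_prod_def lessThan_atLeast0)
    finally show "(\<rho> h * S) $$ (a,b) = (S * \<rho> h) $$ (a,b)" .
  qed (use S \<rho>c[OF h] in auto)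
  obtain c where c: "S = c \<cdot>\<^sub>m 1\<^sub>m n" using schur_scalar[OF \<rho>(1) S comm] by metis
  \<comment> \<open>This is the trace of \<open>S * \<rho> h\<close>. It is used twice: for
    \<open>h = g\<close>, and for \<open>h = \<one>\<close> to express \<open>c\<close> by character
    values.\<close>
  have tr: "(\<Sum>x\<in>X. f x * \<chi> (x \<otimes> h)) = c * \<chi> h" if h: "h \<in> carrier G" for h
  proof -
    have "(\<Sum>x\<in>X. f x * \<chi> (x \<otimes> h)) = (\<Sum>x\<in>X. f x * (\<Sum>a<n. \<Sum>b<n. \<rho> x $$ (a,b) * \<rho> h $$ (b,a)))"
    proof (rule sum.cong[OF refl])
      fix x assume "x \<in> X"
      then have x: "x \<in> carrier G" using X by auto
      then show "f x * \<chi> (x \<otimes> h) = f x * (\<Sum>a<n. \<Sum>b<n. \<rho> x $$ (a,b) * \<rho> h $$ (b,a))"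
        using h \<rho>c[of "x \<otimes> h"] by (simp add: \<rho>(4) mat_trace_def rep_mult_entry[OF \<rho>(2)])
    qed
    also have "\<dots> = (\<Sum>a<n. \<Sum>x\<in>X. \<Sum>b<n. f x * \<rho> x $$ (a,b) * \<rho> h $$ (b,a))"
      by (simp add: sum_distrib_left mult.assoc) (rule sum.swap)
    also have "\<dots> = (\<Sum>a<n. \<Sum>b<n. \<Sum>x\<in>X. f x * \<rho> x $$ (a,b) * \<rho> h $$ (b,a))"
      by (intro sum.cong refl sum.swap)
    also have "\<dots> = (\<Sum>a<n. \<Sum>b<n. S $$ (a,b) * \<rho> h $$ (b,a))"
      by (intro sum.cong refl) (simp add: S_def sum_distrib_right)
    also have "\<dots> = (\<Sum>a<n. \<Sum>b<n. if b = a then c * \<rho> h $$ (a,a) else 0)"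
      by (intro sum.cong refl) (auto simp: c)
    also have "\<dots> = c * \<chi> h"
      using \<rho>c[OF h] h by (simp add: \<rho>(4) mat_trace_def sum_distrib_left)
    finally show ?thesis .
  qed
  have "(\<Sum>x\<in>X. f x * \<chi> x) = (\<Sum>x\<in>X. f x * \<chi> (x \<otimes> \<one>))"
    using X by (intro sum.cong) auto
  then have "(\<Sum>x\<in>X. f x * \<chi> x) = c * of_nat n" using tr[OF one_closed] \<rho>(5) by simp
  then show ?thesis using tr[OF g] \<rho>(5) by simp
qed

end

lemma sum_list_map_eq_sum_count_list:
  fixes f :: "'b \<Rightarrow> 'c::comm_semiring_1"
  assumes "set xs \<subseteq> A" and "finite A"
  shows "(\<Sum>x\<leftarrow>xs. f x) = (\<Sum>x\<in>A. of_nat (count_list xs x) * f x)"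
  using assms(1)
proof (induction xs)
  case (Cons a xs)
  have "(\<Sum>x\<in>A. of_nat (count_list (a # xs) x) * f x)
    = (\<Sum>x\<in>A. of_nat (count_list xs x) * f x + (if x = a then f a else 0))"
    by (rule sum.cong) (auto simp: distrib_right add.commute)
  also have "\<dots> = (\<Sum>x\<in>A. of_nat (count_list xs x) * f x) + f a"
    using assms(2) Cons.prems by (simp add: sum.distrib)
  finally show ?case using Cons by (simp add: add.commute)
qed simp

section \<open>The regular character and the second orthogonality relation\<close>

context group
begin

lemma regular_representation:
  assumes fin: "finite (carrier G)"
  obtains \<rho> where "representation G (card (carrier G)) \<rho>"
    "\<And>g. g \<in> carrier G \<Longrightarrow> mat_trace (\<rho> g) = (if g = \<one> then of_nat (card (carrier G)) else 0)"
proof -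
  define n where "n = card (carrier G)"
  obtain e where e: "bij_betw e {..<n} (carrier G)"
    using ex_bij_betw_nat_finite[OF fin] by (auto simp: n_def lessThan_atLeast0)
  have ec: "e i \<in> carrier G" if "i < n" for i using e that by (auto simp: bij_betw_def)
  have einj: "e i = e j \<longleftrightarrow> i = j" if "i < n" "j < n" for i j
    using e that by (auto simp: bij_betw_def inj_on_def)
  define \<rho> where "\<rho> g = mat n n (\<lambda>(i,j). if e i = g \<otimes> e j then 1 else (0::complex))" for g
  have "representation G n \<rho>"
    unfolding representation_iff
  proof (intro conjI ballI)
    show "\<rho> \<one> = 1\<^sub>m n" by (rule eq_matI) (auto simp: \<rho>_def einj ec)
    fix g h assume gh: "g \<in> carrier G" "h \<in> carrier G"
    show "\<rho> (g \<otimes> h) = \<rho> g * \<rho> h"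
    proof (rule eq_matI)
      fix i j assume "i < dim_row (\<rho> g * \<rho> h)" "j < dim_col (\<rho> g * \<rho> h)"
      then have ij: "i < n" "j < n" by (auto simp: \<rho>_def)
      obtain k where k: "k < n" "e k = h \<otimes> e j"
        using e gh ec[OF ij(2)] by (auto simp: bij_betw_def) (metis gh(2) imageE lessThan_iff m_closed)
      have "(\<rho> g * \<rho> h) $$ (i,j)
        = (\<Sum>l<n. (if e i = g \<otimes> e l then 1 else 0) * (if e l = h \<otimes> e j then 1 else (0::complex)))"
        using ij by (simp add: \<rho>_def scalar_prod_def lessThan_atLeast0)
      also have "\<dots> = (\<Sum>l<n. if l = k then (if e i = g \<otimes> e k then 1 else 0) else 0)"
        using k by (intro sum.cong) (auto simp: einj simp flip: k(2))
      also have "\<dots> = (if e i = g \<otimes> (h \<otimes> e j) then 1 else 0)" using k by simp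
      also have "\<dots> = \<rho> (g \<otimes> h) $$ (i,j)"
        using ij gh ec by (simp add: \<rho>_def m_assoc)
      finally show "\<rho> (g \<otimes> h) $$ (i,j) = (\<rho> g * \<rho> h) $$ (i,j)" by simp
    qed (auto simp: \<rho>_def)
  qed (auto simp: \<rho>_def)
  moreover have "mat_trace (\<rho> g) = (if g = \<one> then of_nat n else 0)" if g: "g \<in> carrier G" for g
  proof -
    have "mat_trace (\<rho> g) = (\<Sum>i<n. if e i = g \<otimes> e i then 1 else 0)"
      by (simp add: mat_trace_def \<rho>_def)
    also have "\<dots> = (\<Sum>i<n. if g = \<one> then 1 else 0)"
      using ec g by (intro sum.cong) (auto simp: r_cancel_one')
    finally show ?thesis by simp
  qed
  ultimately show thesis using that by (simp add: n_def)
qed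

lemma sum_list_Irr_orthogonality:
  assumes fin: "finite (carrier G)" and xs: "set xs \<subseteq> Irr G" and \<psi>: "\<psi> \<in> Irr G"
  shows "(\<Sum>g\<in>carrier G. (\<Sum>\<chi>\<leftarrow>xs. \<chi> g) * \<psi> (inv g)) = of_nat (card (carrier G)) * of_nat (count_list xs \<psi>)"
  using xs
proof (induction xs)
  case (Cons \<chi> xs)
  then show ?case
    using Irr_orthogonality[OF fin, of \<chi> \<psi>] \<psi>
    by (auto simp: distrib_right distrib_left sum.distrib)
qed simp

lemma card_carrier_pos: "finite (carrier G) \<Longrightarrow> card (carrier G) > 0"
  by (auto simp: card_gt_0_iff)

text \<open>Pairing the regular character, which is concentrated at the identity, with \<psi> shows
  that \<psi> occurs \<psi>(1) > 0 times in one fixed composition list. So this list exhausts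
  \<open>Irr G\<close>, which gives finiteness and the decomposition at once.\<close>

lemma regular_character_aux:
  assumes fin: "finite (carrier G)"
  shows "finite (Irr G) \<and> (\<forall>g\<in>carrier G. (\<Sum>\<chi>\<in>Irr G. \<chi> \<one> * \<chi> g)
    = (if g = \<one> then of_nat (card (carrier G)) else 0))"
proof -
  let ?n = "card (carrier G)"
  obtain \<rho> where \<rho>: "representation G ?n \<rho>"
    "\<And>g. g \<in> carrier G \<Longrightarrow> mat_trace (\<rho> g) = (if g = \<one> then of_nat ?n else 0)"
    using regular_representation[OF fin] by blast
  obtain xs where xs: "set xs \<subseteq> Irr G" "\<And>g. g \<in> carrier G \<Longrightarrow> mat_trace (\<rho> g) = (\<Sum>\<chi>\<leftarrow>xs. \<chi> g)"
    using character_decomposition[OF \<rho>(1)] by blast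
  have cnt: "of_nat (count_list xs \<psi>) = \<psi> \<one>" if \<psi>: "\<psi> \<in> Irr G" for \<psi>
  proof -
    have "of_nat ?n * of_nat (count_list xs \<psi>) = (\<Sum>g\<in>carrier G. mat_trace (\<rho> g) * \<psi> (inv g))"
      using sum_list_Irr_orthogonality[OF fin xs(1) \<psi>] by (simp add: xs(2))
    also have "\<dots> = (\<Sum>g\<in>carrier G. if g = \<one> then of_nat ?n * \<psi> \<one> else 0)"
      by (intro sum.cong) (auto simp: \<rho>(2))
    also have "\<dots> = of_nat ?n * \<psi> \<one>" using fin by simp
    finally show ?thesis using card_carrier_pos[OF fin] by simp
  qed
  have "\<psi> \<in> set xs" if \<psi>: "\<psi> \<in> Irr G" for \<psi>
  proof (rule ccontr)
    assume "\<psi> \<notin> set xs"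
    then have "\<psi> \<one> = 0" using cnt[OF \<psi>] by (simp add: count_list_0_iff)
    then show False using Irr_degree[OF is_group \<psi>] by auto
  qed
  then have I: "Irr G = set xs" using xs(1) by blast
  moreover have "(\<Sum>\<chi>\<in>Irr G. \<chi> \<one> * \<chi> g) = (if g = \<one> then of_nat ?n else 0)" if "g \<in> carrier G" for g
  proof -
    have "(\<Sum>\<chi>\<in>Irr G. \<chi> \<one> * \<chi> g) = (\<Sum>\<chi>\<in>set xs. of_nat (count_list xs \<chi>) * \<chi> g)"
      using I cnt by (intro sum.cong) auto
    also have "\<dots> = (\<Sum>\<chi>\<leftarrow>xs. \<chi> g)" by (simp add: sum_list_map_eq_sum_count_list[of xs "set xs"])
    finally show ?thesis using xs(2)[OF that] \<rho>(2)[OF that] by simp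
  qed
  ultimately show ?thesis by simp
qed

lemma finite_Irr: "finite (carrier G) \<Longrightarrow> finite (Irr G)"
  and regular_character: "finite (carrier G) \<Longrightarrow> g \<in> carrier G \<Longrightarrow>
    (\<Sum>\<chi>\<in>Irr G. \<chi> \<one> * \<chi> g) = (if g = \<one> then of_nat (card (carrier G)) else 0)"
  using regular_character_aux by blast+

text \<open>Counting occurrences in one composition list makes multiplicities natural numbers by
  construction; orthogonality then identifies them with the inner products through which they are
  detected.\<close>

lemma rep_multiplicities:
  assumes fin: "finite (carrier G)" and \<rho>: "representation G n \<rho>"
  obtains m :: "('a \<Rightarrow> complex) \<Rightarrow> nat" where
    "\<And>g. g \<in> carrier G \<Longrightarrow> mat_trace (\<rho> g) = (\<Sum>\<chi>\<in>Irr G. of_nat (m \<chi>) * \<chi> g)"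
    "\<And>\<psi>. \<psi> \<in> Irr G \<Longrightarrow> (\<Sum>g\<in>carrier G. mat_trace (\<rho> g) * \<psi> (inv g)) = of_nat (card (carrier G)) * of_nat (m \<psi>)"
proof -
  obtain xs where xs: "set xs \<subseteq> Irr G" "\<And>g. g \<in> carrier G \<Longrightarrow> mat_trace (\<rho> g) = (\<Sum>\<chi>\<leftarrow>xs. \<chi> g)"
    using character_decomposition[OF \<rho>] by blast
  show thesis
  proof (rule that[of "count_list xs"])
    show "mat_trace (\<rho> g) = (\<Sum>\<chi>\<in>Irr G. of_nat (count_list xs \<chi>) * \<chi> g)" if "g \<in> carrier G" for g
      using xs that finite_Irr[OF fin] by (simp add: sum_list_map_eq_sum_count_list[of xs "Irr G"])
    show "(\<Sum>g\<in>carrier G. mat_trace (\<rho> g) * \<psi> (inv g)) = of_nat (card (carrier G)) * of_nat (count_list xs \<psi>)"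
      if "\<psi> \<in> Irr G" for \<psi>
      using sum_list_Irr_orthogonality[OF fin xs(1) that] by (simp add: xs(2))
  qed
qed

lemma conj_mult:
  assumes "a \<in> carrier G" "b \<in> carrier G" "x \<in> carrier G"
  shows "(a \<otimes> b) \<otimes> x \<otimes> inv (a \<otimes> b) = a \<otimes> (b \<otimes> x \<otimes> inv b) \<otimes> inv a"
  using assms by (simp add: inv_mult_group m_assoc)

lemma conj_inv_cancel:
  assumes "h \<in> carrier G" "x \<in> carrier G"
  shows "inv h \<otimes> (h \<otimes> x \<otimes> inv h) \<otimes> h = x" and "h \<otimes> (inv h \<otimes> x \<otimes> h) \<otimes> inv h = x"
  using conj_mult[of "inv h" h x] conj_mult[of h "inv h" x] assms by simp_all

lemma card_conjugators_conj:
  assumes x: "x \<in> carrier G" and y: "y \<in> carrier G" and h: "h \<in> carrier G"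
  shows "card {g \<in> carrier G. g \<otimes> x \<otimes> inv g = h \<otimes> y \<otimes> inv h} = card {g \<in> carrier G. g \<otimes> x \<otimes> inv g = y}"
proof (rule bij_betw_same_card[of "\<lambda>g. inv h \<otimes> g"], rule bij_betwI[where g = "\<lambda>g. h \<otimes> g"])
  show "(\<lambda>g. inv h \<otimes> g) \<in> {g \<in> carrier G. g \<otimes> x \<otimes> inv g = h \<otimes> y \<otimes> inv h} \<rightarrow> {g \<in> carrier G. g \<otimes> x \<otimes> inv g = y}"
    using h x y conj_mult[of "inv h" _ x] by (auto simp: conj_inv_cancel)
  show "(\<lambda>g. h \<otimes> g) \<in> {g \<in> carrier G. g \<otimes> x \<otimes> inv g = y} \<rightarrow> {g \<in> carrier G. g \<otimes> x \<otimes> inv g = h \<otimes> y \<otimes> inv h}"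
    using h x y conj_mult[of h _ x] by auto
qed (use h in \<open>auto simp: m_assoc[symmetric]\<close>)

text \<open>The classical formula for \<chi>(x) \<chi>(w) as an average of values on products of
  conjugates of \<open>x\<close> with \<open>w\<close>. Weighting \<open>y\<close> by the number of
  \<open>g\<close> conjugating \<open>x\<close> to \<open>y\<close> turns a sum over a conjugacy
  class into a sum over the whole group; this weight is a class function, so the weighted sum is
  central.\<close>

lemma Irr_class_average:
  assumes fin: "finite (carrier G)" and \<chi>: "\<chi> \<in> Irr G" and x: "x \<in> carrier G" and w: "w \<in> carrier G"
  shows "\<chi> \<one> * (\<Sum>g\<in>carrier G. \<chi> (g \<otimes> x \<otimes> inv g \<otimes> w)) = of_nat (card (carrier G)) * \<chi> x * \<chi> w"
proof -
  define f where "f y = (of_nat (card {g \<in> carrier G. g \<otimes> x \<otimes> inv g = y}) :: complex)" for y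
  have group_sum: "(\<Sum>g\<in>carrier G. F (g \<otimes> x \<otimes> inv g)) = (\<Sum>y\<in>carrier G. f y * F y)" for F :: "'a \<Rightarrow> complex"
  proof -
    have "(\<Sum>g\<in>carrier G. F (g \<otimes> x \<otimes> inv g))
      = (\<Sum>y\<in>carrier G. \<Sum>g\<in>{g \<in> carrier G. g \<otimes> x \<otimes> inv g = y}. F (g \<otimes> x \<otimes> inv g))"
      using fin x by (intro sum.group[symmetric]) auto
    also have "\<dots> = (\<Sum>y\<in>carrier G. f y * F y)"
      by (intro sum.cong refl) (simp add: f_def)
    finally show ?thesis .
  qed
  have "\<chi> \<one> * (\<Sum>y\<in>carrier G. f y * \<chi> (y \<otimes> w)) = (\<Sum>y\<in>carrier G. f y * \<chi> y) * \<chi> w"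
    using x w by (intro Irr_central_sum[OF \<chi>]) (auto simp: f_def card_conjugators_conj)
  moreover have "(\<Sum>y\<in>carrier G. f y * \<chi> y) = of_nat (card (carrier G)) * \<chi> x"
    using group_sum[of \<chi>, symmetric] x by (simp add: Irr_conj[OF \<chi>])
  ultimately show ?thesis using group_sum[of "\<lambda>y. \<chi> (y \<otimes> w)"] by simp
qed

text \<open>Each product \<chi>(x) \<chi>(y^-1) is spread out by \<open>Irr_class_average\<close>.
  Summed over \<chi>, the terms become values of the regular character at g x g^-1 y^-1, which
  detects exactly the \<open>g\<close> conjugating \<open>x\<close> to \<open>y\<close>. In this way
  the number of irreducible characters is never compared with the number of classes.\<close>

theorem second_orthogonality:
  assumes fin: "finite (carrier G)" and x: "x \<in> carrier G" and y: "y \<in> carrier G"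
  shows "(\<Sum>\<chi>\<in>Irr G. \<chi> x * \<chi> (inv y)) = of_nat (card {g \<in> carrier G. g \<otimes> x \<otimes> inv g = y})"
proof -
  let ?n = "of_nat (card (carrier G)) :: complex"
  have "?n * (\<Sum>\<chi>\<in>Irr G. \<chi> x * \<chi> (inv y))
    = (\<Sum>\<chi>\<in>Irr G. \<Sum>g\<in>carrier G. \<chi> \<one> * \<chi> (g \<otimes> x \<otimes> inv g \<otimes> inv y))"
    using x y by (simp add: sum_distrib_left Irr_class_average[OF fin, symmetric] mult.assoc[symmetric])
  also have "\<dots> = (\<Sum>g\<in>carrier G. \<Sum>\<chi>\<in>Irr G. \<chi> \<one> * \<chi> (g \<otimes> x \<otimes> inv g \<otimes> inv y))"
    by (rule sum.swap)
  also have "\<dots> = (\<Sum>g\<in>carrier G. if g \<otimes> x \<otimes> inv g = y then ?n else 0)"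
  proof (rule sum.cong[OF refl])
    fix g assume g: "g \<in> carrier G"
    have "g \<otimes> x \<otimes> inv g \<otimes> inv y = \<one> \<longleftrightarrow> g \<otimes> x \<otimes> inv g = y"
      using g x y by (metis inv_closed inv_equality inv_inv m_closed r_inv)
    then show "(\<Sum>\<chi>\<in>Irr G. \<chi> \<one> * \<chi> (g \<otimes> x \<otimes> inv g \<otimes> inv y)) = (if g \<otimes> x \<otimes> inv g = y then ?n else 0)"
      using g x y by (simp add: regular_character[OF fin])
  qed
  also have "\<dots> = ?n * of_nat (card {g \<in> carrier G. g \<otimes> x \<otimes> inv g = y})"
    using fin by (simp add: sum.If_cases Int_def mult.commute)
  finally show ?thesis using card_carrier_pos[OF fin] by simp
qed

lemma trivial_Irr: "restrict (\<lambda>_. 1) (carrier G) \<in> Irr G"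
proof -
  define \<rho> where "\<rho> = (\<lambda>_::'a. 1\<^sub>m 1 :: complex mat)"
  have "representation G 1 \<rho>" by (auto simp: representation_iff \<rho>_def)
  moreover have "W = {0\<^sub>v 1} \<or> W = carrier_vec 1" if W: "invariant_subspace G 1 \<rho> W" for W
  proof (cases "W = {0\<^sub>v 1}")
    case False
    note W' = W[unfolded invariant_subspace_iff]
    then obtain v where v: "v \<in> W" "v \<noteq> 0\<^sub>v 1" using False by blast
    have vc: "v \<in> carrier_vec 1" using v W' by auto
    have v0: "v $ 0 \<noteq> 0"
    proof
      assume "v $ 0 = 0"
      then have "v = 0\<^sub>v 1" using vc by (intro eq_vecI) auto
      then show False using v(2) by simp
    qed
    have "w \<in> W" if w: "w \<in> carrier_vec 1" for w
    proof -
      have "w = (w $ 0 / v $ 0) \<cdot>\<^sub>v v" using w vc v0 by (intro eq_vecI) auto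
      then show ?thesis using W' v(1) by metis
    qed
    then show ?thesis using W' by blast
  qed simp
  ultimately have "irreducible_representation G 1 \<rho>" by (simp add: irreducible_representation_def)
  then have "character_of G \<rho> \<in> Irr G" by (auto simp: Irr_def)
  moreover have "character_of G \<rho> = restrict (\<lambda>_. 1) (carrier G)"
    by (simp add: character_of_def \<rho>_def mat_trace_def)
  ultimately show ?thesis by simp
qed

section \<open>Restriction of characters to subgroups\<close>

lemma representation_subgroup:
  assumes "subgroup K G" and "representation G n \<rho>"
  shows "representation (G\<lparr>carrier := K\<rparr>) n \<rho>"
  using assms(2) subgroup.subset[OF assms(1)]
  unfolding representation_iff group.representation_iff[OF subgroup_imp_group[OF assms(1)]]
  by auto

lemma restrict_Irr_multiplicities:
  assumes fin: "finite (carrier G)" and K: "subgroup K G" and \<chi>: "\<chi> \<in> Irr G"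
  obtains m :: "('a \<Rightarrow> complex) \<Rightarrow> nat" where
    "\<And>k. k \<in> K \<Longrightarrow> \<chi> k = (\<Sum>\<psi>\<in>Irr (G\<lparr>carrier := K\<rparr>). of_nat (m \<psi>) * \<psi> k)"
    "\<And>\<psi>. \<psi> \<in> Irr (G\<lparr>carrier := K\<rparr>) \<Longrightarrow> (\<Sum>k\<in>K. \<chi> k * \<psi> (inv k)) = of_nat (card K) * of_nat (m \<psi>)"
proof -
  obtain n \<rho> where \<rho>: "irreducible_representation G n \<rho>" "representation G n \<rho>" "n > 0"
    "\<And>g. g \<in> carrier G \<Longrightarrow> \<chi> g = mat_trace (\<rho> g)" "\<chi> \<one> = of_nat n" using \<chi> by (rule IrrE) (rule that)
  interpret K: group "G\<lparr>carrier := K\<rparr>" using subgroup_imp_group[OF K] .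
  have KG: "K \<subseteq> carrier G" using subgroup.subset[OF K] .
  have finK: "finite (carrier (G\<lparr>carrier := K\<rparr>))" using fin KG finite_subset by auto
  show thesis
  proof (rule K.rep_multiplicities[OF finK representation_subgroup[OF K \<rho>(2)]])
    fix m :: "('a \<Rightarrow> complex) \<Rightarrow> nat"
    assume m1: "\<And>g. g \<in> carrier (G\<lparr>carrier := K\<rparr>) \<Longrightarrow>
        mat_trace (\<rho> g) = (\<Sum>\<chi>\<in>Irr (G\<lparr>carrier := K\<rparr>). of_nat (m \<chi>) * \<chi> g)"
      and m2: "\<And>\<psi>. \<psi> \<in> Irr (G\<lparr>carrier := K\<rparr>) \<Longrightarrow>
        (\<Sum>g\<in>carrier (G\<lparr>carrier := K\<rparr>). mat_trace (\<rho> g) * \<psi> (inv\<^bsub>G\<lparr>carrier := K\<rparr>\<^esub> g))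
          = of_nat (card (carrier (G\<lparr>carrier := K\<rparr>))) * of_nat (m \<psi>)"
    show thesis
    proof (rule that[of m])
      fix k assume "k \<in> K"
      then show "\<chi> k = (\<Sum>\<psi>\<in>Irr (G\<lparr>carrier := K\<rparr>). of_nat (m \<psi>) * \<psi> k)"
        using m1[of k] \<rho>(4)[of k] KG by auto
    next
      fix \<psi> assume \<psi>: "\<psi> \<in> Irr (G\<lparr>carrier := K\<rparr>)"
      have "(\<Sum>k\<in>K. \<chi> k * \<psi> (inv k)) = (\<Sum>g\<in>K. mat_trace (\<rho> g) * \<psi> (inv\<^bsub>G\<lparr>carrier := K\<rparr>\<^esub> g))"
        using KG by (intro sum.cong refl) (auto simp: \<rho>(4) m_inv_consistent[OF K])
      then show "(\<Sum>k\<in>K. \<chi> k * \<psi> (inv k)) = of_nat (card K) * of_nat (m \<psi>)" using m2[OF \<psi>] by simp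
    qed
  qed
qed

text \<open>\<open>d\<close> is the multiplicity of the trivial character in the restriction of
  \<chi> to \<open>K\<close>, in other words the dimension of the space of \<open>K\<close>-fixed
  vectors. Fixed spaces appear below only in the form of this sum.\<close>

lemma sum_Irr_subgroup:
  assumes fin: "finite (carrier G)" and K: "subgroup K G" and \<chi>: "\<chi> \<in> Irr G"
  obtains d :: nat where "(\<Sum>k\<in>K. \<chi> k) = of_nat (card K) * of_nat d"
proof -
  obtain m :: "('a \<Rightarrow> complex) \<Rightarrow> nat" where m:
    "\<And>k. k \<in> K \<Longrightarrow> \<chi> k = (\<Sum>\<psi>\<in>Irr (G\<lparr>carrier := K\<rparr>). of_nat (m \<psi>) * \<psi> k)"
    "\<And>\<psi>. \<psi> \<in> Irr (G\<lparr>carrier := K\<rparr>) \<Longrightarrow> (\<Sum>k\<in>K. \<chi> k * \<psi> (inv k)) = of_nat (card K) * of_nat (m \<psi>)"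
    using fin K \<chi> by (rule restrict_Irr_multiplicities) (rule that)
  have "restrict (\<lambda>_. 1) K \<in> Irr (G\<lparr>carrier := K\<rparr>)"
    using group.trivial_Irr[OF subgroup_imp_group[OF K]] by simp
  from m(2)[OF this] have "(\<Sum>k\<in>K. \<chi> k) = of_nat (card K) * of_nat (m (restrict (\<lambda>_. 1) K))"
    using subgroup.m_inv_closed[OF K] by simp
  then show thesis by (rule that)
qed

end

section \<open>Lower bound from a supplement of a normal subgroup\<close>

context group
begin

text \<open>\<open>m \<theta>\<close> is the multiplicity of \<theta> in the permutation character
  on the cosets of \<open>M\<close>. The set in the hypothesis is the stabilizer in \<open>M\<close>
  of the coset of \<open>inv c\<close>, so every orbit of \<open>M\<close> other than the base point
  has length at least \<open>p\<close>. Fact \<open>A\<close> computes the degree and fact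
  \<open>B\<close> the rank of the permutation character, both scaled by powers of
  \<open>card M\<close>. Removing the trivial constituent leaves an inequality between sums that has
  to hold for a single \<theta>.\<close>

lemma exists_Irr_small_fixed_space:
  assumes fin: "finite (carrier G)" and M: "subgroup M G" and ne: "M \<noteq> carrier G"
    and small: "\<And>c. c \<in> carrier G \<Longrightarrow> c \<notin> M \<Longrightarrow> p * card {k \<in> M. c \<otimes> k \<otimes> inv c \<in> M} \<le> card M"
  obtains \<theta> m d where "\<theta> \<in> Irr G" "\<theta> \<noteq> restrict (\<lambda>_. 1) (carrier G)" "m > 0"
    "(\<Sum>k\<in>M. \<theta> k) = of_nat (card M) * of_nat m" "\<theta> \<one> = of_nat d" "p * m \<le> d"
proof -
  let ?triv = "restrict (\<lambda>_. 1 :: complex) (carrier G)"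
  note finI = finite_Irr[OF fin] and triv = trivial_Irr
  have MG: "M \<subseteq> carrier G" using subgroup.subset[OF M] .
  have finM: "finite M" using MG fin finite_subset by blast
  have oneM: "\<one> \<in> M" using subgroup.one_closed[OF M] .
  have cM: "card M > 0" using oneM finM card_gt_0_iff by blast
  have "\<exists>d. (\<Sum>k\<in>M. \<theta> k) = of_nat (card M) * of_nat d" if "\<theta> \<in> Irr G" for \<theta>
    by (rule sum_Irr_subgroup[OF fin M that]) blast
  then obtain m :: "('a \<Rightarrow> complex) \<Rightarrow> nat"
    where m: "\<And>\<theta>. \<theta> \<in> Irr G \<Longrightarrow> (\<Sum>k\<in>M. \<theta> k) = of_nat (card M) * of_nat (m \<theta>)" by metis
  obtain d :: "('a \<Rightarrow> complex) \<Rightarrow> nat" where d: "\<And>\<theta>. \<theta> \<in> Irr G \<Longrightarrow> \<theta> \<one> = of_nat (d \<theta>)"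
    using Irr_degree[OF is_group] by metis
  have m1: "m ?triv = 1" using m[OF triv] MG cM by (simp add: subset_iff)
  have d1: "d ?triv = 1" using d[OF triv] by simp
  \<comment> \<open>Degree: summed over all \<theta>, the regular character keeps only the term of
    the identity of \<open>M\<close>.\<close>
  have "of_nat (card M * (\<Sum>\<theta>\<in>Irr G. m \<theta> * d \<theta>)) = (\<Sum>\<theta>\<in>Irr G. \<theta> \<one> * (\<Sum>k\<in>M. \<theta> k))"
    by (simp add: m d sum_distrib_left mult_ac)
  also have "\<dots> = (\<Sum>\<theta>\<in>Irr G. \<Sum>k\<in>M. \<theta> \<one> * \<theta> k)" by (simp add: sum_distrib_left)
  also have "\<dots> = (\<Sum>k\<in>M. \<Sum>\<theta>\<in>Irr G. \<theta> \<one> * \<theta> k)" by (rule sum.swap)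
  also have "\<dots> = (\<Sum>k\<in>M. if k = \<one> then of_nat (card (carrier G)) else 0)"
    using MG by (intro sum.cong refl regular_character[OF fin]) auto
  also have "\<dots> = (of_nat (card (carrier G)) :: complex)" using oneM finM by simp
  finally have A: "card M * (\<Sum>\<theta>\<in>Irr G. m \<theta> * d \<theta>) = card (carrier G)" by (simp only: of_nat_eq_iff)
  \<comment> \<open>Rank: second orthogonality turns the sum of squares into the number of pairs of
    \<open>g\<close> in \<open>G\<close> and \<open>k\<close> in \<open>M\<close> with g k g^-1 in
    \<open>M\<close>. The \<open>g\<close> in \<open>M\<close> account for the trivial
    orbit.\<close>
  have "of_nat ((card M)\<^sup>2 * (\<Sum>\<theta>\<in>Irr G. (m \<theta>)\<^sup>2)) = (\<Sum>\<theta>\<in>Irr G. (\<Sum>k\<in>M. \<theta> k) * (\<Sum>l\<in>M. \<theta> (inv l)))"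
  proof -
    have "(\<Sum>l\<in>M. \<theta> (inv l)) = (\<Sum>l\<in>M. \<theta> l)" for \<theta> :: "'a \<Rightarrow> complex"
      by (rule sum.reindex_bij_witness[of _ "\<lambda>l. inv l" "\<lambda>l. inv l"])
        (use MG subgroup.m_inv_closed[OF M] in auto)
    then show ?thesis by (simp add: m sum_distrib_left power2_eq_square mult_ac)
  qed
  also have "\<dots> = (\<Sum>\<theta>\<in>Irr G. \<Sum>k\<in>M. \<Sum>l\<in>M. \<theta> k * \<theta> (inv l))" by (simp add: sum_product)
  also have "\<dots> = (\<Sum>k\<in>M. \<Sum>\<theta>\<in>Irr G. \<Sum>l\<in>M. \<theta> k * \<theta> (inv l))" by (rule sum.swap)
  also have "\<dots> = (\<Sum>k\<in>M. \<Sum>l\<in>M. \<Sum>\<theta>\<in>Irr G. \<theta> k * \<theta> (inv l))" by (intro sum.cong refl sum.swap)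
  also have "\<dots> = (\<Sum>k\<in>M. \<Sum>l\<in>M. of_nat (card {g \<in> carrier G. g \<otimes> k \<otimes> inv g = l}))"
    using MG by (intro sum.cong refl second_orthogonality[OF fin]) auto
  also have "\<dots> = of_nat (\<Sum>k\<in>M. \<Sum>l\<in>M. card {g \<in> carrier G. g \<otimes> k \<otimes> inv g = l})" by simp
  finally have "(card M)\<^sup>2 * (\<Sum>\<theta>\<in>Irr G. (m \<theta>)\<^sup>2) = (\<Sum>k\<in>M. \<Sum>l\<in>M. card {g \<in> carrier G. g \<otimes> k \<otimes> inv g = l})"
    by (simp only: of_nat_eq_iff)
  also have "\<dots> = (\<Sum>k\<in>M. \<Sum>l\<in>M. \<Sum>g\<in>carrier G. if g \<otimes> k \<otimes> inv g = l then 1 else 0)"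
    using fin by (intro sum.cong refl) (simp add: sum.If_cases Int_def)
  also have "\<dots> = (\<Sum>k\<in>M. \<Sum>g\<in>carrier G. \<Sum>l\<in>M. if g \<otimes> k \<otimes> inv g = l then 1 else 0)"
    by (intro sum.cong refl sum.swap)
  also have "\<dots> = (\<Sum>k\<in>M. \<Sum>g\<in>carrier G. if g \<otimes> k \<otimes> inv g \<in> M then 1 else 0)"
    using finM by (intro sum.cong refl) simp
  also have "\<dots> = (\<Sum>g\<in>carrier G. \<Sum>k\<in>M. if g \<otimes> k \<otimes> inv g \<in> M then 1 else 0)" by (rule sum.swap)
  also have "\<dots> = (\<Sum>g\<in>carrier G. card {k \<in> M. g \<otimes> k \<otimes> inv g \<in> M})"
    using finM by (intro sum.cong refl) (simp add: sum.If_cases Int_def)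
  also have "\<dots> = (\<Sum>g\<in>M. card {k \<in> M. g \<otimes> k \<otimes> inv g \<in> M})
      + (\<Sum>g\<in>carrier G - M. card {k \<in> M. g \<otimes> k \<otimes> inv g \<in> M})"
    by (subst sum.subset_diff[OF MG fin]) (rule add.commute)
  also have "(\<Sum>g\<in>M. card {k \<in> M. g \<otimes> k \<otimes> inv g \<in> M}) = (\<Sum>g\<in>M. card M)"
  proof (intro sum.cong refl arg_cong[where f = card])
    fix g assume "g \<in> M"
    then show "{k \<in> M. g \<otimes> k \<otimes> inv g \<in> M} = M"
      using subgroup.m_closed[OF M] subgroup.m_inv_closed[OF M] by auto
  qed
  finally have B: "(card M)\<^sup>2 * (\<Sum>\<theta>\<in>Irr G. (m \<theta>)\<^sup>2)
    = card M * card M + (\<Sum>g\<in>carrier G - M. card {k \<in> M. g \<otimes> k \<otimes> inv g \<in> M})" by simp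
  have "p * (\<Sum>g\<in>carrier G - M. card {k \<in> M. g \<otimes> k \<otimes> inv g \<in> M}) \<le> (\<Sum>g\<in>carrier G - M. card M)"
    unfolding sum_distrib_left using small by (intro sum_mono) auto
  also have "\<dots> = (card (carrier G) - card M) * card M"
    using MG finM by (simp add: card_Diff_subset)
  finally have C: "p * (\<Sum>g\<in>carrier G - M. card {k \<in> M. g \<otimes> k \<otimes> inv g \<in> M})
    \<le> (card (carrier G) - card M) * card M" .
  define S where "S = Irr G - {?triv}"
  have finS: "finite S" using finI by (simp add: S_def)
  have split: "(\<Sum>\<theta>\<in>Irr G. f \<theta>) = f ?triv + (\<Sum>\<theta>\<in>S. f \<theta>)" for f :: "('a \<Rightarrow> complex) \<Rightarrow> nat"
    unfolding S_def by (rule sum.remove[OF finI triv])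
  have "card M * (1 + (\<Sum>\<theta>\<in>S. m \<theta> * d \<theta>)) = card (carrier G)"
    using A split[of "\<lambda>\<theta>. m \<theta> * d \<theta>"] by (simp add: m1 d1)
  then have A': "card M * (\<Sum>\<theta>\<in>S. m \<theta> * d \<theta>) = card (carrier G) - card M" by simp
  have "(card M)\<^sup>2 * (\<Sum>\<theta>\<in>S. (m \<theta>)\<^sup>2) = (\<Sum>g\<in>carrier G - M. card {k \<in> M. g \<otimes> k \<otimes> inv g \<in> M})"
    using B split[of "\<lambda>\<theta>. (m \<theta>)\<^sup>2"] by (simp add: m1 power2_eq_square distrib_left)
  with C A' have "p * ((card M)\<^sup>2 * (\<Sum>\<theta>\<in>S. (m \<theta>)\<^sup>2)) \<le> card M * (\<Sum>\<theta>\<in>S. m \<theta> * d \<theta>) * card M"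
    by simp
  then have le: "p * (\<Sum>\<theta>\<in>S. (m \<theta>)\<^sup>2) \<le> (\<Sum>\<theta>\<in>S. m \<theta> * d \<theta>)"
    using cM by (simp add: power2_eq_square mult_ac)
  have "card M < card (carrier G)" using MG ne fin by (simp add: psubset_card_mono psubset_eq)
  then have pos: "(\<Sum>\<theta>\<in>S. m \<theta> * d \<theta>) \<noteq> 0" using A' by (metis mult_0_right zero_less_diff less_irrefl)
  \<comment> \<open>Otherwise \<open>le\<close> would fail strictly. The strict term needs some
    \<theta> in \<open>S\<close> with \<open>m \<theta> > 0\<close>, and \<open>pos\<close> supplies
    it because \<open>M\<close> is a proper subgroup.\<close>
  have "\<exists>\<theta>\<in>S. m \<theta> > 0 \<and> p * m \<theta> \<le> d \<theta>"
  proof (rule ccontr)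
    assume "\<not> ?thesis"
    then have small': "d \<theta> < p * m \<theta>" if "\<theta> \<in> S" "m \<theta> > 0" for \<theta> using that by (meson not_le)
    obtain \<theta> where \<theta>: "\<theta> \<in> S" "m \<theta> > 0"
      using pos by (metis (no_types, lifting) mult_0 neq0_conv sum.neutral)
    have "(\<Sum>\<theta>\<in>S. m \<theta> * d \<theta>) < (\<Sum>\<theta>\<in>S. p * (m \<theta>)\<^sup>2)"
    proof (rule sum_strict_mono_ex1[OF finS])
      show "\<forall>\<theta>\<in>S. m \<theta> * d \<theta> \<le> p * (m \<theta>)\<^sup>2"
      proof
        fix \<theta> assume "\<theta> \<in> S"
        then have "m \<theta> = 0 \<or> d \<theta> \<le> p * m \<theta>" using small' by fastforce
        then have "m \<theta> * d \<theta> \<le> m \<theta> * (p * m \<theta>)" using mult_le_mono2 by auto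
        then show "m \<theta> * d \<theta> \<le> p * (m \<theta>)\<^sup>2" by (simp add: power2_eq_square mult_ac)
      qed
      have "m \<theta> * d \<theta> < m \<theta> * (p * m \<theta>)" using small'[OF \<theta>] \<theta>(2) by simp
      then show "\<exists>\<theta>\<in>S. m \<theta> * d \<theta> < p * (m \<theta>)\<^sup>2"
        using \<theta>(1) by (auto simp: power2_eq_square mult_ac)
    qed
    then show False using le by (simp add: sum_distrib_left)
  qed
  then obtain \<theta> where \<theta>: "\<theta> \<in> S" "m \<theta> > 0" "p * m \<theta> \<le> d \<theta>" by blast
  then have "\<theta> \<in> Irr G" "\<theta> \<noteq> ?triv" by (auto simp: S_def)
  then show thesis using that \<theta>(2,3) m d by blast
qed

text \<open>Up to a factor, the values \<open>\<theta> (inv g)\<close> are the coefficients of the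
  central idempotent of \<theta>. Convolving with them annihilates every other irreducible character
  and so projects \<open>f\<close> to its \<theta>-component.\<close>

lemma Irr_convolution:
  assumes fin: "finite (carrier G)" and \<theta>: "\<theta> \<in> Irr G" and y: "y \<in> carrier G"
    and f: "\<And>g. g \<in> carrier G \<Longrightarrow> f g = (\<Sum>\<psi>\<in>Irr G. c \<psi> * \<psi> g)"
  shows "\<theta> \<one> * (\<Sum>g\<in>carrier G. \<theta> (inv g) * f (g \<otimes> y)) = of_nat (card (carrier G)) * c \<theta> * \<theta> y"
proof -
  have conv: "\<psi> \<one> * (\<Sum>g\<in>carrier G. \<theta> (inv g) * \<psi> (g \<otimes> y)) = (if \<psi> = \<theta> then of_nat (card (carrier G)) * \<theta> y else 0)"
    if \<psi>: "\<psi> \<in> Irr G" for \<psi>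
  proof -
    have inv_conj: "inv (h \<otimes> x \<otimes> inv h) = h \<otimes> inv x \<otimes> inv h" if "x \<in> carrier G" "h \<in> carrier G" for x h
      using that by (simp add: inv_mult_group m_assoc)
    have "\<psi> \<one> * (\<Sum>g\<in>carrier G. \<theta> (inv g) * \<psi> (g \<otimes> y)) = (\<Sum>g\<in>carrier G. \<theta> (inv g) * \<psi> g) * \<psi> y"
      using y by (intro Irr_central_sum[OF \<psi>]) (auto simp: inv_conj Irr_conj[OF \<theta>])
    also have "(\<Sum>g\<in>carrier G. \<theta> (inv g) * \<psi> g) = (if \<psi> = \<theta> then of_nat (card (carrier G)) else 0)"
      using Irr_orthogonality[OF fin \<psi> \<theta>] by (simp add: mult.commute)
    finally show ?thesis by auto
  qed
  have \<theta>0: "\<theta> \<one> \<noteq> 0" using Irr_degree[OF is_group \<theta>] by auto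
  have conv': "(\<Sum>g\<in>carrier G. \<theta> (inv g) * \<psi> (g \<otimes> y)) = (if \<psi> = \<theta> then of_nat (card (carrier G)) * \<theta> y / \<theta> \<one> else 0)"
    if \<psi>: "\<psi> \<in> Irr G" for \<psi>
  proof -
    have "\<psi> \<one> \<noteq> 0" using Irr_degree[OF is_group \<psi>] by auto
    then show ?thesis using conv[OF \<psi>] by (auto simp: field_simps split: if_splits)
  qed
  have "(\<Sum>g\<in>carrier G. \<theta> (inv g) * f (g \<otimes> y)) = (\<Sum>g\<in>carrier G. \<Sum>\<psi>\<in>Irr G. c \<psi> * (\<theta> (inv g) * \<psi> (g \<otimes> y)))"
    using y by (intro sum.cong refl) (simp add: f sum_distrib_left mult_ac)
  also have "\<dots> = (\<Sum>\<psi>\<in>Irr G. c \<psi> * (\<Sum>g\<in>carrier G. \<theta> (inv g) * \<psi> (g \<otimes> y)))"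
    by (subst sum.swap) (simp add: sum_distrib_left)
  also have "\<dots> = (\<Sum>\<psi>\<in>Irr G. if \<psi> = \<theta> then c \<theta> * (of_nat (card (carrier G)) * \<theta> y / \<theta> \<one>) else 0)"
    by (intro sum.cong refl) (simp add: conv')
  also have "\<dots> = c \<theta> * (of_nat (card (carrier G)) * \<theta> y / \<theta> \<one>)"
    using \<theta> finite_Irr[OF fin] by simp
  finally show ?thesis using \<theta>0 by simp
qed

end

section \<open>Inflation along surjective homomorphisms\<close>

lemma irreducible_representation_comp:
  assumes f: "group_hom K L f" and surj: "f ` carrier K = carrier L"
    and irr: "irreducible_representation L n \<tau>"
  shows "irreducible_representation K n (\<tau> \<circ> f)"
proof -
  interpret f: group_hom K L f by fact
  have "representation L n \<tau>" "n > 0" using irr by (auto simp: irreducible_representation_def)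
  then have rep: "representation K n (\<tau> \<circ> f)"
    by (simp add: f.G.representation_iff f.H.representation_iff)
  moreover have "W = {0\<^sub>v n} \<or> W = carrier_vec n" if W: "invariant_subspace K n (\<tau> \<circ> f) W" for W
  proof -
    have "invariant_subspace L n \<tau> W"
      using W unfolding f.G.invariant_subspace_iff f.H.invariant_subspace_iff surj[symmetric] by simp
    then show ?thesis using irr by (auto simp: irreducible_representation_def)
  qed
  ultimately show ?thesis using \<open>n > 0\<close> by (simp add: irreducible_representation_def)
qed

lemma Irr_comp:
  assumes f: "group_hom K L f" and surj: "f ` carrier K = carrier L" and \<chi>: "\<chi> \<in> Irr L"
  shows "restrict (\<chi> \<circ> f) (carrier K) \<in> Irr K"
proof -
  interpret f: group_hom K L f by fact
  obtain n \<tau> where \<tau>: "irreducible_representation L n \<tau>" "\<chi> = character_of L \<tau>"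
    using \<chi> by (auto simp: Irr_def)
  have "character_of K (\<tau> \<circ> f) = restrict (\<chi> \<circ> f) (carrier K)"
    by (auto simp: character_of_def \<tau>(2) restrict_def)
  moreover have "character_of K (\<tau> \<circ> f) \<in> Irr K"
    using irreducible_representation_comp[OF f surj \<tau>(1)] by (auto simp: Irr_def)
  ultimately show ?thesis by simp
qed

lemma inj_on_Irr_comp:
  assumes f: "group_hom K L f" and surj: "f ` carrier K = carrier L"
  shows "inj_on (\<lambda>\<chi>. restrict (\<chi> \<circ> f) (carrier K)) (Irr L)"
proof (rule inj_onI)
  interpret f: group_hom K L f by fact
  fix \<chi> \<psi> assume I: "\<chi> \<in> Irr L" "\<psi> \<in> Irr L"
    and eq: "restrict (\<chi> \<circ> f) (carrier K) = restrict (\<psi> \<circ> f) (carrier K)"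
  show "\<chi> = \<psi>"
  proof (rule f.H.Irr_eqI[OF I])
    fix g assume "g \<in> carrier L"
    then obtain k where "k \<in> carrier K" "g = f k" using surj by blast
    then show "\<chi> g = \<psi> g" using fun_cong[OF eq, of k] by simp
  qed
qed

lemma hom_restrict_carrier:
  assumes "h \<in> hom G L" and "P \<subseteq> carrier G"
  shows "h \<in> hom (G\<lparr>carrier := P\<rparr>) L"
  using assms by (auto simp: hom_def)

text \<open>The instance in view takes for \<open>H\<close> the normalizer of a Sylow subgroup of
  \<open>N\<close>, but only the factorization of \<open>G\<close> as \<open>N H\<close> is used
  here. It makes \<open>H\<close> map onto \<open>G/N\<close> with kernel \<open>M\<close>.\<close>

locale normal_supplement = normal N G for N and G (structure) +
  fixes H
  assumes fin: "finite (carrier G)" and H: "subgroup H G"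
    and supplement: "\<And>g. g \<in> carrier G \<Longrightarrow> \<exists>n\<in>N. \<exists>h\<in>H. g = n \<otimes> h"
begin

abbreviation M where "M \<equiv> H \<inter> N"
abbreviation GN where "GN \<equiv> G\<lparr>carrier := N\<rparr>"
abbreviation GH where "GH \<equiv> G\<lparr>carrier := H\<rparr>"

lemma NG: "N \<subseteq> carrier G" and HG: "H \<subseteq> carrier G"
  using subset subgroup.subset[OF H] .

lemma fin_N: "finite N" and fin_H: "finite H"
  using NG HG fin finite_subset by blast+

lemma group_GN: "group GN" and group_GH: "group GH"
  using subgroup_imp_group[OF subgroup_axioms] subgroup_imp_group[OF H] .

lemma subgroup_M: "subgroup M G" and subgroup_M_GN: "subgroup M GN" and subgroup_M_GH: "subgroup M GH"
proof -
  show s: "subgroup M G" using subgroups_Inter_pair[OF H subgroup_axioms] .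
  show "subgroup M GN" "subgroup M GH"
    using subgroup_incl[OF s subgroup_axioms] subgroup_incl[OF s H] by auto
qed

lemma inv_N: "n \<in> N \<Longrightarrow> inv\<^bsub>GN\<^esub> n = inv n" and inv_H: "h \<in> H \<Longrightarrow> inv\<^bsub>GH\<^esub> h = inv h"
  by (simp_all add: m_inv_consistent[OF subgroup_axioms] m_inv_consistent[OF H])

lemma sum_N_conj: "g \<in> carrier G \<Longrightarrow> (\<Sum>n\<in>N. f (inv g \<otimes> n \<otimes> g)) = (\<Sum>n\<in>N. f n)"
  by (rule sum.reindex_bij_witness[of _ "\<lambda>n. g \<otimes> n \<otimes> inv g" "\<lambda>n. inv g \<otimes> n \<otimes> g"])
    (use NG inv_op_closed1 inv_op_closed2 in \<open>auto simp: conj_inv_cancel subset_iff\<close>)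

lemma Irr_GN_conj: "\<theta> \<in> Irr GN \<Longrightarrow> n \<in> N \<Longrightarrow> x \<in> N \<Longrightarrow> \<theta> (n \<otimes> x \<otimes> inv n) = \<theta> x"
  using group.Irr_conj[OF group_GN, of \<theta> x n] by (simp add: inv_N)

text \<open>This replaces invariance of \<theta>. Writing g = n h, the factor \<open>n\<close>
  disappears because \<theta> is a class function of \<open>N\<close>, and \<open>h\<close> merely
  permutes \<open>M\<close>. So all \<open>G\<close>-conjugates of \<theta> have fixed spaces of the
  same dimension under \<open>M\<close>.\<close>

lemma sum_M_conj:
  assumes \<theta>: "\<theta> \<in> Irr GN" and g: "g \<in> carrier G"
  shows "(\<Sum>k\<in>M. \<theta> (g \<otimes> k \<otimes> inv g)) = (\<Sum>k\<in>M. \<theta> k)"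
proof -
  obtain n h where nh: "n \<in> N" "h \<in> H" "g = n \<otimes> h" using supplement[OF g] by blast
  have hG: "h \<in> carrier G" and nG: "n \<in> carrier G" using nh NG HG by auto
  have "(\<Sum>k\<in>M. \<theta> (g \<otimes> k \<otimes> inv g)) = (\<Sum>k\<in>M. \<theta> (h \<otimes> k \<otimes> inv h))"
  proof (rule sum.cong[OF refl])
    fix k assume k: "k \<in> M"
    then have "h \<otimes> k \<otimes> inv h \<in> N" using inv_op_closed2[OF hG] by blast
    then show "\<theta> (g \<otimes> k \<otimes> inv g) = \<theta> (h \<otimes> k \<otimes> inv h)"
      using Irr_GN_conj[OF \<theta> nh(1)] conj_mult[OF nG hG, of k] k NG nh(3) by auto
  qed
  also have "\<dots> = (\<Sum>k\<in>M. \<theta> k)"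
  proof (rule sum.reindex_bij_witness[of _ "\<lambda>k. inv h \<otimes> k \<otimes> h" "\<lambda>k. h \<otimes> k \<otimes> inv h"])
    fix k assume k: "k \<in> M"
    then have kG: "k \<in> carrier G" using NG by auto
    show "inv h \<otimes> (h \<otimes> k \<otimes> inv h) \<otimes> h = k" "h \<otimes> (inv h \<otimes> k \<otimes> h) \<otimes> inv h = k"
      using conj_inv_cancel[OF hG kG] .
    show "h \<otimes> k \<otimes> inv h \<in> M" "inv h \<otimes> k \<otimes> h \<in> M"
      using k inv_op_closed1[OF hG] inv_op_closed2[OF hG] nh(2) subgroup.m_closed[OF H] subgroup.m_inv_closed[OF H]
      by auto
  qed simp
  finally show ?thesis .
qed

text \<open>Up to the factor |H| |N|, the left side is the inner product of the characters induced
  from \<beta> and \<theta>, which second orthogonality computes without constructing them. As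
  \<open>N\<close> is normal, an element of \<open>H\<close> conjugate into \<open>N\<close> lies in
  \<open>M\<close>, where \<beta> is constant. A nonzero right side produces a \<chi> that involves
  \<beta> on \<open>H\<close> and \<theta> on \<open>N\<close> at the same time.\<close>

lemma sum_Irr_multiplicities:
  assumes \<beta>: "\<And>k. k \<in> M \<Longrightarrow> \<beta> k = b" and \<theta>: "\<theta> \<in> Irr GN"
  shows "(\<Sum>\<chi>\<in>Irr G. (\<Sum>h\<in>H. \<chi> h * \<beta> (inv h)) * (\<Sum>n\<in>N. \<chi> n * \<theta> (inv n)))
    = of_nat (card (carrier G)) * b * (\<Sum>k\<in>M. \<theta> k)"
proof -
  have "(\<Sum>n\<in>N. \<chi> n * \<theta> (inv n)) = (\<Sum>n\<in>N. \<chi> (inv n) * \<theta> n)" for \<chi> :: "'a \<Rightarrow> complex"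
    by (rule sum.reindex_bij_witness[of _ "\<lambda>n. inv n" "\<lambda>n. inv n"]) (use NG in auto)
  then have "(\<Sum>\<chi>\<in>Irr G. (\<Sum>h\<in>H. \<chi> h * \<beta> (inv h)) * (\<Sum>n\<in>N. \<chi> n * \<theta> (inv n)))
    = (\<Sum>\<chi>\<in>Irr G. \<Sum>h\<in>H. \<Sum>n\<in>N. \<beta> (inv h) * \<theta> n * (\<chi> h * \<chi> (inv n)))"
    by (simp add: sum_product mult_ac)
  also have "\<dots> = (\<Sum>h\<in>H. \<Sum>\<chi>\<in>Irr G. \<Sum>n\<in>N. \<beta> (inv h) * \<theta> n * (\<chi> h * \<chi> (inv n)))" by (rule sum.swap)
  also have "\<dots> = (\<Sum>h\<in>H. \<Sum>n\<in>N. \<Sum>\<chi>\<in>Irr G. \<beta> (inv h) * \<theta> n * (\<chi> h * \<chi> (inv n)))"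
    by (intro sum.cong refl sum.swap)
  also have "\<dots> = (\<Sum>h\<in>H. \<Sum>n\<in>N. \<beta> (inv h) * \<theta> n * of_nat (card {g \<in> carrier G. g \<otimes> h \<otimes> inv g = n}))"
    using NG HG by (intro sum.cong refl) (auto simp: sum_distrib_left[symmetric] second_orthogonality[OF fin])
  also have "\<dots> = (\<Sum>h\<in>H. \<Sum>n\<in>N. \<Sum>g\<in>carrier G. if g \<otimes> h \<otimes> inv g = n then \<beta> (inv h) * \<theta> n else 0)"
    using fin by (intro sum.cong refl) (simp add: sum.If_cases Int_def mult.commute)
  also have "\<dots> = (\<Sum>h\<in>H. \<Sum>g\<in>carrier G. \<Sum>n\<in>N. if g \<otimes> h \<otimes> inv g = n then \<beta> (inv h) * \<theta> n else 0)"
    by (intro sum.cong refl sum.swap)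
  also have "\<dots> = (\<Sum>h\<in>H. \<Sum>g\<in>carrier G. if h \<in> N then \<beta> (inv h) * \<theta> (g \<otimes> h \<otimes> inv g) else 0)"
  proof (intro sum.cong refl)
    fix h g assume h: "h \<in> H" and g: "g \<in> carrier G"
    have hG: "h \<in> carrier G" using h HG by auto
    have "g \<otimes> h \<otimes> inv g \<in> N \<longleftrightarrow> h \<in> N"
      using inv_op_closed2[OF g, of h] inv_op_closed1[OF g, of "g \<otimes> h \<otimes> inv g"] conj_inv_cancel(1)[OF g hG] by auto
    then show "(\<Sum>n\<in>N. if g \<otimes> h \<otimes> inv g = n then \<beta> (inv h) * \<theta> n else 0)
      = (if h \<in> N then \<beta> (inv h) * \<theta> (g \<otimes> h \<otimes> inv g) else 0)"
      using fin_N by simp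
  qed
  also have "\<dots> = (\<Sum>g\<in>carrier G. \<Sum>h\<in>H. if h \<in> N then \<beta> (inv h) * \<theta> (g \<otimes> h \<otimes> inv g) else 0)"
    by (rule sum.swap)
  also have "\<dots> = (\<Sum>g\<in>carrier G. \<Sum>k\<in>M. \<beta> (inv k) * \<theta> (g \<otimes> k \<otimes> inv g))"
    using fin_H by (simp add: sum.inter_restrict)
  also have "\<dots> = (\<Sum>g\<in>carrier G. b * (\<Sum>k\<in>M. \<theta> (g \<otimes> k \<otimes> inv g)))"
    using subgroup.m_inv_closed[OF subgroup_M] \<beta> by (simp add: sum_distrib_left)
  also have "\<dots> = of_nat (card (carrier G)) * b * (\<Sum>k\<in>M. \<theta> k)"
    by (simp add: sum_M_conj[OF \<theta>] cong: sum.cong)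
  finally show ?thesis .
qed

text \<open>Clifford's theorem would give this; instead, let the \<open>G\<close>-invariant central element of the group algebra
  of \<open>N\<close> with coefficients \<open>F\<close> act on \<open>\<chi>\<close> and take the trace against the sum of the elements of \<open>M\<close>.\<close>

lemma degree_ratio:
  assumes \<chi>: "\<chi> \<in> Irr G" and \<theta>: "\<theta> \<in> Irr GN" and ne: "(\<Sum>n\<in>N. \<chi> n * \<theta> (inv n)) \<noteq> 0"
  shows "\<chi> \<one> * (\<Sum>k\<in>M. \<theta> k) = \<theta> \<one> * (\<Sum>k\<in>M. \<chi> k)"
proof -
  define E where "E = (\<Sum>n\<in>N. \<chi> n * \<theta> (inv n))"
  \<comment> \<open>Summing over all conjugates of \<theta> makes the coefficients constant on
    \<open>G\<close>-classes, so that the corresponding element is central for \<open>G\<close> and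
    not only for \<open>N\<close>.\<close>
  define F where "F n = (\<Sum>g\<in>carrier G. \<theta> (g \<otimes> inv n \<otimes> inv g))" for n
  have swap: "(\<Sum>n\<in>N. \<theta> (g \<otimes> inv n \<otimes> inv g) * f n) = (\<Sum>n\<in>N. \<theta> (inv n) * f (inv g \<otimes> n \<otimes> g))"
    if g: "g \<in> carrier G" for g f
  proof -
    have "(\<Sum>n\<in>N. \<theta> (g \<otimes> inv n \<otimes> inv g) * f n)
      = (\<Sum>n\<in>N. \<theta> (g \<otimes> inv (inv g \<otimes> n \<otimes> g) \<otimes> inv g) * f (inv g \<otimes> n \<otimes> g))"
      by (rule sum_N_conj[OF g, symmetric])
    also have "\<dots> = (\<Sum>n\<in>N. \<theta> (inv n) * f (inv g \<otimes> n \<otimes> g))"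
    proof (rule sum.cong[OF refl])
      fix n assume "n \<in> N"
      then have n: "n \<in> carrier G" using NG by auto
      have "inv (inv g \<otimes> n \<otimes> g) = inv g \<otimes> inv n \<otimes> g"
        using n g by (simp add: inv_mult_group m_assoc)
      then have "g \<otimes> inv (inv g \<otimes> n \<otimes> g) \<otimes> inv g = inv n" using conj_inv_cancel(2)[OF g, of "inv n"] n by simp
      then show "\<theta> (g \<otimes> inv (inv g \<otimes> n \<otimes> g) \<otimes> inv g) * f (inv g \<otimes> n \<otimes> g) = \<theta> (inv n) * f (inv g \<otimes> n \<otimes> g)"
        by simp
    qed
    finally show ?thesis .
  qed
  have \<chi>conj: "\<chi> (inv g \<otimes> n \<otimes> g \<otimes> k) = \<chi> (n \<otimes> (g \<otimes> k \<otimes> inv g))"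
    if "g \<in> carrier G" "n \<in> carrier G" "k \<in> carrier G" for g n k
    using Irr_mult_comm[OF \<chi>, of "inv g" "n \<otimes> g \<otimes> k"] that by (simp add: m_assoc)
  have FE: "(\<Sum>n\<in>N. F n * \<chi> n) = of_nat (card (carrier G)) * E"
  proof -
    have "(\<Sum>n\<in>N. F n * \<chi> n) = (\<Sum>g\<in>carrier G. \<Sum>n\<in>N. \<theta> (g \<otimes> inv n \<otimes> inv g) * \<chi> n)"
      unfolding F_def sum_distrib_right by (rule sum.swap)
    also have "\<dots> = (\<Sum>g\<in>carrier G. \<Sum>n\<in>N. \<theta> (inv n) * \<chi> n)"
    proof (rule sum.cong[OF refl])
      fix g assume g: "g \<in> carrier G"
      have "\<chi> (inv g \<otimes> n \<otimes> g) = \<chi> n" if "n \<in> N" for n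
        using Irr_conj[OF \<chi>, of n "inv g"] g that NG by auto
      then show "(\<Sum>n\<in>N. \<theta> (g \<otimes> inv n \<otimes> inv g) * \<chi> n) = (\<Sum>n\<in>N. \<theta> (inv n) * \<chi> n)"
        using swap[OF g, of \<chi>] by simp
    qed
    finally show ?thesis by (simp add: E_def mult.commute)
  qed
  have F_conj: "F (g \<otimes> n \<otimes> inv g) = F n" if g: "g \<in> carrier G" and n: "n \<in> N" for g n
  proof -
    have nG: "n \<in> carrier G" using n NG by auto
    have "inv (g \<otimes> n \<otimes> inv g) = g \<otimes> inv n \<otimes> inv g" using g nG by (simp add: inv_mult_group m_assoc)
    then have "F (g \<otimes> n \<otimes> inv g) = (\<Sum>h\<in>carrier G. \<theta> ((h \<otimes> g) \<otimes> inv n \<otimes> inv (h \<otimes> g)))"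
      unfolding F_def using g nG by (intro sum.cong refl) (simp add: conj_mult)
    also have "\<dots> = F n" unfolding F_def by (rule sum_right_translate[OF g])
    finally show ?thesis .
  qed
  \<comment> \<open>Projection of the restriction of \<chi> to its \<theta>-component;
    \<open>E\<close> is |N| times the multiplicity.\<close>
  have conv: "\<theta> \<one> * (\<Sum>n\<in>N. \<theta> (inv n) * \<chi> (n \<otimes> y)) = E * \<theta> y" if y: "y \<in> N" for y
  proof (rule restrict_Irr_multiplicities[OF fin subgroup_axioms \<chi>])
    fix c :: "('a \<Rightarrow> complex) \<Rightarrow> nat"
    assume c1: "\<And>k. k \<in> N \<Longrightarrow> \<chi> k = (\<Sum>\<psi>\<in>Irr GN. of_nat (c \<psi>) * \<psi> k)"
      and c2: "\<And>\<psi>. \<psi> \<in> Irr GN \<Longrightarrow> (\<Sum>k\<in>N. \<chi> k * \<psi> (inv k)) = of_nat (card N) * of_nat (c \<psi>)"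
    have "\<theta> \<one>\<^bsub>GN\<^esub> * (\<Sum>n\<in>carrier GN. \<theta> (inv\<^bsub>GN\<^esub> n) * \<chi> (n \<otimes>\<^bsub>GN\<^esub> y)) = of_nat (card (carrier GN)) * of_nat (c \<theta>) * \<theta> y"
      by (rule group.Irr_convolution[OF group_GN]) (use fin_N \<theta> y c1 in auto)
    then show ?thesis
      using c2[OF \<theta>] by (simp add: E_def inv_N cong: sum.cong)
  qed
  have "\<chi> \<one> * (\<Sum>k\<in>M. \<Sum>n\<in>N. F n * \<chi> (n \<otimes> k)) = (\<Sum>k\<in>M. (\<Sum>n\<in>N. F n * \<chi> n) * \<chi> k)"
    unfolding sum_distrib_left[where r = "\<chi> \<one>"]
  proof (intro sum.cong refl)
    fix k assume "k \<in> M"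
    then show "(\<Sum>n\<in>N. \<chi> \<one> * (F n * \<chi> (n \<otimes> k))) = (\<Sum>n\<in>N. F n * \<chi> n) * \<chi> k"
      unfolding sum_distrib_left[symmetric] using NG inv_op_closed2 F_conj
      by (intro Irr_central_sum[OF \<chi>]) auto
  qed
  also have "\<dots> = of_nat (card (carrier G)) * E * (\<Sum>k\<in>M. \<chi> k)"
    by (simp add: FE sum_distrib_left)
  finally have "\<chi> \<one> * (\<theta> \<one> * (\<Sum>k\<in>M. \<Sum>n\<in>N. F n * \<chi> (n \<otimes> k))) = \<theta> \<one> * (of_nat (card (carrier G)) * E * (\<Sum>k\<in>M. \<chi> k))"
    by (simp add: mult.left_commute)
  \<comment> \<open>The same double sum, now evaluated inside \<open>N\<close>: conjugation by
    \<open>g\<close> is shifted from \<theta> to \<open>k\<close>, \<open>conv\<close> projects, and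
    by \<open>sum_M_conj\<close> every \<open>g\<close> contributes equally. Comparison of the two
    values cancels the nonzero factor |G| E.\<close>
  moreover have "\<theta> \<one> * (\<Sum>k\<in>M. \<Sum>n\<in>N. F n * \<chi> (n \<otimes> k)) = of_nat (card (carrier G)) * E * (\<Sum>k\<in>M. \<theta> k)"
  proof -
    have "(\<Sum>k\<in>M. \<Sum>n\<in>N. F n * \<chi> (n \<otimes> k)) = (\<Sum>k\<in>M. \<Sum>g\<in>carrier G. \<Sum>n\<in>N. \<theta> (g \<otimes> inv n \<otimes> inv g) * \<chi> (n \<otimes> k))"
      unfolding F_def sum_distrib_right by (intro sum.cong refl sum.swap)
    also have "\<dots> = (\<Sum>k\<in>M. \<Sum>g\<in>carrier G. \<Sum>n\<in>N. \<theta> (inv n) * \<chi> (n \<otimes> (g \<otimes> k \<otimes> inv g)))"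
    proof (rule sum.cong[OF refl], rule sum.cong[OF refl])
      fix k g assume k: "k \<in> M" and g: "g \<in> carrier G"
      have "\<chi> (inv g \<otimes> n \<otimes> g \<otimes> k) = \<chi> (n \<otimes> (g \<otimes> k \<otimes> inv g))" if "n \<in> N" for n
        using \<chi>conj[OF g] that k NG by auto
      then show "(\<Sum>n\<in>N. \<theta> (g \<otimes> inv n \<otimes> inv g) * \<chi> (n \<otimes> k)) = (\<Sum>n\<in>N. \<theta> (inv n) * \<chi> (n \<otimes> (g \<otimes> k \<otimes> inv g)))"
        using swap[OF g, of "\<lambda>n. \<chi> (n \<otimes> k)"] by simp
    qed
    finally have "\<theta> \<one> * (\<Sum>k\<in>M. \<Sum>n\<in>N. F n * \<chi> (n \<otimes> k))
      = (\<Sum>k\<in>M. \<Sum>g\<in>carrier G. \<theta> \<one> * (\<Sum>n\<in>N. \<theta> (inv n) * \<chi> (n \<otimes> (g \<otimes> k \<otimes> inv g))))"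
      by (simp only: sum_distrib_left[where r = "\<theta> \<one>"])
    also have "\<dots> = (\<Sum>k\<in>M. \<Sum>g\<in>carrier G. E * \<theta> (g \<otimes> k \<otimes> inv g))"
      using inv_op_closed2 by (intro sum.cong refl conv) auto
    also have "\<dots> = (\<Sum>g\<in>carrier G. E * (\<Sum>k\<in>M. \<theta> (g \<otimes> k \<otimes> inv g)))"
      by (subst sum.swap) (simp add: sum_distrib_left)
    also have "\<dots> = of_nat (card (carrier G)) * E * (\<Sum>k\<in>M. \<theta> k)"
      by (simp add: sum_M_conj[OF \<theta>] cong: sum.cong)
    finally show ?thesis .
  qed
  ultimately show ?thesis
    using ne card_carrier_pos[OF fin] by (simp add: E_def mult_ac)
qed

text \<open>In 1 + p the 1 comes from \<open>B\<close>, the characters inflated from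
  \<open>G/N\<close>, and \<open>p\<close> from \<open>Y\<close>, the characters lying over
  \<theta>. A \<chi> in \<open>Y\<close> has degree at least \<open>p\<close> times its
  \<open>M\<close>-fixed dimension, and this dimension is at least the total degree of the inflated
  constituents of \<chi> on \<open>H\<close>. Every \<beta> in \<open>B\<close> occurs in this way
  for some \<chi> in \<open>Y\<close>.\<close>

theorem degree_sum_lower_bound:
  assumes ne: "\<not> N \<subseteq> H"
    and small: "\<And>c. c \<in> N \<Longrightarrow> c \<notin> H \<Longrightarrow> p * card {k \<in> M. c \<otimes> k \<otimes> inv c \<in> M} \<le> card M"
  shows "degree_sum G \<ge> (1 + real p) * degree_sum (G Mod N)"
proof -
  interpret Q: group "G Mod N" by (rule factorgroup_is_group)
  have finQ: "finite (carrier (G Mod N))"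
    using fin by (simp add: FactGroup_def RCOSETS_def)
  obtain \<theta> m d where \<theta>: "\<theta> \<in> Irr GN" "\<theta> \<noteq> restrict (\<lambda>_. 1) N" "m > 0"
    "(\<Sum>k\<in>M. \<theta> k) = of_nat (card M) * of_nat m" "\<theta> \<one> = of_nat d" "p * m \<le> d"
  proof (rule group.exists_Irr_small_fixed_space[OF group_GN])
    show "finite (carrier GN)" using fin_N by simp
    show "subgroup M GN" by (rule subgroup_M_GN)
    show "M \<noteq> carrier GN" using ne by auto
    show "p * card {k \<in> M. c \<otimes>\<^bsub>GN\<^esub> k \<otimes>\<^bsub>GN\<^esub> inv\<^bsub>GN\<^esub> c \<in> M} \<le> card M" if "c \<in> carrier GN" "c \<notin> M" for c
      using small[of c] that by (simp add: inv_N)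
  qed (use that in auto)
  have cM: "card M > 0"
    using subgroup.one_closed[OF subgroup_M] fin_N card_gt_0_iff by blast
  define infl where "infl \<beta> = restrict (\<beta> \<circ> (\<lambda>g. N #> g)) (carrier G)" for \<beta> :: "'a set \<Rightarrow> complex"
  define B where "B = infl ` Irr (G Mod N)"
  have hom: "group_hom G (G Mod N) (\<lambda>g. N #> g)"
    using r_coset_hom_Mod by (simp add: group_hom_def group_hom_axioms_def Q.is_group is_group)
  have surj: "(\<lambda>g. N #> g) ` carrier G = carrier (G Mod N)"
    by (auto simp: FactGroup_def RCOSETS_def)
  have coset_nh: "N #> (n \<otimes> h) = N #> h" if "n \<in> N" "h \<in> carrier G" for n h
  proof -
    have n: "n \<in> carrier G" using that NG by auto
    have "N #> n = N" using that(1) by (rule rcos_const[OF is_group])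
    then show ?thesis using coset_mult_assoc[OF NG n that(2)] by simp
  qed
  have BI: "B \<subseteq> Irr G" unfolding B_def infl_def using Irr_comp[OF hom surj] by auto
  have inj: "inj_on infl (Irr (G Mod N))" unfolding infl_def by (rule inj_on_Irr_comp[OF hom surj])
  have one_infl: "infl \<beta> \<one> = \<beta> \<one>\<^bsub>G Mod N\<^esub>" for \<beta>
    using group_hom.hom_one[OF hom] by (simp add: infl_def)
  have deg_Q: "degree_sum (G Mod N) = (\<Sum>\<beta>\<in>B. Re (\<beta> \<one>))"
    unfolding degree_sum_def B_def by (simp add: sum.reindex[OF inj] one_infl)
  have B_nh: "\<beta> (n \<otimes> h) = \<beta> h" if "\<beta> \<in> B" "n \<in> N" "h \<in> carrier G" for \<beta> n h
  proof -
    have "n \<otimes> h \<in> carrier G" using that NG by auto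
    then show ?thesis using that by (auto simp: B_def infl_def coset_nh)
  qed
  have B_N: "\<beta> n = \<beta> \<one>" if "\<beta> \<in> B" "n \<in> N" for \<beta> n
    using B_nh[OF that one_closed] that(2) NG by auto
  have finB: "finite B" using BI finite_Irr[OF fin] finite_subset by blast
  have homH: "group_hom GH (G Mod N) (\<lambda>g. N #> g)"
    using hom_restrict_carrier[OF r_coset_hom_Mod HG] group_GH Q.is_group
    by (simp add: group_hom_def group_hom_axioms_def)
  have surjH: "(\<lambda>g. N #> g) ` carrier GH = carrier (G Mod N)"
  proof -
    have "N #> g \<in> (\<lambda>g. N #> g) ` H" if g: "g \<in> carrier G" for g
      using supplement[OF g] coset_nh HG by force
    then show ?thesis unfolding surj[symmetric] using HG by auto
  qed
  \<comment> \<open>Because \<open>H\<close> maps onto \<open>G/N\<close>, an inflated irreducible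
    character stays irreducible on \<open>H\<close>, and distinct ones stay distinct.\<close>
  define res where "res \<beta> = restrict \<beta> H" for \<beta> :: "'a \<Rightarrow> complex"
  have res_infl: "res (infl \<beta>) = restrict (\<beta> \<circ> (\<lambda>g. N #> g)) (carrier GH)" for \<beta>
    using HG by (auto simp: res_def infl_def fun_eq_iff)
  have resI: "res \<beta> \<in> Irr GH" if "\<beta> \<in> B" for \<beta>
    using that Irr_comp[OF homH surjH] by (auto simp: B_def res_infl)
  have res_M: "res \<beta> k = \<beta> \<one>" if "\<beta> \<in> B" "k \<in> M" for \<beta> k
    using B_N[OF that(1), of k] that(2) by (simp add: res_def)
  have inj_res: "inj_on res B"
    unfolding B_def
  proof (rule inj_on_imageI)
    show "inj_on (res \<circ> infl) (Irr (G Mod N))"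
      using inj_on_Irr_comp[OF homH surjH] by (simp add: o_def[of res] res_infl)
  qed
  \<comment> \<open>The counting runs in natural numbers: \<open>e\<close> is the degree,
    \<open>fx\<close> and \<open>fh\<close> are the \<open>M\<close>-fixed dimensions for characters
    of \<open>G\<close> and of \<open>H\<close>, and \<open>a \<chi> \<psi>\<close> is the
    multiplicity of \<psi> in the restriction of \<chi> to \<open>H\<close>.\<close>
  obtain e :: "('a \<Rightarrow> complex) \<Rightarrow> nat" where e: "\<And>\<chi>. \<chi> \<in> Irr G \<Longrightarrow> \<chi> \<one> = of_nat (e \<chi>)"
    using Irr_degree[OF is_group] by metis
  have "\<exists>d. (\<Sum>k\<in>M. \<chi> k) = of_nat (card M) * of_nat d" if "\<chi> \<in> Irr G" for \<chi>
    by (rule sum_Irr_subgroup[OF fin subgroup_M that]) blast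
  then obtain fx :: "('a \<Rightarrow> complex) \<Rightarrow> nat"
    where fx: "\<And>\<chi>. \<chi> \<in> Irr G \<Longrightarrow> (\<Sum>k\<in>M. \<chi> k) = of_nat (card M) * of_nat (fx \<chi>)" by metis
  define P where "P \<chi> c \<longleftrightarrow> (\<forall>k\<in>H. \<chi> k = (\<Sum>\<psi>\<in>Irr GH. of_nat (c \<psi>) * \<psi> k)) \<and>
      (\<forall>\<psi>\<in>Irr GH. (\<Sum>h\<in>H. \<chi> h * \<psi> (inv h)) = of_nat (card H) * of_nat (c \<psi>))"
    for \<chi> :: "'a \<Rightarrow> complex" and c :: "('a \<Rightarrow> complex) \<Rightarrow> nat"
  have "\<exists>c. P \<chi> c" if "\<chi> \<in> Irr G" for \<chi>
  proof (rule restrict_Irr_multiplicities[OF fin H that])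
    fix c :: "('a \<Rightarrow> complex) \<Rightarrow> nat"
    assume "\<And>k. k \<in> H \<Longrightarrow> \<chi> k = (\<Sum>\<psi>\<in>Irr GH. of_nat (c \<psi>) * \<psi> k)"
      and "\<And>\<psi>. \<psi> \<in> Irr GH \<Longrightarrow> (\<Sum>k\<in>H. \<chi> k * \<psi> (inv k)) = of_nat (card H) * of_nat (c \<psi>)"
    then have "P \<chi> c" unfolding P_def by blast
    then show ?thesis by blast
  qed
  then obtain a where a: "\<And>\<chi>. \<chi> \<in> Irr G \<Longrightarrow> P \<chi> (a \<chi>)" by metis
  have a1: "\<chi> k = (\<Sum>\<psi>\<in>Irr GH. of_nat (a \<chi> \<psi>) * \<psi> k)" if "\<chi> \<in> Irr G" "k \<in> H" for \<chi> k
    using a[OF that(1)] that(2) unfolding P_def by blast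
  have a2: "(\<Sum>h\<in>H. \<chi> h * \<psi> (inv h)) = of_nat (card H) * of_nat (a \<chi> \<psi>)"
    if "\<chi> \<in> Irr G" "\<psi> \<in> Irr GH" for \<chi> \<psi>
    using a[OF that(1)] that(2) unfolding P_def by blast
  have finGH: "finite (carrier GH)" using fin_H by simp
  have "\<exists>d. (\<Sum>k\<in>M. \<psi> k) = of_nat (card M) * of_nat d" if "\<psi> \<in> Irr GH" for \<psi>
    by (rule group.sum_Irr_subgroup[OF group_GH finGH subgroup_M_GH that]) blast
  then have "\<exists>f. \<forall>\<psi>\<in>Irr GH. (\<Sum>k\<in>M. \<psi> k) = of_nat (card M) * of_nat (f \<psi>)"
    by (intro bchoice ballI)
  then obtain fh :: "('a \<Rightarrow> complex) \<Rightarrow> nat"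
    where fh: "\<And>\<psi>. \<psi> \<in> Irr GH \<Longrightarrow> (\<Sum>k\<in>M. \<psi> k) = of_nat (card M) * of_nat (fh \<psi>)" by blast
  have fh_res: "fh (res \<beta>) = e \<beta>" if \<beta>: "\<beta> \<in> B" for \<beta>
  proof -
    have "of_nat (card M) * of_nat (fh (res \<beta>)) = (\<Sum>k\<in>M. res \<beta> k)"
      by (rule fh[OF resI[OF \<beta>], symmetric])
    also have "\<dots> = (\<Sum>k\<in>M. \<beta> \<one>)"
      by (rule sum.cong[OF refl], rule res_M[OF \<beta>])
    also have "\<dots> = of_nat (card M) * of_nat (e \<beta>)" using e[of \<beta>] BI \<beta> by auto
    finally show ?thesis using cM by simp
  qed
  \<comment> \<open>The fixed dimension is computed through the restriction to \<open>H\<close>. A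
    copy of \<open>res \<beta>\<close> is trivial on \<open>M\<close> and counts with its full
    degree; the remaining constituents only add to the sum.\<close>
  have fx_ge: "(\<Sum>\<beta>\<in>B. a \<chi> (res \<beta>) * e \<beta>) \<le> fx \<chi>" if \<chi>: "\<chi> \<in> Irr G" for \<chi>
  proof -
    have "of_nat (card M) * of_nat (fx \<chi>) = (\<Sum>k\<in>M. \<chi> k)" by (rule fx[OF \<chi>, symmetric])
    also have "\<dots> = (\<Sum>k\<in>M. \<Sum>\<psi>\<in>Irr GH. of_nat (a \<chi> \<psi>) * \<psi> k)"
      by (rule sum.cong[OF refl], rule a1[OF \<chi>]) simp
    also have "\<dots> = (\<Sum>\<psi>\<in>Irr GH. of_nat (a \<chi> \<psi>) * (\<Sum>k\<in>M. \<psi> k))"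
      by (subst sum.swap) (simp add: sum_distrib_left)
    also have "\<dots> = of_nat (card M) * of_nat (\<Sum>\<psi>\<in>Irr GH. a \<chi> \<psi> * fh \<psi>)"
      by (simp add: fh sum_distrib_left mult_ac cong: sum.cong)
    finally have "fx \<chi> = (\<Sum>\<psi>\<in>Irr GH. a \<chi> \<psi> * fh \<psi>)" using cM
      by (simp only: mult_cancel_left of_nat_eq_iff of_nat_eq_0_iff) auto
    also have "\<dots> \<ge> (\<Sum>\<psi>\<in>res ` B. a \<chi> \<psi> * fh \<psi>)"
      using group.finite_Irr[OF group_GH finGH] resI by (intro sum_mono2) auto
    finally show ?thesis by (simp add: sum.reindex[OF inj_res] fh_res cong: sum.cong)
  qed
  define Y where "Y = {\<chi> \<in> Irr G. (\<Sum>n\<in>N. \<chi> n * \<theta> (inv n)) \<noteq> 0}"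
  have YI: "Y \<subseteq> Irr G" and finY: "finite Y" using finite_Irr[OF fin] by (auto simp: Y_def)
  have ex: "\<exists>\<chi>\<in>Y. a \<chi> (res \<beta>) > 0" if \<beta>: "\<beta> \<in> B" for \<beta>
  proof -
    have e0: "e \<beta> > 0" using Irr_degree[OF is_group, of \<beta>] BI \<beta> e by fastforce
    have "(\<Sum>\<chi>\<in>Irr G. (\<Sum>h\<in>H. \<chi> h * res \<beta> (inv h)) * (\<Sum>n\<in>N. \<chi> n * \<theta> (inv n)))
      = of_nat (card (carrier G)) * \<beta> \<one> * (\<Sum>k\<in>M. \<theta> k)"
      by (rule sum_Irr_multiplicities[OF _ \<theta>(1)], rule res_M[OF \<beta>])
    also have "\<dots> \<noteq> 0"
      using card_carrier_pos[OF fin] e0 e[of \<beta>] BI \<beta> cM \<theta>(3,4) by auto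
    finally obtain \<chi> where \<chi>: "\<chi> \<in> Irr G" "(\<Sum>h\<in>H. \<chi> h * res \<beta> (inv h)) * (\<Sum>n\<in>N. \<chi> n * \<theta> (inv n)) \<noteq> 0"
      using sum.not_neutral_contains_not_neutral by blast
    then have "\<chi> \<in> Y" "a \<chi> (res \<beta>) > 0" using a2[OF \<chi>(1) resI[OF \<beta>]] by (auto simp: Y_def)
    then show ?thesis by blast
  qed
  have "(\<Sum>\<beta>\<in>B. e \<beta>) \<le> (\<Sum>\<beta>\<in>B. (\<Sum>\<chi>\<in>Y. a \<chi> (res \<beta>)) * e \<beta>)"
  proof (rule sum_mono)
    fix \<beta> assume "\<beta> \<in> B"
    then obtain \<chi> where "\<chi> \<in> Y" "a \<chi> (res \<beta>) > 0" using ex by blast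
    then have "(\<Sum>\<chi>\<in>Y. a \<chi> (res \<beta>)) \<ge> 1"
      using member_le_sum[of \<chi> Y "\<lambda>\<chi>. a \<chi> (res \<beta>)"] finY by fastforce
    then show "e \<beta> \<le> (\<Sum>\<chi>\<in>Y. a \<chi> (res \<beta>)) * e \<beta>" by simp
  qed
  also have "\<dots> = (\<Sum>\<chi>\<in>Y. \<Sum>\<beta>\<in>B. a \<chi> (res \<beta>) * e \<beta>)"
    unfolding sum_distrib_right by (rule sum.swap)
  also have "\<dots> \<le> (\<Sum>\<chi>\<in>Y. fx \<chi>)" using YI by (intro sum_mono fx_ge) auto
  finally have C: "(\<Sum>\<beta>\<in>B. e \<beta>) \<le> (\<Sum>\<chi>\<in>Y. fx \<chi>)" .
  \<comment> \<open>\<open>degree_ratio\<close> amounts to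
    \<open>e \<chi> * m = d * fx \<chi>\<close>, and \<theta> was chosen with
    \<open>p * m \<le> d\<close>.\<close>
  have ratio: "p * fx \<chi> \<le> e \<chi>" if \<chi>: "\<chi> \<in> Y" for \<chi>
  proof -
    have \<chi>I: "\<chi> \<in> Irr G" and ne: "(\<Sum>n\<in>N. \<chi> n * \<theta> (inv n)) \<noteq> 0" using \<chi> by (auto simp: Y_def)
    have "(of_nat (e \<chi> * m * card M) :: complex) = of_nat (d * fx \<chi> * card M)"
      using degree_ratio[OF \<chi>I \<theta>(1) ne] \<theta>(4,5) e[OF \<chi>I] fx[OF \<chi>I] by (simp add: mult_ac)
    then have "e \<chi> * m = d * fx \<chi>" using cM by (simp only: of_nat_eq_iff) simp
    moreover have "p * m * fx \<chi> \<le> d * fx \<chi>" using \<theta>(6) by (rule mult_le_mono1)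
    ultimately have "m * (p * fx \<chi>) \<le> m * e \<chi>" by (simp add: mult_ac)
    then show ?thesis using \<theta>(3) by simp
  qed
  \<comment> \<open>On \<open>N\<close> an inflated character is a multiple of the trivial one,
    which is orthogonal to the nontrivial \<theta>.\<close>
  have disj: "B \<inter> Y = {}"
  proof -
    have False if \<beta>: "\<beta> \<in> B" "\<beta> \<in> Y" for \<beta>
    proof -
      have "(\<Sum>n\<in>N. \<beta> n * \<theta> (inv n)) = \<beta> \<one> * (\<Sum>n\<in>N. \<theta> (inv n))"
        unfolding sum_distrib_left by (rule sum.cong[OF refl]) (use B_N[OF \<beta>(1)] in metis)
      also have "(\<Sum>n\<in>N. \<theta> (inv n)) = (\<Sum>n\<in>carrier GN. restrict (\<lambda>_. 1) N n * \<theta> (inv\<^bsub>GN\<^esub> n))"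
        by (intro sum.cong) (auto simp: inv_N)
      also have "\<dots> = 0"
        using group.Irr_orthogonality[OF group_GN _ group.trivial_Irr[OF group_GN] \<theta>(1)] fin_N \<theta>(2) by simp
      finally show False using \<beta>(2) by (simp add: Y_def)
    qed
    then show ?thesis by blast
  qed
  have "(\<Sum>\<beta>\<in>B. e \<beta>) + p * (\<Sum>\<beta>\<in>B. e \<beta>) \<le> (\<Sum>\<beta>\<in>B. e \<beta>) + p * (\<Sum>\<chi>\<in>Y. fx \<chi>)"
    using C by simp
  also have "\<dots> \<le> (\<Sum>\<beta>\<in>B. e \<beta>) + (\<Sum>\<chi>\<in>Y. e \<chi>)"
    using ratio by (simp add: sum_distrib_left sum_mono)
  also have "\<dots> = (\<Sum>\<chi>\<in>B \<union> Y. e \<chi>)" using sum.union_disjoint[OF finB finY disj, of e] by simp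
  also have "\<dots> \<le> (\<Sum>\<chi>\<in>Irr G. e \<chi>)" using finite_Irr[OF fin] BI YI by (intro sum_mono2) auto
  finally have "(1 + real p) * real (\<Sum>\<beta>\<in>B. e \<beta>) \<le> real (\<Sum>\<chi>\<in>Irr G. e \<chi>)"
    by (metis (no_types, lifting) of_nat_1 of_nat_add of_nat_mono of_nat_mult add_mult_distrib mult_1)
  moreover have "degree_sum G = real (\<Sum>\<chi>\<in>Irr G. e \<chi>)"
    unfolding degree_sum_def by (simp add: e)
  moreover have "degree_sum (G Mod N) = real (\<Sum>\<beta>\<in>B. e \<beta>)"
    unfolding deg_Q using BI by (simp add: e subset_iff)
  ultimately show ?thesis by simp
qed

end

section \<open>Sylow subgroups and the Frattini argument\<close>

lemma group_action_restrict:
  assumes "group P"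
    and closed: "\<And>g x. g \<in> carrier P \<Longrightarrow> x \<in> E \<Longrightarrow> act g x \<in> E"
    and one: "\<And>x. x \<in> E \<Longrightarrow> act \<one>\<^bsub>P\<^esub> x = x"
    and mult: "\<And>g h x. g \<in> carrier P \<Longrightarrow> h \<in> carrier P \<Longrightarrow> x \<in> E \<Longrightarrow> act (g \<otimes>\<^bsub>P\<^esub> h) x = act g (act h x)"
  shows "group_action P E (\<lambda>g. restrict (act g) E)"
proof -
  interpret P: group P by fact
  have bij: "restrict (act g) E \<in> Bij E" if g: "g \<in> carrier P" for g
  proof -
    have inv: "act (inv\<^bsub>P\<^esub> g) (act g x) = x" "act g (act (inv\<^bsub>P\<^esub> g) x) = x" if "x \<in> E" for x
      using mult[of "inv\<^bsub>P\<^esub> g" g x] mult[of g "inv\<^bsub>P\<^esub> g" x] one that g by auto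
    have "bij_betw (act g) E E"
      by (rule bij_betwI[where g = "act (inv\<^bsub>P\<^esub> g)"]) (use g closed inv in auto)
    then show ?thesis by (auto simp: Bij_def bij_betw_def inj_on_def)
  qed
  have "(\<lambda>g. restrict (act g) E) \<in> hom P (BijGroup E)"
  proof (rule homI)
    show "restrict (act g) E \<in> carrier (BijGroup E)" if "g \<in> carrier P" for g
      using bij[OF that] by (simp add: BijGroup_def)
    show "restrict (act (g \<otimes>\<^bsub>P\<^esub> h)) E = restrict (act g) E \<otimes>\<^bsub>BijGroup E\<^esub> restrict (act h) E"
      if "g \<in> carrier P" "h \<in> carrier P" for g h
      using that bij closed mult by (auto simp: BijGroup_def compose_def fun_eq_iff)
  qed
  then show ?thesis
    using group_BijGroup P.is_group by (simp add: group_action_def group_hom_def group_hom_axioms_def)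
qed

text \<open>Orbit lengths are powers of \<open>p\<close>. They cannot all be divisible by
  \<open>p\<close>, as their sum \<open>card E\<close> is not, so some orbit is a single point.
  Sylow conjugacy, the centralized involution and the centres of \<open>p\<close>-groups all come
  from this count.\<close>

lemma p_group_fixed_point:
  assumes P: "group P" and p: "prime p" and card: "card (carrier P) = p ^ a"
    and finE: "finite E" and ndvd: "\<not> p dvd card E"
    and closed: "\<And>g x. g \<in> carrier P \<Longrightarrow> x \<in> E \<Longrightarrow> act g x \<in> E"
    and one: "\<And>x. x \<in> E \<Longrightarrow> act \<one>\<^bsub>P\<^esub> x = x"
    and mult: "\<And>g h x. g \<in> carrier P \<Longrightarrow> h \<in> carrier P \<Longrightarrow> x \<in> E \<Longrightarrow> act (g \<otimes>\<^bsub>P\<^esub> h) x = act g (act h x)"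
  obtains x where "x \<in> E" "\<And>g. g \<in> carrier P \<Longrightarrow> act g x = x"
proof -
  define \<phi> where "\<phi> = (\<lambda>g. restrict (act g) E)"
  interpret group_action P E \<phi>
    unfolding \<phi>_def by (rule group_action_restrict[OF P closed one mult])
  have "card E = (\<Sum>orb\<in>orbits P E \<phi>. card orb)"
    using disjoint_sum[OF finE, of "\<lambda>_. 1::nat"] by simp
  then obtain orb where orb: "orb \<in> orbits P E \<phi>" "\<not> p dvd card orb"
    using ndvd dvd_sum[of "orbits P E \<phi>" p card] by auto
  then obtain x where x: "x \<in> E" "orb = orbit P \<phi> x" by (auto simp: orbits_def)
  have "card (orbit P \<phi> x) dvd p ^ a"
    using orbit_stabilizer_theorem[OF x(1)] card by (metis dvd_triv_left Coset.order_def)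
  then obtain i where "i \<le> a" "card (orbit P \<phi> x) = p ^ i"
    using divides_primepow_nat[OF p] by blast
  then have "card (orbit P \<phi> x) = 1" using orb(2) x(2) by (cases i) auto
  then obtain y where y: "orbit P \<phi> x = {y}" by (auto simp: card_1_singleton_iff)
  have "act g x = x" if g: "g \<in> carrier P" for g
  proof -
    have "act g x \<in> orbit P \<phi> x" using g x(1) by (auto simp: orbit_def \<phi>_def)
    moreover have "x \<in> orbit P \<phi> x" by (rule orbit_refl[OF x(1)])
    ultimately show ?thesis using y by auto
  qed
  then show thesis using that x(1) by blast
qed

lemma multiplicity_split:
  fixes n p :: nat
  assumes "prime p" "n > 0"
  obtains a m where "n = p ^ a * m" "\<not> p dvd m"
  using multiplicity_decompose'[of n p] assms by (metis not_prime_unit neq0_conv)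

section \<open>Conjugacy of Sylow subgroups and normalizers\<close>

context group
begin

lemma conj_distrib:
  assumes "g \<in> carrier G" "x \<in> carrier G" "y \<in> carrier G"
  shows "g \<otimes> (x \<otimes> y) \<otimes> inv g = (g \<otimes> x \<otimes> inv g) \<otimes> (g \<otimes> y \<otimes> inv g)"
  using assms by (simp add: m_assoc) (simp add: m_assoc[symmetric])

lemma conj_inv:
  assumes "g \<in> carrier G" "x \<in> carrier G"
  shows "inv (g \<otimes> x \<otimes> inv g) = g \<otimes> inv x \<otimes> inv g"
  using assms by (simp add: inv_mult_group m_assoc)

lemma inj_on_conj: "g \<in> carrier G \<Longrightarrow> S \<subseteq> carrier G \<Longrightarrow> inj_on (\<lambda>k. g \<otimes> k \<otimes> inv g) S"
  by (rule inj_on_inverseI[where g = "\<lambda>k. inv g \<otimes> k \<otimes> g"]) (auto simp: conj_inv_cancel subset_iff)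

lemma subgroup_conj:
  assumes P: "subgroup P G" and g: "g \<in> carrier G"
  shows "subgroup ((\<lambda>k. g \<otimes> k \<otimes> inv g) ` P) G"
proof -
  have PG: "\<And>k. k \<in> P \<Longrightarrow> k \<in> carrier G" using subgroup.subset[OF P] by auto
  show ?thesis
  proof (rule subgroupI)
    show "(\<lambda>k. g \<otimes> k \<otimes> inv g) ` P \<subseteq> carrier G" using PG g by auto
    show "(\<lambda>k. g \<otimes> k \<otimes> inv g) ` P \<noteq> {}" using subgroup.one_closed[OF P] by auto
    fix x y assume "x \<in> (\<lambda>k. g \<otimes> k \<otimes> inv g) ` P" "y \<in> (\<lambda>k. g \<otimes> k \<otimes> inv g) ` P"
    then obtain k l where "k \<in> P" "l \<in> P" "x = g \<otimes> k \<otimes> inv g" "y = g \<otimes> l \<otimes> inv g" by blast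
    then show "x \<otimes> y \<in> (\<lambda>k. g \<otimes> k \<otimes> inv g) ` P"
      using conj_distrib[OF g, of k l] PG subgroup.m_closed[OF P, of k l]
      by (metis (no_types, lifting) image_eqI)
  next
    fix x assume "x \<in> (\<lambda>k. g \<otimes> k \<otimes> inv g) ` P"
    then show "inv x \<in> (\<lambda>k. g \<otimes> k \<otimes> inv g) ` P"
      using conj_inv[OF g] PG subgroup.m_inv_closed[OF P] by auto
  qed
qed

text \<open>\<open>Q\<close> acts by right multiplication on the right cosets of \<open>P\<close>,
  whose number \<open>m\<close> is prime to \<open>p\<close>. A fixed coset \<open>P #> x\<close>
  says precisely that \<open>x\<close> conjugates \<open>Q\<close> into \<open>P\<close>.\<close>

lemma sylow_conjugate:
  assumes fin: "finite (carrier G)" and p: "prime p"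
    and P: "subgroup P G" "card P = p ^ a" "card (carrier G) = p ^ a * m" "\<not> p dvd m"
    and Q: "subgroup Q G" "card Q = p ^ b"
  obtains x where "x \<in> carrier G" "\<And>q. q \<in> Q \<Longrightarrow> x \<otimes> q \<otimes> inv x \<in> P"
proof -
  have PG: "P \<subseteq> carrier G" and QG: "Q \<subseteq> carrier G" using subgroup.subset P(1) Q(1) by auto
  have "card (rcosets P) * p ^ a = p ^ a * m"
    using lagrange[OF P(1)] P(2,3) by (simp add: Coset.order_def)
  then have idx: "card (rcosets P) = m" using prime_gt_0_nat[OF p] by simp
  have RC: "C \<subseteq> carrier G" if "C \<in> rcosets P" for C
    using rcosets_part_G[OF P(1)] that by blast
  \<comment> \<open>The inverse in \<open>act\<close> turns right multiplication into a left
    action.\<close>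
  obtain C where C: "C \<in> rcosets P" "\<And>q. q \<in> carrier (G\<lparr>carrier := Q\<rparr>) \<Longrightarrow> C #> inv q = C"
  proof (rule p_group_fixed_point[OF subgroup_imp_group[OF Q(1)] p, where E = "rcosets P" and act = "\<lambda>q C. C #> inv q" and a = b])
    show "finite (rcosets P)" using fin by (simp add: RCOSETS_def)
    show "C #> inv g \<in> rcosets P" if "g \<in> carrier (G\<lparr>carrier := Q\<rparr>)" "C \<in> rcosets P" for g C
      using that PG QG coset_mult_assoc[OF PG] by (auto simp: RCOSETS_def) blast
    show "C #> inv \<one>\<^bsub>G\<lparr>carrier := Q\<rparr>\<^esub> = C" if "C \<in> rcosets P" for C
      using RC[OF that] by (simp add: coset_mult_one)
    show "C #> inv (g \<otimes>\<^bsub>G\<lparr>carrier := Q\<rparr>\<^esub> h) = (C #> inv h) #> inv g"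
      if "g \<in> carrier (G\<lparr>carrier := Q\<rparr>)" "h \<in> carrier (G\<lparr>carrier := Q\<rparr>)" "C \<in> rcosets P" for g h C
      using that QG RC[OF that(3)] by (auto simp: coset_mult_assoc inv_mult_group subset_iff)
  qed (use Q idx P(4) in auto)
  then obtain x where x: "x \<in> carrier G" "C = P #> x" by (auto simp: RCOSETS_def)
  have "x \<otimes> q \<otimes> inv x \<in> P" if q: "q \<in> Q" for q
  proof -
    have qG: "q \<in> carrier G" using q QG by auto
    have "C #> q = C" using C(2)[of "inv q"] subgroup.m_inv_closed[OF Q(1) q] qG by simp
    then have "P #> (x \<otimes> q) = P #> x" using coset_mult_assoc[OF PG x(1) qG] x(2) by simp
    then have "x \<otimes> q \<in> P #> x" using rcos_self[OF _ P(1), of "x \<otimes> q"] x(1) qG by simp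
    then obtain k where "k \<in> P" "x \<otimes> q = k \<otimes> x" by (auto simp: r_coset_def)
    then show ?thesis using x(1) PG by (auto simp: m_assoc subset_iff)
  qed
  then show thesis using that x(1) by blast
qed

text \<open>For a subgroup \<open>P\<close> this is its normalizer in \<open>G\<close>.\<close>

definition conj_stabilizer :: "'a set \<Rightarrow> 'a set" where
  "conj_stabilizer P = {g \<in> carrier G. (\<lambda>k. g \<otimes> k \<otimes> inv g) ` P = P}"

lemma conj_stabilizerI:
  assumes "finite P" "P \<subseteq> carrier G" "g \<in> carrier G" "\<And>k. k \<in> P \<Longrightarrow> g \<otimes> k \<otimes> inv g \<in> P"
  shows "g \<in> conj_stabilizer P"
proof -
  have "(\<lambda>k. g \<otimes> k \<otimes> inv g) ` P = P"
    using assms by (intro endo_inj_surj inj_on_conj) auto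
  then show ?thesis using assms by (simp add: conj_stabilizer_def)
qed

lemma subgroup_conj_stabilizer:
  assumes "P \<subseteq> carrier G"
  shows "subgroup (conj_stabilizer P) G"
proof (rule subgroupI)
  have comp: "(\<lambda>k. (g \<otimes> h) \<otimes> k \<otimes> inv (g \<otimes> h)) ` P = (\<lambda>k. g \<otimes> k \<otimes> inv g) ` (\<lambda>k. h \<otimes> k \<otimes> inv h) ` P"
    if "g \<in> carrier G" "h \<in> carrier G" for g h
    unfolding image_image using assms that by (intro image_cong refl conj_mult) auto
  have one: "(\<lambda>k. \<one> \<otimes> k \<otimes> inv \<one>) ` P = P" using assms by (simp add: subset_iff cong: image_cong)
  show "conj_stabilizer P \<subseteq> carrier G" by (auto simp: conj_stabilizer_def)
  show "conj_stabilizer P \<noteq> {}" using one by (auto simp: conj_stabilizer_def intro!: exI[of _ \<one>] simp del: inv_one)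
  show "g \<otimes> h \<in> conj_stabilizer P" if "g \<in> conj_stabilizer P" "h \<in> conj_stabilizer P" for g h
    using that comp by (simp add: conj_stabilizer_def)
  show "inv g \<in> conj_stabilizer P" if g: "g \<in> conj_stabilizer P" for g
  proof -
    have "(\<lambda>k. inv g \<otimes> k \<otimes> inv (inv g)) ` P = (\<lambda>k. (inv g \<otimes> g) \<otimes> k \<otimes> inv (inv g \<otimes> g)) ` P"
      using comp[of "inv g" g] g by (simp add: conj_stabilizer_def del: l_inv)
    then show ?thesis using one g by (simp add: conj_stabilizer_def)
  qed
qed

text \<open>Sylow conjugacy inside \<open>M\<close> moves \<open>Q\<close> into \<open>P\<close> by
  an element that also stabilizes \<open>P\<close>, so \<open>Q\<close> was contained in
  \<open>P\<close> already.\<close>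

lemma normal_sylow_unique:
  assumes fin: "finite (carrier G)" and p: "prime p"
    and M: "subgroup M G" "card M = p ^ a * m" "\<not> p dvd m" "M \<subseteq> conj_stabilizer P"
    and P: "subgroup P G" "P \<subseteq> M" "card P = p ^ a"
    and Q: "subgroup Q G" "Q \<subseteq> M" "card Q = p ^ a"
  shows "Q = P"
proof -
  interpret M: group "G\<lparr>carrier := M\<rparr>" using subgroup_imp_group[OF M(1)] .
  have MG: "M \<subseteq> carrier G" using subgroup.subset[OF M(1)] .
  have finM: "finite M" using MG fin finite_subset by blast
  have sP: "subgroup P (G\<lparr>carrier := M\<rparr>)" and sQ: "subgroup Q (G\<lparr>carrier := M\<rparr>)"
    using subgroup_incl[OF P(1) M(1)] subgroup_incl[OF Q(1) M(1)] P(2) Q(2) by auto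
  obtain x where x: "x \<in> M" "\<And>q. q \<in> Q \<Longrightarrow> x \<otimes> q \<otimes> inv x \<in> P"
  proof (rule M.sylow_conjugate[OF _ p sP P(3) _ M(3) sQ Q(3)])
    fix x assume "x \<in> carrier (G\<lparr>carrier := M\<rparr>)"
      "\<And>q. q \<in> Q \<Longrightarrow> x \<otimes>\<^bsub>G\<lparr>carrier := M\<rparr>\<^esub> q \<otimes>\<^bsub>G\<lparr>carrier := M\<rparr>\<^esub> inv\<^bsub>G\<lparr>carrier := M\<rparr>\<^esub> x \<in> P"
    then show thesis using that[of x] by (simp add: m_inv_consistent[OF M(1)])
  qed (use finM M(2) in auto)
  have "Q \<subseteq> P"
  proof
    fix q assume q: "q \<in> Q"
    have xs: "x \<in> conj_stabilizer P" using x(1) M(4) by auto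
    then have xG: "x \<in> carrier G" and qG: "q \<in> carrier G" using q MG Q(2) x(1) by auto
    obtain k where "k \<in> P" "x \<otimes> q \<otimes> inv x = x \<otimes> k \<otimes> inv x"
      using x(2)[OF q] xs by (auto simp: conj_stabilizer_def)
    moreover have "k \<in> carrier G" if "k \<in> P" for k using that P(2) MG by auto
    ultimately show "q \<in> P" using xG qG by simp
  qed
  moreover have "finite P" using P(2) finM finite_subset by blast
  ultimately show ?thesis using P(3) Q(3) card_subset_eq by metis
qed

text \<open>The conjugate of \<open>P\<close> by \<open>g\<close> is again a Sylow subgroup of
  \<open>N\<close>. Some \<open>x\<close> in \<open>N\<close> moves it back to \<open>P\<close>, so
  \<open>x \<otimes> g\<close> normalizes \<open>P\<close>.\<close>

lemma frattini:
  assumes fin: "finite (carrier G)" and p: "prime p" and N: "N \<lhd> G"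
    and P: "subgroup P G" "P \<subseteq> N" "card P = p ^ a" "card N = p ^ a * m" "\<not> p dvd m"
    and g: "g \<in> carrier G"
  shows "\<exists>n\<in>N. \<exists>h\<in>conj_stabilizer P. g = n \<otimes> h"
proof -
  have sN: "subgroup N G" using N normal_invE(1) by blast
  interpret N: group "G\<lparr>carrier := N\<rparr>" using subgroup_imp_group[OF sN] .
  have NG: "N \<subseteq> carrier G" using subgroup.subset[OF sN] .
  have finN: "finite N" using NG fin finite_subset by blast
  let ?Q = "(\<lambda>k. g \<otimes> k \<otimes> inv g) ` P"
  have PG: "P \<subseteq> carrier G" using P(2) NG by auto
  have QN: "?Q \<subseteq> N" using normal_invE(2)[OF N g] P(2) by auto
  have cQ: "card ?Q = p ^ a" using card_image[OF inj_on_conj[OF g PG]] P(3) by simp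
  have sP: "subgroup P (G\<lparr>carrier := N\<rparr>)" and sQ: "subgroup ?Q (G\<lparr>carrier := N\<rparr>)"
    using subgroup_incl[OF P(1) sN P(2)] subgroup_incl[OF subgroup_conj[OF P(1) g] sN QN] .
  obtain x where x: "x \<in> N" "\<And>q. q \<in> ?Q \<Longrightarrow> x \<otimes> q \<otimes> inv x \<in> P"
  proof (rule N.sylow_conjugate[OF _ p sP P(3) _ P(5) sQ cQ])
    fix x assume "x \<in> carrier (G\<lparr>carrier := N\<rparr>)"
      "\<And>q. q \<in> ?Q \<Longrightarrow> x \<otimes>\<^bsub>G\<lparr>carrier := N\<rparr>\<^esub> q \<otimes>\<^bsub>G\<lparr>carrier := N\<rparr>\<^esub> inv\<^bsub>G\<lparr>carrier := N\<rparr>\<^esub> x \<in> P"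
    then show thesis using that[of x] by (simp add: m_inv_consistent[OF sN])
  qed (use finN P(4) in auto)
  have xG: "x \<in> carrier G" using x NG by auto
  have "x \<otimes> g \<in> conj_stabilizer P"
  proof (rule conj_stabilizerI)
    show "finite P" using P(2) finN finite_subset by blast
    show "(x \<otimes> g) \<otimes> k \<otimes> inv (x \<otimes> g) \<in> P" if "k \<in> P" for k
      using x(2)[of "g \<otimes> k \<otimes> inv g"] that PG xG g by (auto simp: conj_mult)
  qed (use PG xG g in auto)
  moreover have "g = inv x \<otimes> (x \<otimes> g)" using xG g by (simp add: m_assoc[symmetric])
  moreover have "inv x \<in> N" using subgroup.m_inv_closed[OF sN x(1)] .
  ultimately show ?thesis by blast
qed

text \<open>This is the divisibility of nontrivial orbit lengths. If the index of \<open>D\<close>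
  in \<open>M\<close> were prime to \<open>p\<close>, then \<open>D\<close> would contain a subgroup
  of order p^a, which can only be \<open>P\<close>, the unique one in \<open>M\<close>. By
  definition of \<open>D\<close> the conjugate of \<open>P\<close> by \<open>c\<close> then also
  lies in \<open>M\<close> and equals \<open>P\<close>, although \<open>c\<close> does not normalize
  \<open>P\<close>.\<close>

lemma sylow_normalizer_intersection:
  assumes fin: "finite (carrier G)" and p: "prime p" and N: "subgroup N G"
    and P: "subgroup P G" "P \<subseteq> N" "card P = p ^ a" "card N = p ^ a * m" "\<not> p dvd m"
    and c: "c \<in> N" "c \<notin> conj_stabilizer P"
  defines "M \<equiv> conj_stabilizer P \<inter> N"
  shows "p * card {k \<in> M. c \<otimes> k \<otimes> inv c \<in> M} \<le> card M"
proof -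
  have NG: "N \<subseteq> carrier G" and PG: "P \<subseteq> carrier G" using subgroup.subset N P(1) by auto
  have cG: "c \<in> carrier G" using c NG by auto
  have M: "subgroup M G"
    unfolding M_def by (rule subgroups_Inter_pair[OF subgroup_conj_stabilizer[OF PG] N])
  have MG: "M \<subseteq> carrier G" using subgroup.subset[OF M] .
  have finM: "finite M" using MG fin finite_subset by blast
  have finP: "finite P" using PG fin finite_subset by blast
  have PM: "P \<subseteq> M"
    unfolding M_def using P(2) PG subgroup.m_closed[OF P(1)] subgroup.m_inv_closed[OF P(1)]
    by (auto intro!: conj_stabilizerI[OF finP])
  define D where "D = {k \<in> M. c \<otimes> k \<otimes> inv c \<in> M}"
  have D: "subgroup D G"
  proof (rule subgroupI)
    show "D \<subseteq> carrier G" using MG by (auto simp: D_def)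
    show "D \<noteq> {}" using subgroup.one_closed[OF M] cG by (auto simp: D_def)
    show "x \<otimes> y \<in> D" if "x \<in> D" "y \<in> D" for x y
      using that MG cG subgroup.m_closed[OF M] by (auto simp: D_def conj_distrib subset_iff)
    show "inv x \<in> D" if "x \<in> D" for x
      using that MG cG subgroup.m_inv_closed[OF M] by (auto simp: D_def conj_inv[symmetric] subset_iff)
  qed
  have DM: "D \<subseteq> M" by (auto simp: D_def)
  have finD: "finite D" using DM finM finite_subset by blast
  have lag: "\<exists>i. card L = i * card K" if "subgroup K G" "subgroup L G" "K \<subseteq> L" for K L
  proof -
    interpret L: group "G\<lparr>carrier := L\<rparr>" using subgroup_imp_group[OF that(2)] .
    show ?thesis using L.lagrange[OF subgroup_incl[OF that]]
      by (intro exI[of _ "card (rcosets\<^bsub>G\<lparr>carrier := L\<rparr>\<^esub> K)"]) (simp add: Coset.order_def)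
  qed
  obtain i where i: "card M = i * card D" using lag[OF D M DM] by blast
  obtain i' where i': "card M = i' * p ^ a" using lag[OF P(1) M PM] P(3) by auto
  obtain j where j: "card N = j * card M" using lag[OF M N] by (auto simp: M_def)
  have pa: "p ^ a > 0" using prime_gt_0_nat[OF p] by simp
  \<comment> \<open>\<open>P\<close> remains a Sylow subgroup of \<open>M\<close>, since its index
    there divides its index \<open>m\<close> in \<open>N\<close>.\<close>
  have "\<not> p dvd i'"
  proof
    assume "p dvd i'"
    then have "p dvd j * i'" by simp
    moreover have "p ^ a * m = p ^ a * (j * i')" using j i' P(4) by (simp add: mult_ac)
    then have "m = j * i'" using prime_gt_0_nat[OF p] by auto
    ultimately show False using P(5) by simp
  qed
  have "p dvd i"
  proof (rule ccontr)
    assume "\<not> p dvd i"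
    then have "coprime (p ^ a) i" using p by (simp add: prime_imp_coprime coprime_power_left_iff)
    moreover have "p ^ a dvd i * card D" using i i' by (metis dvd_triv_right)
    ultimately have "p ^ a dvd card D" by (simp add: coprime_dvd_mult_right_iff)
    then obtain l where "card D = p ^ a * l" by (auto elim: dvdE)
    then obtain Q where Q: "subgroup Q (G\<lparr>carrier := D\<rparr>)" "card Q = p ^ a"
      using sylow_thm[OF p subgroup_imp_group[OF D], of a l] finD by (auto simp: Coset.order_def)
    have QD: "Q \<subseteq> D" using subgroup.subset[OF Q(1)] by simp
    have sQ: "subgroup Q G" using incl_subgroup[OF D Q(1)] .
    have uniq: "R = P" if "subgroup R G" "R \<subseteq> M" "card R = p ^ a" for R
      using normal_sylow_unique[OF fin p M _ \<open>\<not> p dvd i'\<close> _ P(1) PM P(3) that] i'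
      by (auto simp: M_def mult.commute)
    have "Q = P" using uniq[OF sQ _ Q(2)] QD DM by auto
    then have PD: "P \<subseteq> D" using QD by simp
    have "(\<lambda>k. c \<otimes> k \<otimes> inv c) ` P = P"
      using uniq[OF subgroup_conj[OF P(1) cG]] PD card_image[OF inj_on_conj[OF cG PG]] P(3)
      by (auto simp: D_def)
    then show False using c(2) cG by (simp add: conj_stabilizer_def)
  qed
  moreover have "i > 0" using i finM subgroup.one_closed[OF M] by (metis card_0_eq empty_iff mult_is_0 neq0_conv)
  ultimately have "p \<le> i" by (auto dest: dvd_imp_le)
  then show ?thesis unfolding i D_def[symmetric] by simp
qed

end

section \<open>Perfect groups have a non-normal Sylow subgroup for some prime at least 5\<close>

lemma degree_sum_surj_hom:
  assumes f: "group_hom K L f" and surj: "f ` carrier K = carrier L" and fin: "finite (carrier K)"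
  shows "degree_sum L \<le> degree_sum K"
proof -
  interpret f: group_hom K L f by fact
  let ?i = "\<lambda>\<chi>. restrict (\<chi> \<circ> f) (carrier K)"
  have "degree_sum L = (\<Sum>\<chi>\<in>?i ` Irr L. Re (\<chi> \<one>\<^bsub>K\<^esub>))"
    unfolding degree_sum_def by (simp add: sum.reindex[OF inj_on_Irr_comp[OF f surj]])
  also have "\<dots> \<le> degree_sum K"
    unfolding degree_sum_def
  proof (rule sum_mono2)
    show "finite (Irr K)" by (rule f.G.finite_Irr[OF fin])
    show "?i ` Irr L \<subseteq> Irr K" using Irr_comp[OF f surj] by auto
    show "0 \<le> Re (\<chi> \<one>\<^bsub>K\<^esub>)" if "\<chi> \<in> Irr K - ?i ` Irr L" for \<chi>
      using Irr_degree[OF f.G.is_group, of \<chi>] that by auto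
  qed
  finally show ?thesis .
qed

context group
begin

lemma degree_sum_Mod_antimono:
  assumes fin: "finite (carrier G)" and D: "D \<lhd> G" and N: "N \<lhd> G" and DN: "D \<subseteq> N"
  shows "degree_sum (G Mod N) \<le> degree_sum (G Mod D)"
proof -
  interpret D: normal D G by fact
  interpret N: normal N G by fact
  have NG: "N \<subseteq> carrier G" using N.subset .
  \<comment> \<open>The natural map from \<open>G/D\<close> to \<open>G/N\<close>, written without
    choosing coset representatives.\<close>
  define f where "f C = N <#> C" for C
  have f_coset: "f (D #> g) = N #> g" if g: "g \<in> carrier G" for g
  proof
    show "f (D #> g) \<subseteq> N #> g"
    proof
      fix x assume "x \<in> f (D #> g)"
      then obtain n d where nd: "n \<in> N" "d \<in> D" "x = n \<otimes> (d \<otimes> g)" by (auto simp: f_def set_mult_def r_coset_def)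
      then have "n \<otimes> d \<in> N" "x = (n \<otimes> d) \<otimes> g" using DN N.m_closed g NG by (auto simp: m_assoc subset_iff)
      then show "x \<in> N #> g" by (auto simp: r_coset_def)
    qed
    show "N #> g \<subseteq> f (D #> g)"
    proof
      fix x assume "x \<in> N #> g"
      then obtain n where "n \<in> N" "x = n \<otimes> g" by (auto simp: r_coset_def)
      then have "n \<in> N" "\<one> \<otimes> g \<in> D #> g" "x = n \<otimes> (\<one> \<otimes> g)"
        using D.one_closed g by (auto simp: r_coset_def)
      then show "x \<in> f (D #> g)" unfolding f_def set_mult_def by blast
    qed
  qed
  have cD: "carrier (G Mod D) = (\<lambda>g. D #> g) ` carrier G" and cN: "carrier (G Mod N) = (\<lambda>g. N #> g) ` carrier G"
    by (auto simp: FactGroup_def RCOSETS_def)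
  have "group_hom (G Mod D) (G Mod N) f"
  proof (intro group_hom.intro group_hom_axioms.intro D.factorgroup_is_group N.factorgroup_is_group homI)
    show "f x \<in> carrier (G Mod N)" if "x \<in> carrier (G Mod D)" for x
      using that by (auto simp: cD cN f_coset)
    fix x y assume "x \<in> carrier (G Mod D)" "y \<in> carrier (G Mod D)"
    then obtain g h where "g \<in> carrier G" "h \<in> carrier G" "x = D #> g" "y = D #> h" by (auto simp: cD)
    then show "f (x \<otimes>\<^bsub>G Mod D\<^esub> y) = f x \<otimes>\<^bsub>G Mod N\<^esub> f y"
      by (simp add: f_coset D.rcos_sum N.rcos_sum)
  qed
  moreover have "f ` carrier (G Mod D) = carrier (G Mod N)"
    unfolding cD cN image_image by (intro image_cong refl) (simp add: f_coset)
  moreover have "finite (carrier (G Mod D))" using fin by (simp add: cD)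
  ultimately show ?thesis by (rule degree_sum_surj_hom)
qed

text \<open>The derived series is formed inside \<open>G\<close>, where every term is visibly
  normal. It becomes stationary because cardinalities cannot drop forever, and
  \<open>derived_consistent\<close> carries it over to \<open>N\<close>, where a trivial term would
  contradict nonsolvability.\<close>

lemma perfect_core:
  assumes fin: "finite (carrier G)" and N: "N \<lhd> G" and ns: "\<not> solvable (G\<lparr>carrier := N\<rparr>)"
  obtains D where "D \<lhd> G" "D \<subseteq> N" "derived G D = D" "D \<noteq> {\<one>}"
proof -
  have sN: "subgroup N G" using N normal_invE(1) by blast
  define S where "S n = (derived G ^^ n) N" for n
  have Sn: "S n \<lhd> G" for n
    by (induction n) (simp_all add: S_def N derived_is_normal)
  have sS: "subgroup (S n) G" for n using Sn normal_invE(1) by blast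
  have dec: "S (Suc n) \<subseteq> S n" for n
    using derived_incl[OF order_refl sS[of n]] by (simp add: S_def)
  have SN: "S n \<subseteq> N" for n
    by (induction n) (use dec in \<open>auto simp: S_def\<close>)
  have finN: "finite N" using subgroup.subset[OF sN] fin finite_subset by blast
  have "\<exists>n. S (Suc n) = S n"
  proof (rule ccontr)
    assume "\<not> ?thesis"
    then have "S (Suc n) \<subset> S n" for n using dec by blast
    then have lt: "card (S (Suc n)) < card (S n)" for n
      using SN finN by (meson finite_subset psubset_card_mono)
    have "card (S n) + n \<le> card (S 0)" for n
    proof (induction n)
      case (Suc n)
      then show ?case using lt[of n] by simp
    qed simp
    from this[of "Suc (card (S 0))"] show False by simp
  qed
  then obtain n where n: "S (Suc n) = S n" by blast
  have "S n \<noteq> {\<one>}"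
  proof
    assume S1: "S n = {\<one>}"
    interpret N: group "G\<lparr>carrier := N\<rparr>" using subgroup_imp_group[OF sN] .
    have "(derived (G\<lparr>carrier := N\<rparr>) ^^ k) N = S k" for k
    proof (induction k)
      case (Suc k)
      then show ?case using derived_consistent[OF SN sN, of k] by (simp add: S_def)
    qed (simp add: S_def)
    then have "solvable_seq (G\<lparr>carrier := N\<rparr>) N"
      using N.trivial_derived_seq_imp_solvable[of N n] N.subgroup_self S1 by simp
    then show False using ns by (simp add: solvable_def)
  qed
  moreover have "derived G (S n) = S n" using n by (simp add: S_def)
  ultimately show thesis using that Sn SN by blast
qed

section \<open>Perfect simple groups and Burnside's argument for the primes 2 and 3\<close>

lemma perfect_simple_center:
  assumes simple: "\<And>K. K \<lhd> G \<Longrightarrow> K = {\<one>} \<or> K = carrier G"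
    and perfect: "derived G (carrier G) = carrier G" and ne: "carrier G \<noteq> {\<one>}"
    and z: "z \<in> carrier G" "\<And>g. g \<in> carrier G \<Longrightarrow> g \<otimes> z \<otimes> inv g = z"
  shows "z = \<one>"
proof (rule ccontr)
  assume z1: "z \<noteq> \<one>"
  define Z where "Z = {x \<in> carrier G. \<forall>g\<in>carrier G. g \<otimes> x \<otimes> inv g = x}"
  have "Z \<lhd> G"
    unfolding normal_inv_iff
  proof
    show "subgroup Z G"
    proof (rule subgroupI)
      show "Z \<noteq> {}" by (auto simp: Z_def)
    qed (auto simp: Z_def conj_distrib conj_inv[symmetric])
  qed (auto simp: Z_def)
  moreover have "z \<in> Z" using z by (simp add: Z_def)
  ultimately have Z: "Z = carrier G" using simple z1 by blast
  have "x \<otimes> y = y \<otimes> x" if "x \<in> carrier G" "y \<in> carrier G" for x y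
  proof -
    have "x \<otimes> y \<otimes> inv x = y" using Z that by (auto simp: Z_def)
    then show ?thesis using that by (metis inv_closed inv_solve_right m_closed inv_inv)
  qed
  then interpret comm_group G by (intro group_comm_groupI)
  have "derived G (carrier G) = {\<one>}" by (rule derived_eq_singleton) simp
  then show False using perfect ne by simp
qed

text \<open>\<open>k\<close> is the dimension of the fixed space \<open>W\<close> of
  \<open>A\<close>. In a basis adapted to \<open>W\<close> the diagonal consists of \<open>k\<close>
  entries 1 followed by entries -1. The two extreme cases are those in which \<open>A\<close> is a
  scalar matrix.\<close>

lemma involution_matrix_trace:
  fixes A :: "complex mat"
  assumes A: "A \<in> carrier_mat n n" and AA: "A * A = 1\<^sub>m n"
  obtains k where "k \<le> n" "mat_trace A = of_int (2 * int k - int n)"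
    "k = n \<Longrightarrow> A = 1\<^sub>m n" "k = 0 \<Longrightarrow> A = - 1\<^sub>m n"
proof -
  define W where "W = {v \<in> carrier_vec n. A *\<^sub>v v = v}"
  have AAv: "A *\<^sub>v (A *\<^sub>v v) = v" if "v \<in> carrier_vec n" for v
    using assoc_mult_mat_vec[OF A A that] AA that by simp
  obtain k P Q where k: "k \<le> n" and P: "P \<in> carrier_mat n n" and Q: "Q \<in> carrier_mat n n"
    and PQ: "P * Q = 1\<^sub>m n" and QP: "Q * P = 1\<^sub>m n"
    and WQ: "W = {w \<in> carrier_vec n. \<forall>i<n. k \<le> i \<longrightarrow> (Q *\<^sub>v w) $ i = 0}"
  proof (rule subspace_adapted_basis[of W n])
    show "W \<subseteq> carrier_vec n" by (auto simp: W_def)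
    show "0\<^sub>v n \<in> W" using A by (auto simp: W_def)
    show "v + w \<in> W" if "v \<in> W" "w \<in> W" for v w
      using that A by (auto simp: W_def mult_add_distrib_mat_vec)
    show "c \<cdot>\<^sub>v v \<in> W" if "v \<in> W" for c v
      using that A by (auto simp: W_def mult_mat_vec)
  qed (use that in auto)
  define B where "B = Q * A * P"
  have QA: "Q * A \<in> carrier_mat n n" and B: "B \<in> carrier_mat n n" using A P Q by (auto simp: B_def)
  have trB: "mat_trace B = mat_trace A"
  proof -
    have "mat_trace B = mat_trace (P * (Q * A))" unfolding B_def by (rule mat_trace_comm[OF QA P])
    also have "P * (Q * A) = A" using assoc_mult_mat[OF P Q A] PQ A by simp
    finally show ?thesis .
  qed
  have colP: "col P j \<in> carrier_vec n" for j using P by (auto simp: carrier_vecI)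
  have QcolP: "Q *\<^sub>v col P j = unit_vec n j" if "j < n" for j
    using col_mult2[OF Q P that] QP that by simp
  have colB: "col B j = Q *\<^sub>v (A *\<^sub>v col P j)" if "j < n" for j
    unfolding B_def using col_mult2[OF QA P that] assoc_mult_mat_vec[OF Q A colP] by simp
  have diag: "B $$ (i,i) = (if i < k then 1 else -1)" if i: "i < n" for i
  proof (cases "i < k")
    case True
    then have "col P i \<in> W" unfolding WQ using QcolP[OF i] colP i by auto
    then have "col B i = unit_vec n i" using colB[OF i] QcolP[OF i] by (simp add: W_def)
    moreover have "B $$ (i,i) = col B i $ i" using B i by simp
    ultimately show ?thesis using True i by simp
  next
    case False
    \<comment> \<open>For any vector v, the sum A v + v is fixed by \<open>A\<close> and so lies in
      \<open>W\<close>. Its vanishing coordinate at \<open>i\<close> determines the diagonal entry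
      without diagonalizing \<open>A\<close>.\<close>
    let ?w = "A *\<^sub>v col P i + col P i"
    have Ac: "A *\<^sub>v col P i \<in> carrier_vec n" using A colP by auto
    have "A *\<^sub>v ?w = col P i + A *\<^sub>v col P i"
      using mult_add_distrib_mat_vec[OF A Ac colP] AAv[OF colP] by simp
    then have "?w \<in> W" using Ac colP by (auto simp: W_def comm_add_vec)
    then have "(Q *\<^sub>v ?w) $ i = 0" unfolding WQ using i False by auto
    moreover have "Q *\<^sub>v ?w = col B i + unit_vec n i"
      using mult_add_distrib_mat_vec[OF Q Ac colP] colB[OF i] QcolP[OF i] by simp
    ultimately have "col B i $ i + 1 = 0" using i B by simp
    moreover have "B $$ (i,i) = col B i $ i" using B i by simp
    ultimately show ?thesis using False by (simp add: eq_neg_iff_add_eq_0)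
  qed
  have "mat_trace A = (\<Sum>i<n. if i < k then 1 else -1)"
    unfolding trB[symmetric] using B by (simp add: mat_trace_def diag)
  also have "\<dots> = of_int (2 * int k - int n)"
  proof -
    have "{..<n} \<inter> {i. i < k} = {..<k}" "{..<n} \<inter> - {i. i < k} = {k..<n}" using k by auto
    then show ?thesis using k by (simp add: sum.If_cases of_nat_diff)
  qed
  finally have tr: "mat_trace A = of_int (2 * int k - int n)" .
  have "A = 1\<^sub>m n" if "k = n"
  proof (rule mat_col_eqI)
    fix i assume "i < dim_col (1\<^sub>m n :: complex mat)"
    then have i: "i < n" by simp
    have "unit_vec n i \<in> W" unfolding WQ using that by auto
    then show "col A i = col (1\<^sub>m n) i" using mat_unit_vec_col[OF A i] i by (simp add: W_def)
  qed (use A in auto)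
  moreover have "A = - 1\<^sub>m n" if "k = 0"
  proof (rule eq_matI)
    fix i j assume "i < dim_row (- 1\<^sub>m n :: complex mat)" "j < dim_col (- 1\<^sub>m n :: complex mat)"
    then have ij: "i < n" "j < n" by auto
    let ?e = "unit_vec n j :: complex vec"
    let ?w = "A *\<^sub>v ?e + ?e"
    have Ae: "A *\<^sub>v ?e \<in> carrier_vec n" using A by auto
    have "A *\<^sub>v ?w = ?e + A *\<^sub>v ?e"
      using mult_add_distrib_mat_vec[OF A Ae, of ?e] AAv[of ?e] by simp
    then have w: "?w \<in> W" using Ae by (auto simp: W_def comm_add_vec)
    have wc: "?w \<in> carrier_vec n" using Ae by simp
    have "Q *\<^sub>v ?w = 0\<^sub>v n" using w Q unfolding WQ that by (intro eq_vecI) auto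
    then have "P *\<^sub>v (Q *\<^sub>v ?w) = 0\<^sub>v n" using P by auto
    then have "?w = 0\<^sub>v n" using assoc_mult_mat_vec[OF P Q wc] PQ wc by simp
    then have "?w $ i = 0" using ij by simp
    then have "A $$ (i,j) + (if i = j then 1 else 0) = 0"
      using ij A mat_unit_vec_col[OF A ij(2)] by simp
    then show "A $$ (i,j) = (- 1\<^sub>m n) $$ (i,j)" using ij by (auto simp: eq_neg_iff_add_eq_0 split: if_splits)
  qed (use A in auto)
  ultimately show thesis using that k tr by blast
qed

text \<open>The value of the central character at the sum of the class \<open>C\<close>. That sum
  acts on functions on the group by the integer matrix \<open>L\<close>, and the vector of values of
  \<chi> is an eigenvector with exactly this eigenvalue, which is thus a root of a monic integer
  polynomial.\<close>

lemma class_value_algebraic_int: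
  assumes fin: "finite (carrier G)" and \<chi>: "\<chi> \<in> Irr G" and z: "z \<in> carrier G"
  defines "C \<equiv> (\<lambda>g. g \<otimes> z \<otimes> inv g) ` carrier G"
  shows "algebraic_int (of_nat (card C) * \<chi> z / \<chi> \<one>)"
proof -
  define n where "n = card (carrier G)"
  have CG: "C \<subseteq> carrier G" using z by (auto simp: C_def)
  have Cconj: "h \<otimes> x \<otimes> inv h \<in> C" if "x \<in> C" "h \<in> carrier G" for x h
    using that z by (auto simp: C_def conj_mult[symmetric])
  obtain e where e: "bij_betw e {..<n} (carrier G)"
    using ex_bij_betw_nat_finite[OF fin] by (auto simp: n_def lessThan_atLeast0)
  have ec: "e i \<in> carrier G" if "i < n" for i using e that by (auto simp: bij_betw_def)
  define L :: "int mat" where "L = mat n n (\<lambda>(i,j). if e j \<otimes> inv (e i) \<in> C then 1 else 0)"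
  have L: "L \<in> carrier_mat n n" by (simp add: L_def)
  let ?L = "map_mat of_int L :: complex mat"
  have L': "?L \<in> carrier_mat n n" using L by simp
  define v where "v = vec n (\<lambda>i. \<chi> (e i))"
  define r where "r = of_nat (card C) * \<chi> z / \<chi> \<one>"
  have \<chi>1: "\<chi> \<one> \<noteq> 0" using Irr_degree[OF is_group \<chi>] by auto
  have \<chi>C: "\<chi> x = \<chi> z" if "x \<in> C" for x
    using that Irr_conj[OF \<chi> z] by (auto simp: C_def)
  have scal: "(\<Sum>x\<in>C. \<chi> (x \<otimes> g)) = r * \<chi> g" if g: "g \<in> carrier G" for g
  proof -
    have "\<chi> \<one> * (\<Sum>x\<in>C. 1 * \<chi> (x \<otimes> g)) = (\<Sum>x\<in>C. 1 * \<chi> x) * \<chi> g"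
      by (rule Irr_central_sum[OF \<chi> CG Cconj _ g]) auto
    also have "(\<Sum>x\<in>C. 1 * \<chi> x) = of_nat (card C) * \<chi> z" by (simp add: \<chi>C)
    finally show ?thesis using \<chi>1 by (simp add: r_def field_simps)
  qed
  have "?L *\<^sub>v v = r \<cdot>\<^sub>v v"
  proof (rule eq_vecI)
    fix i assume "i < dim_vec (r \<cdot>\<^sub>v v)"
    then have i: "i < n" by (simp add: v_def)
    have "(?L *\<^sub>v v) $ i = (\<Sum>j<n. (if e j \<otimes> inv (e i) \<in> C then 1 else 0) * \<chi> (e j))"
      using i by (auto simp: L_def v_def scalar_prod_def lessThan_atLeast0 intro!: sum.cong)
    also have "\<dots> = (\<Sum>j<n. if e j \<otimes> inv (e i) \<in> C then \<chi> (e j) else 0)"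
      by (intro sum.cong) auto
    also have "\<dots> = (\<Sum>g\<in>carrier G. if g \<otimes> inv (e i) \<in> C then \<chi> g else 0)"
      using sum.reindex_bij_betw[OF e, of "\<lambda>g. if g \<otimes> inv (e i) \<in> C then \<chi> g else 0"] by simp
    also have "\<dots> = (\<Sum>g\<in>{g \<in> carrier G. g \<otimes> inv (e i) \<in> C}. \<chi> g)"
      using fin by (simp add: sum.inter_filter)
    also have "\<dots> = (\<Sum>x\<in>C. \<chi> (x \<otimes> e i))"
      by (rule sum.reindex_bij_witness[of _ "\<lambda>x. x \<otimes> e i" "\<lambda>g. g \<otimes> inv (e i)"])
        (use CG ec[OF i] in \<open>auto simp: m_assoc subset_iff\<close>)
    also have "\<dots> = (r \<cdot>\<^sub>v v) $ i" using scal[OF ec[OF i]] i by (simp add: v_def)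
    finally show "(?L *\<^sub>v v) $ i = (r \<cdot>\<^sub>v v) $ i" .
  qed (simp add: L_def v_def)
  moreover have "v \<noteq> 0\<^sub>v n"
  proof
    assume v0: "v = 0\<^sub>v n"
    obtain i where i: "i < n" "e i = \<one>" using e by (auto simp: bij_betw_def) (metis image_iff lessThan_iff one_closed)
    have "v $ i = \<chi> \<one>" using i by (simp add: v_def)
    then show False using v0 i \<chi>1 by simp
  qed
  ultimately have "eigenvalue ?L r"
    unfolding eigenvalue_def eigenvector_def using L' by (intro exI[of _ v]) (auto simp: v_def)
  then have "poly (char_poly ?L) r = 0" using eigenvalue_root_char_poly[OF L'] by simp
  moreover have "char_poly ?L = map_poly of_int (char_poly L)" by (rule of_int_hom.char_poly_hom[OF L])
  moreover have "lead_coeff (char_poly ?L) = 1" using degree_monic_char_poly[OF L'] by simp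
  ultimately show ?thesis
    unfolding r_def[symmetric] by (intro algebraic_int.intros[of "char_poly ?L"]) auto
qed

end

lemma even_card_involution:
  assumes "finite S" and "\<And>x. x \<in> S \<Longrightarrow> f x \<in> S" "\<And>x. x \<in> S \<Longrightarrow> f (f x) = x" "\<And>x. x \<in> S \<Longrightarrow> f x \<noteq> x"
  shows "even (card S)"
  using assms
proof (induction "card S" arbitrary: S rule: less_induct)
  case less
  show ?case
  proof (cases "S = {}")
    case False
    then obtain x where x: "x \<in> S" by blast
    let ?T = "S - {x, f x}"
    have c: "card S = card ?T + 2"
    proof -
      have "x \<noteq> f x" using less.prems(4)[OF x] by metis
      then have "card {x, f x} = 2" "{x, f x} \<subseteq> S" using less.prems(2) x by auto
      then show ?thesis using less.prems(1) card_Diff_subset[of "{x, f x}" S] card_mono[of S "{x, f x}"] by simp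
    qed
    have "even (card ?T)"
    proof (rule less.hyps)
      show "f y \<in> ?T" if "y \<in> ?T" for y
        using that less.prems(2,3) x by (metis DiffD1 DiffD2 DiffI insertCI insertE singletonD)
    qed (use c less.prems in auto)
    then show ?thesis using c by simp
  qed simp
qed

context group
begin

lemma kernel_subgroup:
  assumes \<rho>: "representation G n \<rho>"
  shows "subgroup {g \<in> carrier G. \<rho> g = 1\<^sub>m n} G"
proof (rule subgroupI)
  note c = rep_carrier[OF \<rho>] and m = rep_mult[OF \<rho>]
  show "{g \<in> carrier G. \<rho> g = 1\<^sub>m n} \<noteq> {}" using rep_one[OF \<rho>] by auto
  show "inv x \<in> {g \<in> carrier G. \<rho> g = 1\<^sub>m n}" if "x \<in> {g \<in> carrier G. \<rho> g = 1\<^sub>m n}" for x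
    using that m[of x "inv x"] rep_one[OF \<rho>] c[of "inv x"] by simp
qed (auto simp: rep_mult[OF \<rho>])

text \<open>\<open>Z\<close> is the preimage of the centre of the image of \<rho>. It is normal and
  contains \<open>z\<close>, hence is everything, so the image is abelian and a perfect group acts
  trivially. The character is then the constant \<open>n\<close>, which pairs nontrivially with the
  trivial character and therefore equals it.\<close>

lemma perfect_simple_scalar:
  assumes fin: "finite (carrier G)"
    and simple: "\<And>K. K \<lhd> G \<Longrightarrow> K = {\<one>} \<or> K = carrier G"
    and perfect: "derived G (carrier G) = carrier G"
    and irr: "irreducible_representation G n \<rho>"
    and z: "z \<in> carrier G" "z \<noteq> \<one>" "\<And>g. g \<in> carrier G \<Longrightarrow> \<rho> z * \<rho> g = \<rho> g * \<rho> z"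
  shows "character_of G \<rho> = restrict (\<lambda>_. 1) (carrier G)"
proof -
  have \<rho>: "representation G n \<rho>" and n: "n > 0" using irr by (auto simp: irreducible_representation_def)
  note c = rep_carrier[OF \<rho>] and m = rep_mult[OF \<rho>]
  define Z where "Z = {x \<in> carrier G. \<forall>g\<in>carrier G. \<rho> (g \<otimes> x \<otimes> inv g) = \<rho> x}"
  have conj_one: "\<rho> (g \<otimes> h \<otimes> inv g) = \<rho> h \<longleftrightarrow> \<rho> g * \<rho> h = \<rho> h * \<rho> g" if gh: "g \<in> carrier G" "h \<in> carrier G" for g h
  proof
    assume eq: "\<rho> (g \<otimes> h \<otimes> inv g) = \<rho> h"
    have "\<rho> g * \<rho> h = \<rho> ((g \<otimes> h \<otimes> inv g) \<otimes> g)" using gh by (simp add: m m_assoc flip: m)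
    also have "\<dots> = \<rho> h * \<rho> g" using gh eq by (subst m) auto
    finally show "\<rho> g * \<rho> h = \<rho> h * \<rho> g" .
  next
    assume eq: "\<rho> g * \<rho> h = \<rho> h * \<rho> g"
    have "\<rho> (g \<otimes> h \<otimes> inv g) = \<rho> g * \<rho> h * \<rho> (inv g)" using gh by (simp add: m)
    also have "\<dots> = \<rho> (h \<otimes> g \<otimes> inv g)" using gh by (simp add: m eq)
    finally show "\<rho> (g \<otimes> h \<otimes> inv g) = \<rho> h" using gh by (simp add: m_assoc)
  qed
  have "Z \<lhd> G"
    unfolding normal_inv_iff
  proof
    show "subgroup Z G"
    proof (rule subgroupI)
      show "Z \<subseteq> carrier G" by (auto simp: Z_def)
      show "Z \<noteq> {}" by (auto simp: Z_def intro!: exI[of _ \<one>])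
      show "x \<otimes> y \<in> Z" if "x \<in> Z" "y \<in> Z" for x y
        using that by (auto simp: Z_def conj_distrib m)
      show "inv x \<in> Z" if x: "x \<in> Z" for x
      proof -
        have xG: "x \<in> carrier G" using x by (simp add: Z_def)
        have "\<rho> (g \<otimes> inv x \<otimes> inv g) = \<rho> (inv x)" if g: "g \<in> carrier G" for g
        proof -
          have gx: "\<rho> (inv x \<otimes> g \<otimes> x) = \<rho> g"
          proof -
            have "\<rho> g * \<rho> x = \<rho> x * \<rho> g" using x g by (auto simp: Z_def conj_one)
            then have "\<rho> (inv x \<otimes> g \<otimes> x) = \<rho> (inv x \<otimes> (x \<otimes> g))"
              using xG g c[of x] c[of g] c[of "inv x"] by (simp add: m assoc_mult_mat[of _ n n _ n _ n])
            then show ?thesis using xG g by (simp add: m_assoc[symmetric])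
          qed
          have "\<rho> g * \<rho> (inv x) = \<rho> (inv x \<otimes> g \<otimes> x) * \<rho> (inv x)" by (simp add: gx)
          also have "\<dots> = \<rho> (inv x \<otimes> g \<otimes> x \<otimes> inv x)" using xG g by (intro m[symmetric]) auto
          also have "\<dots> = \<rho> (inv x) * \<rho> g" using xG g by (simp add: m_assoc m)
          finally show ?thesis using conj_one[OF g, of "inv x"] xG by simp
        qed
        then show ?thesis using xG by (simp add: Z_def)
      qed
    qed
    show "\<forall>x\<in>carrier G. \<forall>h\<in>Z. x \<otimes> h \<otimes> inv x \<in> Z"
      by (auto simp: Z_def conj_mult[symmetric])
  qed
  moreover have "z \<in> Z" using z by (auto simp: Z_def conj_one)
  ultimately have Z: "Z = carrier G" using simple z(2) by blast
  define K where "K = {g \<in> carrier G. \<rho> g = 1\<^sub>m n}"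
  have K: "subgroup K G" unfolding K_def by (rule kernel_subgroup[OF \<rho>])
  have "derived_set G (carrier G) \<subseteq> K"
  proof
    fix x assume "x \<in> derived_set G (carrier G)"
    then obtain g h where gh: "g \<in> carrier G" "h \<in> carrier G" "x = g \<otimes> h \<otimes> inv g \<otimes> inv h" by auto
    have "\<rho> x = \<rho> (g \<otimes> h \<otimes> inv g) * \<rho> (inv h)" using gh by (simp add: m)
    also have "\<rho> (g \<otimes> h \<otimes> inv g) = \<rho> h" using Z gh(1,2) by (auto simp: Z_def)
    also have "\<rho> h * \<rho> (inv h) = \<rho> (h \<otimes> inv h)" using gh by (intro m[symmetric]) auto
    finally show "x \<in> K" using gh rep_one[OF \<rho>] by (simp add: K_def)
  qed
  then have "carrier G \<subseteq> K"
    using generate_subgroup_incl[OF _ K] perfect unfolding derived_def by auto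
  then have triv: "character_of G \<rho> g = of_nat n" if "g \<in> carrier G" for g
    using that by (auto simp: character_of_def K_def mat_trace_def)
  show ?thesis
  proof (rule ccontr)
    assume ne: "character_of G \<rho> \<noteq> restrict (\<lambda>_. 1) (carrier G)"
    have "character_of G \<rho> \<in> Irr G" using irr by (auto simp: Irr_def)
    from Irr_orthogonality[OF fin this trivial_Irr]
    have "(\<Sum>g\<in>carrier G. of_nat n * 1 :: complex) = 0" using ne triv by simp
    then show False using n card_carrier_pos[OF fin] by simp
  qed
qed

text \<open>Elements that are not their own inverse come in pairs, and the identity is one more
  element. In a group of even order the number of involutions is therefore odd, and the 2-group
  \<open>P\<close> fixes one of them under conjugation.\<close>

lemma centralizing_involution:
  assumes fin: "finite (carrier G)" and P: "subgroup P G" "card P = 2 ^ a" and ev: "even (card (carrier G))"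
  obtains z where "z \<in> carrier G" "z \<noteq> \<one>" "z \<otimes> z = \<one>" "\<And>g. g \<in> P \<Longrightarrow> g \<otimes> z \<otimes> inv g = z"
proof -
  have PG: "P \<subseteq> carrier G" using subgroup.subset[OF P(1)] .
  define I where "I = {x \<in> carrier G. x \<noteq> \<one> \<and> x \<otimes> x = \<one>}"
  define S where "S = {x \<in> carrier G. x \<otimes> x \<noteq> \<one>}"
  have finI: "finite I" and finS: "finite S" using fin by (auto simp: I_def S_def)
  have "even (card S)"
  proof (rule even_card_involution[OF finS, of "\<lambda>x. inv x"])
    fix x assume x: "x \<in> S"
    then have xG: "x \<in> carrier G" by (simp add: S_def)
    show "inv x \<noteq> x" using x xG by (metis (mono_tags, lifting) S_def mem_Collect_eq r_inv)
    show "inv (inv x) = x" using xG by simp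
    have "inv x \<otimes> inv x \<noteq> \<one>"
      using x xG by (metis (mono_tags, lifting) S_def inv_closed inv_equality inv_inv mem_Collect_eq r_inv)
    then show "inv x \<in> S" using xG by (simp add: S_def)
  qed
  moreover have "carrier G = insert \<one> (I \<union> S)" by (auto simp: I_def S_def)
  moreover have "card (insert \<one> (I \<union> S)) = 1 + (card I + card S)"
    using finI finS by (subst card_insert_disjoint) (auto simp: I_def S_def intro!: card_Un_disjoint)
  ultimately have odd: "\<not> 2 dvd card I" using ev by auto
  show thesis
  proof (rule p_group_fixed_point[OF subgroup_imp_group[OF P(1)] two_is_prime_nat _ finI odd, where act = "\<lambda>g x. g \<otimes> x \<otimes> inv g" and a = a])
    show "g \<otimes> x \<otimes> inv g \<in> I" if "g \<in> carrier (G\<lparr>carrier := P\<rparr>)" "x \<in> I" for g x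
    proof -
      have gx: "g \<in> carrier G" "x \<in> carrier G" using that PG by (auto simp: I_def)
      have "g \<otimes> x \<otimes> inv g \<noteq> \<one>"
      proof
        assume "g \<otimes> x \<otimes> inv g = \<one>"
        then have "x = \<one>" using conj_inv_cancel(1)[OF gx] gx by simp
        then show False using that by (simp add: I_def)
      qed
      moreover have "(g \<otimes> x \<otimes> inv g) \<otimes> (g \<otimes> x \<otimes> inv g) = \<one>"
        using conj_distrib[of g x x] gx that by (simp add: I_def)
      ultimately show ?thesis using gx by (simp add: I_def)
    qed
    show "(g \<otimes>\<^bsub>G\<lparr>carrier := P\<rparr>\<^esub> h) \<otimes> x \<otimes> inv (g \<otimes>\<^bsub>G\<lparr>carrier := P\<rparr>\<^esub> h) = g \<otimes> (h \<otimes> x \<otimes> inv h) \<otimes> inv g"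
      if "g \<in> carrier (G\<lparr>carrier := P\<rparr>)" "h \<in> carrier (G\<lparr>carrier := P\<rparr>)" "x \<in> I" for g h x
      using conj_mult[of g h x] that PG by (auto simp: I_def subset_iff)
    show "\<one>\<^bsub>G\<lparr>carrier := P\<rparr>\<^esub> \<otimes> x \<otimes> inv \<one>\<^bsub>G\<lparr>carrier := P\<rparr>\<^esub> = x" if "x \<in> I" for x
      using that by (simp add: I_def)
    fix z assume "z \<in> I" "\<And>g. g \<in> carrier (G\<lparr>carrier := P\<rparr>) \<Longrightarrow> g \<otimes> z \<otimes> inv g = z"
    then show thesis using that[of z] by (auto simp: I_def)
  qed (use P in auto)
qed

text \<open>The number of non-identity elements is -1 modulo \<open>p\<close>, so the conjugation
  action of \<open>P\<close> through \<open>h\<close> fixes one of them. Allowing a homomorphism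
  \<open>h\<close> covers both the centre of a \<open>p\<close>-group and the image of a Sylow
  subgroup in a quotient.\<close>

lemma p_group_center:
  assumes fin: "finite (carrier G)" and P: "group P" "prime p" "card (carrier P) = p ^ a"
    and h: "h \<in> hom P G" and dvd: "p dvd card (carrier G)"
  obtains x where "x \<in> carrier G" "x \<noteq> \<one>" "\<And>g. g \<in> carrier P \<Longrightarrow> h g \<otimes> x \<otimes> inv (h g) = x"
proof -
  interpret h: group_hom P G h using P(1) h by (simp add: group_hom_def group_hom_axioms_def is_group)
  let ?E = "carrier G - {\<one>}"
  have card: "card (carrier G) = card ?E + 1" using card_Suc_Diff1[OF fin one_closed] by simp
  have "\<not> p dvd card ?E"
  proof
    assume "p dvd card ?E"
    then have "p dvd 1" using dvd unfolding card by (metis dvd_add_right_iff)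
    then show False using P(2) by (simp add: prime_nat_iff)
  qed
  show thesis
  proof (rule p_group_fixed_point[OF P _ \<open>\<not> p dvd card ?E\<close>, where act = "\<lambda>g x. h g \<otimes> x \<otimes> inv (h g)"])
    show "h g \<otimes> x \<otimes> inv (h g) \<in> ?E" if "g \<in> carrier P" "x \<in> ?E" for g x
    proof -
      have "h g \<otimes> x \<otimes> inv (h g) \<noteq> \<one>"
      proof
        assume "h g \<otimes> x \<otimes> inv (h g) = \<one>"
        then have "x = \<one>" using conj_inv_cancel(1)[of "h g" x] that by simp
        then show False using that by simp
      qed
      then show ?thesis using that by simp
    qed
    show "h (g \<otimes>\<^bsub>P\<^esub> k) \<otimes> x \<otimes> inv (h (g \<otimes>\<^bsub>P\<^esub> k)) = h g \<otimes> (h k \<otimes> x \<otimes> inv (h k)) \<otimes> inv (h g)"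
      if "g \<in> carrier P" "k \<in> carrier P" "x \<in> ?E" for g k x
      using that conj_mult[of "h g" "h k" x] by simp
    fix x assume "x \<in> ?E" "\<And>g. g \<in> carrier P \<Longrightarrow> h g \<otimes> x \<otimes> inv (h g) = x"
    then show thesis using that[of x] by auto
  qed (use fin in auto)
qed

text \<open>The regular character vanishes at \<open>z\<close>, so the sum of \<chi>(1) \<chi>(z)
  over all \<chi> is 0. The trivial character contributes 1, and every other term is divisible by 3,
  which is impossible. Divisibility holds because \<chi>(z) is 0 whenever \<chi> is nontrivial of
  degree prime to 3.\<close>

theorem no_perfect_simple_23_group:
  assumes fin: "finite (carrier G)" and ne: "carrier G \<noteq> {\<one>}"
    and simple: "\<And>K. K \<lhd> G \<Longrightarrow> K = {\<one>} \<or> K = carrier G"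
    and perfect: "derived G (carrier G) = carrier G"
    and primes: "\<And>p. prime p \<Longrightarrow> p dvd card (carrier G) \<Longrightarrow> p = 2 \<or> p = 3"
  shows False
proof -
  note center = perfect_simple_center[OF simple perfect ne]
  have c0: "card (carrier G) > 0" by (rule card_carrier_pos[OF fin])
  have prime3: "prime (3::nat)" by simp
  have not_p: False if p: "prime p" and pw: "card (carrier G) = p ^ a" for p a
  proof -
    have "card (carrier G) \<noteq> 1" using ne by (metis card_1_singletonE one_closed singletonD)
    then have "p dvd card (carrier G)" using pw by (cases a) auto
    then obtain x where "x \<in> carrier G" "x \<noteq> \<one>" "\<And>g. g \<in> carrier G \<Longrightarrow> id g \<otimes> x \<otimes> inv (id g) = x"
      using p_group_center[OF fin is_group p pw, of id] by (auto simp: hom_def)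
    then show False using center[of x] by simp
  qed
  \<comment> \<open>Otherwise the order would be a power of 3, and a nontrivial 3-group has a
    nontrivial centre.\<close>
  have ev: "even (card (carrier G))"
  proof (rule ccontr)
    assume odd: "odd (card (carrier G))"
    obtain a m where am: "card (carrier G) = 3 ^ a * m" "\<not> 3 dvd m" using multiplicity_split[OF prime3 c0] by blast
    have "m = 1"
    proof (rule ccontr)
      assume "m \<noteq> 1"
      then obtain q where q: "prime q" "q dvd m" using prime_factor_nat by blast
      then have "q dvd card (carrier G)" using am by simp
      then show False using primes[OF q(1)] q am odd by auto
    qed
    then show False using not_p[OF prime3] am by simp
  qed
  obtain a m where am: "card (carrier G) = 2 ^ a * m" "\<not> 2 dvd m"
    using multiplicity_split[OF two_is_prime_nat c0] by blast
  obtain P where P: "subgroup P G" "card P = 2 ^ a"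
    using sylow_thm[OF two_is_prime_nat is_group, of a m] am fin by (auto simp: Coset.order_def)
  obtain z where z: "z \<in> carrier G" "z \<noteq> \<one>" "z \<otimes> z = \<one>" "\<And>g. g \<in> P \<Longrightarrow> g \<otimes> z \<otimes> inv g = z"
    using centralizing_involution[OF fin P ev] by blast
  define C where "C = (\<lambda>g. g \<otimes> z \<otimes> inv g) ` carrier G"
  \<comment> \<open>The centralizer of \<open>z\<close> contains the Sylow 2-subgroup
    \<open>P\<close>, so the class length divides the odd part \<open>m\<close> of the order. Only
    the prime 3 can then divide it.\<close>
  have "card C dvd m"
  proof -
    let ?\<phi> = "\<lambda>g. \<lambda>h\<in>carrier G. g \<otimes> h \<otimes> inv g"
    interpret A: group_action G "carrier G" ?\<phi> by (rule action_by_conjugation)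
    have orb: "orbit G ?\<phi> z = C" using z(1) by (auto simp: orbit_def C_def)
    have st: "stabilizer G ?\<phi> z = {g \<in> carrier G. g \<otimes> z \<otimes> inv g = z}" using z(1) by (auto simp: stabilizer_def)
    have sub: "subgroup (stabilizer G ?\<phi> z) G" by (rule A.stabilizer_subgroup[OF z(1)])
    have "P \<subseteq> stabilizer G ?\<phi> z" using z(4) subgroup.subset[OF P(1)] by (auto simp: st)
    then have "subgroup P (G\<lparr>carrier := stabilizer G ?\<phi> z\<rparr>)" using subgroup_incl[OF P(1) sub] by blast
    note lag = group.lagrange[OF subgroup_imp_group[OF sub] this]
    define i where "i = card (rcosets\<^bsub>G\<lparr>carrier := stabilizer G ?\<phi> z\<rparr>\<^esub> P)"
    have "card (stabilizer G ?\<phi> z) = i * 2 ^ a" using lag P(2) by (simp add: Coset.order_def i_def)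
    then have "card C * (i * 2 ^ a) = 2 ^ a * m"
      using A.orbit_stabilizer_theorem[OF z(1)] orb am by (simp add: Coset.order_def)
    then have "card C * i = m" by simp
    then show ?thesis by auto
  qed
  have cop: "coprime (card C) d" if d: "\<not> 3 dvd d" for d
  proof (rule ccontr)
    assume "\<not> coprime (card C) d"
    then obtain q where q: "prime q" "q dvd card C" "q dvd d"
      by (meson coprime_iff_gcd_eq_1 gcd_greatest_iff prime_factor_nat)
    then have "q dvd m" using \<open>card C dvd m\<close> dvd_trans by blast
    then show False using primes[OF q(1)] q(3) d am by auto
  qed
  have triv: "restrict (\<lambda>_. 1) (carrier G) \<in> Irr G" by (rule trivial_Irr)
  define t1 where "t1 = restrict (\<lambda>_. 1 :: complex) (carrier G)"
  \<comment> \<open>\<open>k\<close> is the dimension of the space fixed by \<open>z\<close>. The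
    cases \<open>k = d\<close> and \<open>k = 0\<close> mean that \<open>z\<close> acts as 1 or -1,
    which only the trivial character permits; for all others |\<chi>(z)| < \<chi>(1).\<close>
  have data: "\<exists>d k. \<chi> \<one> = of_nat d \<and> \<chi> z = of_int (2 * int k - int d) \<and> k \<le> d \<and> d > 0 \<and>
      (\<chi> \<noteq> t1 \<longrightarrow> k \<noteq> d \<and> k \<noteq> 0)" if \<chi>: "\<chi> \<in> Irr G" for \<chi>
  proof -
    obtain n \<rho> where irr: "irreducible_representation G n \<rho>" and \<chi>\<rho>: "\<chi> = character_of G \<rho>"
      using \<chi> by (auto simp: Irr_def)
    have \<rho>: "representation G n \<rho>" and n: "n > 0" using irr by (auto simp: irreducible_representation_def)
    have A: "\<rho> z \<in> carrier_mat n n" by (rule rep_carrier[OF \<rho> z(1)])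
    have AA: "\<rho> z * \<rho> z = 1\<^sub>m n" using rep_mult[OF \<rho> z(1) z(1)] z(3) rep_one[OF \<rho>] by simp
    obtain k where k: "k \<le> n" "mat_trace (\<rho> z) = of_int (2 * int k - int n)"
      "k = n \<Longrightarrow> \<rho> z = 1\<^sub>m n" "k = 0 \<Longrightarrow> \<rho> z = - 1\<^sub>m n"
      using involution_matrix_trace[OF A AA] by metis
    have "\<chi> = t1" if "k = n \<or> k = 0"
      unfolding \<chi>\<rho> t1_def
    proof (rule perfect_simple_scalar[OF fin simple perfect irr z(1,2)])
      fix g assume "g \<in> carrier G"
      then have "\<rho> g \<in> carrier_mat n n" by (rule rep_carrier[OF \<rho>])
      then show "\<rho> z * \<rho> g = \<rho> g * \<rho> z" using that k(3,4) by auto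
    qed
    moreover have "\<chi> \<one> = of_nat n" using character_of_one[OF is_group \<rho>] \<chi>\<rho> by simp
    moreover have "\<chi> z = of_int (2 * int k - int n)" using k(2) z(1) by (simp add: \<chi>\<rho> character_of_def)
    ultimately show ?thesis using k(1) n by (intro exI[of _ n] exI[of _ k] conjI impI) auto
  qed
  define Q where "Q \<chi> d t \<longleftrightarrow> \<chi> \<one> = of_nat d \<and> \<chi> z = of_int t \<and> (\<chi> \<noteq> t1 \<longrightarrow> 3 dvd int d * t)"
    for \<chi> :: "'a \<Rightarrow> complex" and d :: nat and t :: int
  have "\<exists>d t. Q \<chi> d t" if \<chi>: "\<chi> \<in> Irr G" for \<chi>
  proof -
    obtain d k where dk: "\<chi> \<one> = of_nat d" "\<chi> z = of_int (2 * int k - int d)" "k \<le> d" "d > 0"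
      "\<chi> \<noteq> t1 \<longrightarrow> k \<noteq> d \<and> k \<noteq> 0" using data[OF \<chi>] by blast
    define t where "t = 2 * int k - int d"
    have "3 dvd int d * t" if ne1: "\<chi> \<noteq> t1"
    proof (cases "3 dvd d")
      case True
      then have "3 dvd int d" by presburger
      then show ?thesis by simp
    next
      case False
      \<comment> \<open>As \<chi>(z) = t is an integer, this algebraic integer is rational and hence
        an integer. So \<open>d\<close> divides \<open>card C * t\<close> and, being coprime to
        \<open>card C\<close>, divides \<open>t\<close>. With |t| < d this gives
        \<open>t = 0\<close>.\<close>
      have "algebraic_int (of_nat (card C) * \<chi> z / \<chi> \<one>)"
        unfolding C_def by (rule class_value_algebraic_int[OF fin \<chi> z(1)])
      moreover have "of_nat (card C) * \<chi> z / \<chi> \<one> \<in> \<rat>" by (simp add: dk(1,2))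
      ultimately have "of_nat (card C) * \<chi> z / \<chi> \<one> \<in> \<int>" by (rule rational_algebraic_int_is_int)
      then obtain i where "of_nat (card C) * \<chi> z / \<chi> \<one> = of_int i" by (auto elim: Ints_cases)
      then have "(of_int (int (card C) * t) :: complex) = of_int (i * int d)"
        using dk by (simp add: t_def field_simps)
      then have "int (card C) * t = i * int d" by (simp only: of_int_eq_iff)
      then have "int d dvd int (card C) * t" by simp
      moreover have "coprime (int d) (int (card C))" using cop[OF False] by (simp add: coprime_commute)
      ultimately have dt: "int d dvd t" by (simp add: coprime_dvd_mult_right_iff)
      have "\<bar>t\<bar> < int d" using dk ne1 by (auto simp: t_def)
      then have "t = 0" using dt dvd_imp_le_int[of t "int d"] by linarith
      then show ?thesis by simp
    qed
    then have "Q \<chi> d t" using dk by (simp add: Q_def t_def)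
    then show ?thesis by blast
  qed
  then obtain d t where Q: "\<And>\<chi>. \<chi> \<in> Irr G \<Longrightarrow> Q \<chi> (d \<chi>) (t \<chi>)" by metis
  have t1I: "t1 \<in> Irr G" using triv by (simp add: t1_def)
  have "(of_int (\<Sum>\<chi>\<in>Irr G. int (d \<chi>) * t \<chi>) :: complex) = (\<Sum>\<chi>\<in>Irr G. \<chi> \<one> * \<chi> z)"
    using Q by (simp add: Q_def)
  also have "\<dots> = 0" using regular_character[OF fin z(1)] z(2) by simp
  finally have "(\<Sum>\<chi>\<in>Irr G. int (d \<chi>) * t \<chi>) = 0" by (simp only: of_int_eq_0_iff)
  then have "int (d t1) * t t1 + (\<Sum>\<chi>\<in>Irr G - {t1}. int (d \<chi>) * t \<chi>) = 0"
    using sum.remove[OF finite_Irr[OF fin] t1I, of "\<lambda>\<chi>. int (d \<chi>) * t \<chi>"] by simp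
  moreover have "d t1 = 1"
    using Q[OF t1I] by (simp add: Q_def t1_def)
  moreover have "t t1 = 1"
    using Q[OF t1I] z(1) by (simp add: Q_def t1_def)
  ultimately have "(\<Sum>\<chi>\<in>Irr G - {t1}. int (d \<chi>) * t \<chi>) = -1" by simp
  moreover have "3 dvd (\<Sum>\<chi>\<in>Irr G - {t1}. int (d \<chi>) * t \<chi>)"
    using Q by (intro dvd_sum) (auto simp: Q_def)
  ultimately show False by simp
qed

text \<open>\<open>K\<close> is a proper normal subgroup of largest order, so \<open>G/K\<close> is
  simple and perfect. If all Sylow subgroups for primes at least 5 were normal, the image of such a
  \<open>P\<close> in \<open>G/K\<close> would be trivial or everything. In the first case
  \<open>P\<close> lies in \<open>K\<close> and \<open>p\<close> cannot divide the order of
  \<open>G/K\<close>; in the second \<open>G/K\<close> is a \<open>p\<close>-group and has a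
  nontrivial centre. Only the primes 2 and 3 are left for \<open>G/K\<close>.\<close>

lemma perfect_nonnormal_sylow:
  assumes fin: "finite (carrier G)" and ne: "carrier G \<noteq> {\<one>}"
    and perfect: "derived G (carrier G) = carrier G"
  obtains p a m P where "prime p" "p \<ge> 5" "subgroup P G" "card P = p ^ a"
    "card (carrier G) = p ^ a * m" "\<not> p dvd m" "conj_stabilizer P \<noteq> carrier G"
proof (rule ccontr)
  note witness = that
  assume "\<not> thesis"
  then have stab: "conj_stabilizer P = carrier G" if "prime p" "p \<ge> 5" "subgroup P G" "card P = p ^ a"
    "card (carrier G) = p ^ a * m" "\<not> p dvd m" for p a m P using witness[OF that] by blast
  have c0: "card (carrier G) > 0" by (rule card_carrier_pos[OF fin])
  define S where "S K \<longleftrightarrow> K \<lhd> G \<and> K \<noteq> carrier G" for K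
  have S1: "S {\<one>}" using one_is_normal ne by (simp add: S_def)
  have Sle: "card K \<le> card (carrier G)" if "S K" for K
    using that normal_invE(1)[of K] subgroup.subset fin by (auto simp: S_def intro!: card_mono)
  obtain K where K: "S K" "\<And>L. S L \<Longrightarrow> card L \<le> card K"
    using ex_has_greatest_nat[of S "{\<one>}" card "Suc (card (carrier G))"] S1 Sle by (metis le_imp_less_Suc)
  interpret K: normal K G using K(1) by (simp add: S_def)
  let ?X = "G Mod K"
  interpret X: group ?X by (rule K.factorgroup_is_group)
  have hom: "(\<lambda>g. K #> g) \<in> hom G ?X" by (rule K.r_coset_hom_Mod)
  interpret h: group_hom G ?X "\<lambda>g. K #> g"
    using hom by (simp add: group_hom_def group_hom_axioms_def is_group X.is_group)
  have cX: "carrier ?X = (\<lambda>g. K #> g) ` carrier G" by (auto simp: FactGroup_def RCOSETS_def)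
  have finX: "finite (carrier ?X)" using fin by (simp add: cX)
  have one_iff: "K #> g = \<one>\<^bsub>?X\<^esub> \<longleftrightarrow> g \<in> K" if "g \<in> carrier G" for g
    using that K.subset rcos_self[OF that K.subgroup_axioms] K.rcos_const[OF is_group] by auto
  have index: "card (carrier ?X) * card K = card (carrier G)"
    using lagrange[OF K.subgroup_axioms] by (simp add: FactGroup_def Coset.order_def)
  have simple: "L = {\<one>\<^bsub>?X\<^esub>} \<or> L = carrier ?X" if L: "L \<lhd> ?X" for L
  proof -
    \<comment> \<open>The preimage of \<open>L\<close> is normal and contains \<open>K\<close>, so
      maximality leaves only \<open>K\<close> and \<open>G\<close> for it.\<close>
    define L' where "L' = {g \<in> carrier G. K #> g \<in> L}"
    have sL: "subgroup L ?X" and nL: "\<And>x h. x \<in> carrier ?X \<Longrightarrow> h \<in> L \<Longrightarrow> x \<otimes>\<^bsub>?X\<^esub> h \<otimes>\<^bsub>?X\<^esub> inv\<^bsub>?X\<^esub> x \<in> L"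
      using X.normal_invE[OF L] by auto
    have LX: "L \<subseteq> carrier ?X" using subgroup.subset[OF sL] .
    have "L' \<lhd> G"
      unfolding normal_inv_iff
    proof
      show "subgroup L' G"
      proof (rule subgroupI)
        have "\<one> \<in> L'" using subgroup.one_closed[OF sL] h.hom_one by (simp add: L'_def)
        then show "L' \<noteq> {}" by blast
        show "x \<otimes> y \<in> L'" if "x \<in> L'" "y \<in> L'" for x y
          using that subgroup.m_closed[OF sL] h.hom_mult[of x y] by (simp add: L'_def)
        show "inv x \<in> L'" if "x \<in> L'" for x
          using that subgroup.m_inv_closed[OF sL] h.hom_inv[of x] by (simp add: L'_def)
      qed (auto simp: L'_def)
      show "\<forall>x\<in>carrier G. \<forall>h\<in>L'. x \<otimes> h \<otimes> inv x \<in> L'"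
      proof (intro ballI)
        fix x y assume "x \<in> carrier G" "y \<in> L'"
        then show "x \<otimes> y \<otimes> inv x \<in> L'"
          using nL[of "K #> x" "K #> y"] h.hom_closed[of x] h.hom_mult[of "x \<otimes> y" "inv x"] h.hom_mult[of x y] h.hom_inv[of x]
          by (simp add: L'_def)
      qed
    qed
    moreover have KL: "K \<subseteq> L'"
    proof
      fix x assume x: "x \<in> K"
      then have xG: "x \<in> carrier G" using K.subset by blast
      have "K #> x = \<one>\<^bsub>?X\<^esub>" using one_iff[OF xG] x by blast
      then show "x \<in> L'" using subgroup.one_closed[OF sL] xG by (simp add: L'_def)
    qed
    moreover have "L' = K" if "S L'"
    proof -
      have "finite L'" using fin by (simp add: L'_def)
      then show ?thesis using K(2)[OF that] KL by (metis card_seteq)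
    qed
    ultimately have dichotomy: "L' = K \<or> L' = carrier G" by (auto simp: S_def)
    have L_img: "L = (\<lambda>g. K #> g) ` L'" using LX by (auto simp: L'_def cX)
    from dichotomy show ?thesis
    proof
      assume "L' = K"
      then have "x = \<one>\<^bsub>?X\<^esub>" if "x \<in> L" for x using that L_img one_iff K.subset by auto
      then show ?thesis using subgroup.one_closed[OF sL] by blast
    next
      assume "L' = carrier G"
      then show ?thesis using L_img cX by simp
    qed
  qed
  have perfectX: "derived ?X (carrier ?X) = carrier ?X"
    unfolding cX using h.derived_img[of "carrier G"] perfect by simp
  have neX: "carrier ?X \<noteq> {\<one>\<^bsub>?X\<^esub>}"
  proof
    assume "carrier ?X = {\<one>\<^bsub>?X\<^esub>}"
    then have "g \<in> K" if "g \<in> carrier G" for g using one_iff[OF that] that by (auto simp: cX)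
    then show False using K(1) K.subset by (auto simp: S_def)
  qed
  have "p = 2 \<or> p = 3" if p: "prime p" "p dvd card (carrier ?X)" for p
  proof (rule ccontr)
    assume n23: "\<not> (p = 2 \<or> p = 3)"
    have "p \<ge> 5"
    proof (rule ccontr)
      assume "\<not> p \<ge> 5"
      then have "p = 0 \<or> p = 1 \<or> p = 4" using n23 by auto
      moreover have "\<not> prime (4::nat)"
      proof
        assume "prime (4::nat)"
        moreover have "(2::nat) dvd 4" by simp
        ultimately have "(2::nat) = 1 \<or> (2::nat) = 4" unfolding prime_nat_iff by blast
        then show False by simp
      qed
      ultimately show False using p(1) by auto
    qed
    obtain a m where am: "card (carrier G) = p ^ a * m" "\<not> p dvd m" using multiplicity_split[OF p(1) c0] by blast
    obtain P where P: "subgroup P G" "card P = p ^ a"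
      using sylow_thm[OF p(1) is_group, of a m] am fin by (auto simp: Coset.order_def)
    have PG: "P \<subseteq> carrier G" using subgroup.subset[OF P(1)] .
    have "conj_stabilizer P = carrier G" by (rule stab[OF p(1) \<open>p \<ge> 5\<close> P am])
    then have "P \<lhd> G" unfolding normal_inv_iff using P(1) by (auto simp: conj_stabilizer_def)
    have "(\<lambda>g. K #> g) ` P \<lhd> ?X"
      unfolding X.normal_inv_iff
    proof
      show "subgroup ((\<lambda>g. K #> g) ` P) ?X" by (rule h.subgroup_img_is_subgroup[OF P(1)])
      show "\<forall>x\<in>carrier ?X. \<forall>y\<in>(\<lambda>g. K #> g) ` P. x \<otimes>\<^bsub>?X\<^esub> y \<otimes>\<^bsub>?X\<^esub> inv\<^bsub>?X\<^esub> x \<in> (\<lambda>g. K #> g) ` P"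
      proof (intro ballI)
        fix x y assume "x \<in> carrier ?X" "y \<in> (\<lambda>g. K #> g) ` P"
        then obtain g k where gk: "g \<in> carrier G" "k \<in> P" "x = K #> g" "y = K #> k" by (auto simp: cX)
        then have "x \<otimes>\<^bsub>?X\<^esub> y \<otimes>\<^bsub>?X\<^esub> inv\<^bsub>?X\<^esub> x = K #> (g \<otimes> k \<otimes> inv g)"
          using PG h.hom_mult[of "g \<otimes> k" "inv g"] h.hom_mult[of g k] h.hom_inv[of g] by auto
        then show "x \<otimes>\<^bsub>?X\<^esub> y \<otimes>\<^bsub>?X\<^esub> inv\<^bsub>?X\<^esub> x \<in> (\<lambda>g. K #> g) ` P"
          using normal_invE(2)[OF \<open>P \<lhd> G\<close> gk(1,2)] by auto
      qed
    qed
    then have "(\<lambda>g. K #> g) ` P = {\<one>\<^bsub>?X\<^esub>} \<or> (\<lambda>g. K #> g) ` P = carrier ?X" by (rule simple)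
    then show False
    proof
      assume triv: "(\<lambda>g. K #> g) ` P = {\<one>\<^bsub>?X\<^esub>}"
      have "P \<subseteq> K"
      proof
        fix x assume x: "x \<in> P"
        then have "K #> x = \<one>\<^bsub>?X\<^esub>" using triv by (metis imageI singletonD)
        then show "x \<in> K" using one_iff[of x] x PG by blast
      qed
      then have "subgroup P (G\<lparr>carrier := K\<rparr>)" by (rule subgroup_incl[OF P(1) K.subgroup_axioms])
      from group.lagrange[OF subgroup_imp_group[OF K.subgroup_axioms] this]
      have "card (rcosets\<^bsub>G\<lparr>carrier := K\<rparr>\<^esub> P) * p ^ a = card K" using P(2) by (simp add: Coset.order_def)
      then have "p ^ a dvd card K" by (rule dvdI[OF trans[OF sym mult.commute]])
      \<comment> \<open>One factor \<open>p\<close> from the quotient and p^a from \<open>K\<close>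
        exceed the exact power of \<open>p\<close> in the order of \<open>G\<close>.\<close>
      then have "p * p ^ a dvd card (carrier ?X) * card K" by (rule mult_dvd_mono[OF p(2)])
      then have "p ^ a * p dvd p ^ a * m" using index am by (simp add: mult.commute)
      then show False using am(2) p(1) by (simp add: prime_gt_0_nat)
    next
      assume surj: "(\<lambda>g. K #> g) ` P = carrier ?X"
      have "(\<lambda>g. K #> g) \<in> hom (G\<lparr>carrier := P\<rparr>) ?X"
        by (rule hom_restrict_carrier[OF hom PG])
      then obtain x where x: "x \<in> carrier ?X" "x \<noteq> \<one>\<^bsub>?X\<^esub>"
        "\<And>g. g \<in> P \<Longrightarrow> (K #> g) \<otimes>\<^bsub>?X\<^esub> x \<otimes>\<^bsub>?X\<^esub> inv\<^bsub>?X\<^esub> (K #> g) = x"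
        using X.p_group_center[OF finX subgroup_imp_group[OF P(1)] p(1) _ _ p(2), of a] P(2) by auto
      have "x = \<one>\<^bsub>?X\<^esub>"
      proof (rule X.perfect_simple_center[OF simple perfectX neX x(1)])
        fix y assume "y \<in> carrier ?X"
        then obtain g where "g \<in> P" "y = K #> g" using surj by auto
        then show "y \<otimes>\<^bsub>?X\<^esub> x \<otimes>\<^bsub>?X\<^esub> inv\<^bsub>?X\<^esub> y = x" using x(3) by simp
      qed
      then show False using x(2) by simp
    qed
  qed
  then show False using X.no_perfect_simple_23_group[OF finX neX simple perfectX] by blast
qed

section \<open>Assembly of the bound\<close>

lemma degree_sum_nonnormal_sylow:
  assumes fin: "finite (carrier G)" and p: "prime p" and N: "N \<lhd> G"
    and P: "subgroup P G" "P \<subseteq> N" "card P = p ^ a" "card N = p ^ a * m" "\<not> p dvd m"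
    and nn: "\<not> N \<subseteq> conj_stabilizer P"
  shows "degree_sum G \<ge> (1 + real p) * degree_sum (G Mod N)"
proof -
  have sN: "subgroup N G" using N normal_invE(1) by blast
  have "normal_supplement N G (conj_stabilizer P)"
  proof (intro normal_supplement.intro normal_supplement_axioms.intro N fin)
    show "subgroup (conj_stabilizer P) G" by (rule subgroup_conj_stabilizer[OF subgroup.subset[OF P(1)]])
    show "\<exists>n\<in>N. \<exists>h\<in>conj_stabilizer P. g = n \<otimes> h" if "g \<in> carrier G" for g
      by (rule frattini[OF fin p N P that])
  qed
  then show ?thesis
    using normal_supplement.degree_sum_lower_bound[OF _ nn]
      sylow_normalizer_intersection[OF fin p sN P] by blast
qed

end

theorem theorem1p2:
  fixes G :: "('a, 'b) monoid_scheme" and N :: "'a set"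
  assumes "group G" and "finite (carrier G)"
    and "N \<lhd> G" and "\<not> solvable (G\<lparr>carrier := N\<rparr>)"
  shows "degree_sum G \<ge> 6 * degree_sum (G Mod N)"
proof -
  interpret group G by fact
  note fin = assms(2)
  obtain D where D: "D \<lhd> G" "D \<subseteq> N" "derived G D = D" "D \<noteq> {\<one>\<^bsub>G\<^esub>}"
    using perfect_core[OF fin assms(3,4)] by blast
  have sD: "subgroup D G" using D(1) normal_invE(1) by blast
  interpret GD: group "G\<lparr>carrier := D\<rparr>" by (rule subgroup_imp_group[OF sD])
  have DG: "D \<subseteq> carrier G" using subgroup.subset[OF sD] .
  obtain p a m P where P: "prime p" "p \<ge> 5" "subgroup P (G\<lparr>carrier := D\<rparr>)" "card P = p ^ a"
    "card D = p ^ a * m" "\<not> p dvd m" "GD.conj_stabilizer P \<noteq> D"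
  proof (rule GD.perfect_nonnormal_sylow)
    show "finite (carrier (G\<lparr>carrier := D\<rparr>))" using DG fin finite_subset by auto
    show "carrier (G\<lparr>carrier := D\<rparr>) \<noteq> {\<one>\<^bsub>G\<lparr>carrier := D\<rparr>\<^esub>}" using D(4) by simp
    show "derived (G\<lparr>carrier := D\<rparr>) (carrier (G\<lparr>carrier := D\<rparr>)) = carrier (G\<lparr>carrier := D\<rparr>)"
      using derived_consistent[OF order_refl sD] D(3) by simp
  qed (use that in auto)
  \<comment> \<open>Non-normality was obtained inside \<open>D\<close>, while the supplement is the
    normalizer in \<open>G\<close>; intersecting with \<open>D\<close> relates the two.\<close>
  have "GD.conj_stabilizer P = conj_stabilizer P \<inter> D"
    using DG by (auto simp: GD.conj_stabilizer_def conj_stabilizer_def m_inv_consistent[OF sD] cong: image_cong)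
  then have "\<not> D \<subseteq> conj_stabilizer P" using P(7) by blast
  moreover have "P \<subseteq> D" using subgroup.subset[OF P(3)] by simp
  ultimately have ge: "(1 + real p) * degree_sum (G Mod D) \<le> degree_sum G"
    using degree_sum_nonnormal_sylow[OF fin P(1) D(1) incl_subgroup[OF sD P(3)] _ P(4,5,6)] by blast
  have le: "degree_sum (G Mod N) \<le> degree_sum (G Mod D)"
    by (rule degree_sum_Mod_antimono[OF fin D(1) assms(3) D(2)])
  interpret Q: group "G Mod N" using normal.factorgroup_is_group[OF assms(3)] .
  have "0 \<le> degree_sum (G Mod N)"
    unfolding degree_sum_def using Irr_degree[OF Q.is_group] by (intro sum_nonneg) fastforce
  \<comment> \<open>The constant 6 is 1 + p at the smallest admissible value p = 5.\<close>
  then have "6 * degree_sum (G Mod N) \<le> (1 + real p) * degree_sum (G Mod N)"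
    using P(2) by (intro mult_right_mono) auto
  also have "\<dots> \<le> (1 + real p) * degree_sum (G Mod D)" using le by (intro mult_left_mono) auto
  finally show ?thesis using ge by simp
qed

end
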